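(* Let $\mathbb{T}$ be the theory of any finitary algebraic structure such that the variety $\mathbb{V}(\mathbb{T})$ is congruence modular. Let $\mathbb{E}$ be a regular category with suprema of chains of subobjects which are stable under pullback along split epimorphisms and stable under intersection with subobjects. Then the category $\mathbb{T}(\mathbb{E})$ of internal $\mathbb{T}$-algebras in $\mathbb{E}$ is congruence modular as well. This is the case, in particular, when $\mathbb{E}$ is any topos with suprema of chains of subobjects.
   Context: $\mathbb{V}(\mathbb{T})$ is the variety of $\mathbb{T}$-algebras in $Set$, and $\mathbb{T}(\mathbb{E})$ is the category of internal $\mathbb{T}$-algebras in the finitely complete category $\mathbb{E}$. A chain of subobjects of $X$ is an increasing sequence $(A_i)_{i\in\mathbb{N}}$ of subobjects of $X$; its supremum $\Sigma_{i\in\mathbb{N}}A_i$ is taken in the ordered set of subobjects of $X$. Stability under pullback along split epimorphisms means that $g^{*}(\Sigma_iA_i)=\Sigma_i g^{*}(A_i)$ for every split epimorphism $g$ with codomain $X$; stability under intersection with subobjects means that $\Sigma_i(A_i\cap U)=(\Sigma_iA_i)\cap U$ for every subobject $U$ of $X$. A (finitely complete) category is congruence modular when any pair $(R,S)$ of internal equivalence relations on an object $X$ has a supremum $R\vee S$ among the equivalence relations on $X$ and, for any triple $(R,S,T)$ of equivalence relations on $X$ with $R\subset T$, one has $(R\vee S)\cap T=R\vee(S\cap T)$. *)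

theory Defs
  imports Main
begin

section \<open>Categories\<close>

text \<open>
  Hom-sets need not be disjoint: an arrow is always considered together with its domain and
  codomain, which are therefore explicit arguments below.  Nothing is assumed about
  \<open>hom C A B\<close> when \<open>A\<close> or \<open>B\<close> is not an object.
\<close>

record ('o, 'm) cat =
  obj :: "'o set"
  hom :: "'o \<Rightarrow> 'o \<Rightarrow> 'm set"
  idt :: "'o \<Rightarrow> 'm"
  cmp :: "'m \<Rightarrow> 'm \<Rightarrow> 'm"  (infixl \<open>\<odot>\<index>\<close> 70)

definition category :: "('o, 'm) cat \<Rightarrow> bool" where
  "category C \<longleftrightarrow>
     (\<forall>A\<in>obj C. idt C A \<in> hom C A A) \<and>
     (\<forall>A\<in>obj C. \<forall>B\<in>obj C. \<forall>D\<in>obj C. \<forall>f\<in>hom C A B. \<forall>g\<in>hom C B D.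
        g \<odot>\<^bsub>C\<^esub> f \<in> hom C A D) \<and>
     (\<forall>A\<in>obj C. \<forall>B\<in>obj C. \<forall>f\<in>hom C A B.
        f \<odot>\<^bsub>C\<^esub> idt C A = f \<and> idt C B \<odot>\<^bsub>C\<^esub> f = f) \<and>
     (\<forall>A\<in>obj C. \<forall>B\<in>obj C. \<forall>D\<in>obj C. \<forall>F\<in>obj C.
        \<forall>f\<in>hom C A B. \<forall>g\<in>hom C B D. \<forall>h\<in>hom C D F.
        (h \<odot>\<^bsub>C\<^esub> g) \<odot>\<^bsub>C\<^esub> f = h \<odot>\<^bsub>C\<^esub> (g \<odot>\<^bsub>C\<^esub> f))"


section \<open>Finite limits\<close>

text \<open>
  A finite diagram has vertices \<open>D 0, \<dots>, D (n - 1)\<close> and a finite set \<open>W\<close> of edges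
  \<open>(i, j, f)\<close>, with \<open>f\<close> an arrow from \<open>D i\<close> to \<open>D j\<close>.  Commutation relations
  between the edges would not change the cones, so they are not part of the data.
\<close>

definition is_diagram ::
    "('o, 'm) cat \<Rightarrow> nat \<Rightarrow> (nat \<Rightarrow> 'o) \<Rightarrow> (nat \<times> nat \<times> 'm) set \<Rightarrow> bool" where
  "is_diagram C n D W \<longleftrightarrow>
     (\<forall>i<n. D i \<in> obj C) \<and> finite W \<and>
     (\<forall>(i, j, f)\<in>W. i < n \<and> j < n \<and> f \<in> hom C (D i) (D j))"

definition is_cone ::
    "('o, 'm) cat \<Rightarrow> nat \<Rightarrow> (nat \<Rightarrow> 'o) \<Rightarrow> (nat \<times> nat \<times> 'm) set \<Rightarrow> 'o \<Rightarrow> (nat \<Rightarrow> 'm) \<Rightarrow> bool" where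
  "is_cone C n D W L p \<longleftrightarrow>
     L \<in> obj C \<and> (\<forall>i<n. p i \<in> hom C L (D i)) \<and> (\<forall>(i, j, f)\<in>W. f \<odot>\<^bsub>C\<^esub> p i = p j)"

definition is_limit ::
    "('o, 'm) cat \<Rightarrow> nat \<Rightarrow> (nat \<Rightarrow> 'o) \<Rightarrow> (nat \<times> nat \<times> 'm) set \<Rightarrow> 'o \<Rightarrow> (nat \<Rightarrow> 'm) \<Rightarrow> bool" where
  "is_limit C n D W L p \<longleftrightarrow>
     is_cone C n D W L p \<and>
     (\<forall>Z q. is_cone C n D W Z q \<longrightarrow> (\<exists>!h. h \<in> hom C Z L \<and> (\<forall>i<n. p i \<odot>\<^bsub>C\<^esub> h = q i)))"

definition finitely_complete :: "('o, 'm) cat \<Rightarrow> bool" where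
  "finitely_complete C \<longleftrightarrow>
     category C \<and> (\<forall>n D W. is_diagram C n D W \<longrightarrow> (\<exists>L p. is_limit C n D W L p))"

definition is_terminal :: "('o, 'm) cat \<Rightarrow> 'o \<Rightarrow> bool" where
  "is_terminal C I \<longleftrightarrow> I \<in> obj C \<and> (\<forall>Z\<in>obj C. \<exists>!h. h \<in> hom C Z I)"

definition is_product :: "('o, 'm) cat \<Rightarrow> 'o \<Rightarrow> 'o \<Rightarrow> 'o \<Rightarrow> 'm \<Rightarrow> 'm \<Rightarrow> bool" where
  "is_product C A B P p q \<longleftrightarrow>
     A \<in> obj C \<and> B \<in> obj C \<and> P \<in> obj C \<and> p \<in> hom C P A \<and> q \<in> hom C P B \<and>
     (\<forall>Z\<in>obj C. \<forall>u\<in>hom C Z A. \<forall>v\<in>hom C Z B.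
        \<exists>!h. h \<in> hom C Z P \<and> p \<odot>\<^bsub>C\<^esub> h = u \<and> q \<odot>\<^bsub>C\<^esub> h = v)"

definition is_pullback ::
    "('o, 'm) cat \<Rightarrow> 'o \<Rightarrow> 'o \<Rightarrow> 'o \<Rightarrow> 'm \<Rightarrow> 'm \<Rightarrow> 'o \<Rightarrow> 'm \<Rightarrow> 'm \<Rightarrow> bool" where
  "is_pullback C A B X f g P p q \<longleftrightarrow>
     A \<in> obj C \<and> B \<in> obj C \<and> X \<in> obj C \<and> f \<in> hom C A X \<and> g \<in> hom C B X \<and>
     P \<in> obj C \<and> p \<in> hom C P A \<and> q \<in> hom C P B \<and> f \<odot>\<^bsub>C\<^esub> p = g \<odot>\<^bsub>C\<^esub> q \<and>
     (\<forall>Z\<in>obj C. \<forall>u\<in>hom C Z A. \<forall>v\<in>hom C Z B. f \<odot>\<^bsub>C\<^esub> u = g \<odot>\<^bsub>C\<^esub> v \<longrightarrow>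
        (\<exists>!h. h \<in> hom C Z P \<and> p \<odot>\<^bsub>C\<^esub> h = u \<and> q \<odot>\<^bsub>C\<^esub> h = v))"


section \<open>Bounds in preordered sets\<close>

text \<open>
  Subobjects and relations are handled through representatives; the representatives form a
  preordered set whose quotient is the ordered set in question.  Suprema and infima are
  thus determined only up to mutual \<open>le\<close>, which is equality of subobjects.
\<close>

definition is_lub :: "('a \<Rightarrow> 'a \<Rightarrow> bool) \<Rightarrow> 'a set \<Rightarrow> 'a set \<Rightarrow> 'a \<Rightarrow> bool" where
  "is_lub le P B u \<longleftrightarrow> u \<in> P \<and> (\<forall>b\<in>B. le b u) \<and> (\<forall>v\<in>P. (\<forall>b\<in>B. le b v) \<longrightarrow> le u v)"

definition is_glb :: "('a \<Rightarrow> 'a \<Rightarrow> bool) \<Rightarrow> 'a set \<Rightarrow> 'a set \<Rightarrow> 'a \<Rightarrow> bool" where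
  "is_glb le P B u \<longleftrightarrow> u \<in> P \<and> (\<forall>b\<in>B. le u b) \<and> (\<forall>v\<in>P. (\<forall>b\<in>B. le v b) \<longrightarrow> le v u)"


section \<open>Subobjects and suprema of chains\<close>

definition monic :: "('o, 'm) cat \<Rightarrow> 'o \<Rightarrow> 'o \<Rightarrow> 'm \<Rightarrow> bool" where
  "monic C A X m \<longleftrightarrow>
     m \<in> hom C A X \<and>
     (\<forall>Z\<in>obj C. \<forall>g\<in>hom C Z A. \<forall>h\<in>hom C Z A. m \<odot>\<^bsub>C\<^esub> g = m \<odot>\<^bsub>C\<^esub> h \<longrightarrow> g = h)"

definition subobjects :: "('o, 'm) cat \<Rightarrow> 'o \<Rightarrow> ('o \<times> 'm) set" where
  "subobjects C X = {(A, m). A \<in> obj C \<and> monic C A X m}"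

definition sub_le :: "('o, 'm) cat \<Rightarrow> 'o \<times> 'm \<Rightarrow> 'o \<times> 'm \<Rightarrow> bool" where
  "sub_le C M N \<longleftrightarrow> (\<exists>k\<in>hom C (fst M) (fst N). snd N \<odot>\<^bsub>C\<^esub> k = snd M)"

definition is_intersection ::
    "('o, 'm) cat \<Rightarrow> 'o \<Rightarrow> 'o \<times> 'm \<Rightarrow> 'o \<times> 'm \<Rightarrow> 'o \<times> 'm \<Rightarrow> bool" where
  "is_intersection C X M N I \<longleftrightarrow> is_glb (sub_le C) (subobjects C X) {M, N} I"

text \<open>\<open>N\<close> represents \<open>g\<^sup>* M\<close>, where \<open>g\<close> is an arrow from \<open>Y\<close> to \<open>X\<close>.\<close>

definition is_inverse_image ::
    "('o, 'm) cat \<Rightarrow> 'o \<Rightarrow> 'o \<Rightarrow> 'm \<Rightarrow> 'o \<times> 'm \<Rightarrow> 'o \<times> 'm \<Rightarrow> bool" where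
  "is_inverse_image C Y X g M N \<longleftrightarrow>
     (\<exists>q. is_pullback C Y (fst M) X g (snd M) (fst N) (snd N) q)"

definition is_chain :: "('o, 'm) cat \<Rightarrow> 'o \<Rightarrow> (nat \<Rightarrow> 'o \<times> 'm) \<Rightarrow> bool" where
  "is_chain C X A \<longleftrightarrow> (\<forall>i. A i \<in> subobjects C X) \<and> (\<forall>i. sub_le C (A i) (A (Suc i)))"

definition is_chain_sup :: "('o, 'm) cat \<Rightarrow> 'o \<Rightarrow> (nat \<Rightarrow> 'o \<times> 'm) \<Rightarrow> 'o \<times> 'm \<Rightarrow> bool" where
  "is_chain_sup C X A U \<longleftrightarrow> is_lub (sub_le C) (subobjects C X) (range A) U"

definition has_chain_suprema :: "('o, 'm) cat \<Rightarrow> bool" where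
  "has_chain_suprema C \<longleftrightarrow>
     (\<forall>X\<in>obj C. \<forall>A. is_chain C X A \<longrightarrow> (\<exists>U. is_chain_sup C X A U))"

definition split_epi :: "('o, 'm) cat \<Rightarrow> 'o \<Rightarrow> 'o \<Rightarrow> 'm \<Rightarrow> bool" where
  "split_epi C Y X g \<longleftrightarrow> g \<in> hom C Y X \<and> (\<exists>s\<in>hom C X Y. g \<odot>\<^bsub>C\<^esub> s = idt C X)"

definition chain_suprema_stable_split_epi :: "('o, 'm) cat \<Rightarrow> bool" where
  "chain_suprema_stable_split_epi C \<longleftrightarrow>
     (\<forall>X\<in>obj C. \<forall>Y\<in>obj C. \<forall>g A U A' U'.
        split_epi C Y X g \<and> is_chain C X A \<and> is_chain_sup C X A U \<and>
        (\<forall>i. is_inverse_image C Y X g (A i) (A' i)) \<and> is_inverse_image C Y X g U U' \<longrightarrow>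
        is_chain_sup C Y A' U')"

definition chain_suprema_stable_intersection :: "('o, 'm) cat \<Rightarrow> bool" where
  "chain_suprema_stable_intersection C \<longleftrightarrow>
     (\<forall>X\<in>obj C. \<forall>A U V A' U'.
        is_chain C X A \<and> is_chain_sup C X A U \<and> V \<in> subobjects C X \<and>
        (\<forall>i. is_intersection C X (A i) V (A' i)) \<and> is_intersection C X U V U' \<longrightarrow>
        is_chain_sup C X A' U')"


section \<open>Regular categories\<close>

definition is_coequalizer ::
    "('o, 'm) cat \<Rightarrow> 'o \<Rightarrow> 'o \<Rightarrow> 'm \<Rightarrow> 'm \<Rightarrow> 'o \<Rightarrow> 'm \<Rightarrow> bool" where
  "is_coequalizer C K A u v Q e \<longleftrightarrow>
     K \<in> obj C \<and> A \<in> obj C \<and> Q \<in> obj C \<and> u \<in> hom C K A \<and> v \<in> hom C K A \<and>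
     e \<in> hom C A Q \<and> e \<odot>\<^bsub>C\<^esub> u = e \<odot>\<^bsub>C\<^esub> v \<and>
     (\<forall>Y\<in>obj C. \<forall>g\<in>hom C A Y. g \<odot>\<^bsub>C\<^esub> u = g \<odot>\<^bsub>C\<^esub> v \<longrightarrow>
        (\<exists>!h. h \<in> hom C Q Y \<and> h \<odot>\<^bsub>C\<^esub> e = g))"

definition regular_epi :: "('o, 'm) cat \<Rightarrow> 'o \<Rightarrow> 'o \<Rightarrow> 'm \<Rightarrow> bool" where
  "regular_epi C A Q e \<longleftrightarrow> (\<exists>K u v. is_coequalizer C K A u v Q e)"

definition regular_category :: "('o, 'm) cat \<Rightarrow> bool" where
  "regular_category C \<longleftrightarrow>
     finitely_complete C \<and>
     (\<forall>A B f K p q. is_pullback C A A B f f K p q \<longrightarrow> (\<exists>Q e. is_coequalizer C K A p q Q e)) \<and>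
     (\<forall>A B X f g P p q. is_pullback C A B X f g P p q \<and> regular_epi C B X g \<longrightarrow>
        regular_epi C P A p)"


section \<open>Toposes\<close>

definition has_subobject_classifier :: "('o, 'm) cat \<Rightarrow> bool" where
  "has_subobject_classifier C \<longleftrightarrow>
     (\<exists>I \<Omega> t. is_terminal C I \<and> \<Omega> \<in> obj C \<and> t \<in> hom C I \<Omega> \<and>
        (\<forall>X\<in>obj C. \<forall>(A, m)\<in>subobjects C X.
           \<exists>!\<chi>. \<chi> \<in> hom C X \<Omega> \<and> (\<exists>u. is_pullback C X I \<Omega> \<chi> t A m u)))"

text \<open>\<open>E\<close> is \<open>B\<^sup>A\<close>, with evaluation \<open>ev\<close> on the product \<open>P\<close> of \<open>E\<close> and \<open>A\<close>; below \<open>k\<close> is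
  the arrow \<open>h \<times> A\<close>.\<close>

definition is_exponential ::
    "('o, 'm) cat \<Rightarrow> 'o \<Rightarrow> 'o \<Rightarrow> 'o \<Rightarrow> 'o \<Rightarrow> 'm \<Rightarrow> 'm \<Rightarrow> 'm \<Rightarrow> bool" where
  "is_exponential C A B E P p p' ev \<longleftrightarrow>
     B \<in> obj C \<and> is_product C E A P p p' \<and> ev \<in> hom C P B \<and>
     (\<forall>Z Q q q' f. is_product C Z A Q q q' \<and> f \<in> hom C Q B \<longrightarrow>
        (\<exists>!h. h \<in> hom C Z E \<and>
           (\<exists>k\<in>hom C Q P. p \<odot>\<^bsub>C\<^esub> k = h \<odot>\<^bsub>C\<^esub> q \<and> p' \<odot>\<^bsub>C\<^esub> k = q' \<and> ev \<odot>\<^bsub>C\<^esub> k = f)))"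

definition topos :: "('o, 'm) cat \<Rightarrow> bool" where
  "topos C \<longleftrightarrow>
     finitely_complete C \<and>
     (\<forall>A\<in>obj C. \<forall>B\<in>obj C. \<exists>E P p p' ev. is_exponential C A B E P p p' ev) \<and>
     has_subobject_classifier C"


section \<open>Internal equivalence relations and congruence modularity\<close>

definition relations :: "('o, 'm) cat \<Rightarrow> 'o \<Rightarrow> ('o \<times> 'm \<times> 'm) set" where
  "relations C X = {(R, d0, d1). R \<in> obj C \<and> d0 \<in> hom C R X \<and> d1 \<in> hom C R X \<and>
     (\<forall>Z\<in>obj C. \<forall>g\<in>hom C Z R. \<forall>h\<in>hom C Z R.
        d0 \<odot>\<^bsub>C\<^esub> g = d0 \<odot>\<^bsub>C\<^esub> h \<and> d1 \<odot>\<^bsub>C\<^esub> g = d1 \<odot>\<^bsub>C\<^esub> h \<longrightarrow> g = h)}"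

definition rel_le :: "('o, 'm) cat \<Rightarrow> 'o \<times> 'm \<times> 'm \<Rightarrow> 'o \<times> 'm \<times> 'm \<Rightarrow> bool" where
  "rel_le C = (\<lambda>(R, d0, d1) (S, e0, e1).
     \<exists>k\<in>hom C R S. e0 \<odot>\<^bsub>C\<^esub> k = d0 \<and> e1 \<odot>\<^bsub>C\<^esub> k = d1)"

definition rel_eq :: "('o, 'm) cat \<Rightarrow> 'o \<times> 'm \<times> 'm \<Rightarrow> 'o \<times> 'm \<times> 'm \<Rightarrow> bool" where
  "rel_eq C R S \<longleftrightarrow> rel_le C R S \<and> rel_le C S R"

definition equivalence_relations :: "('o, 'm) cat \<Rightarrow> 'o \<Rightarrow> ('o \<times> 'm \<times> 'm) set" where
  "equivalence_relations C X = {(R, d0, d1). (R, d0, d1) \<in> relations C X \<and>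
     (\<exists>s\<in>hom C X R. d0 \<odot>\<^bsub>C\<^esub> s = idt C X \<and> d1 \<odot>\<^bsub>C\<^esub> s = idt C X) \<and>
     (\<exists>\<sigma>\<in>hom C R R. d0 \<odot>\<^bsub>C\<^esub> \<sigma> = d1 \<and> d1 \<odot>\<^bsub>C\<^esub> \<sigma> = d0) \<and>
     (\<exists>P p q. is_pullback C R R X d1 d0 P p q \<and>
        (\<exists>t\<in>hom C P R. d0 \<odot>\<^bsub>C\<^esub> t = d0 \<odot>\<^bsub>C\<^esub> p \<and> d1 \<odot>\<^bsub>C\<^esub> t = d1 \<odot>\<^bsub>C\<^esub> q))}"

definition is_rel_intersection ::
    "('o, 'm) cat \<Rightarrow> 'o \<Rightarrow> 'o \<times> 'm \<times> 'm \<Rightarrow> 'o \<times> 'm \<times> 'm \<Rightarrow> 'o \<times> 'm \<times> 'm \<Rightarrow> bool" where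
  "is_rel_intersection C X R S I \<longleftrightarrow> is_glb (rel_le C) (relations C X) {R, S} I"

definition is_equiv_join ::
    "('o, 'm) cat \<Rightarrow> 'o \<Rightarrow> 'o \<times> 'm \<times> 'm \<Rightarrow> 'o \<times> 'm \<times> 'm \<Rightarrow> 'o \<times> 'm \<times> 'm \<Rightarrow> bool" where
  "is_equiv_join C X R S J \<longleftrightarrow> is_lub (rel_le C) (equivalence_relations C X) {R, S} J"

definition congruence_modular :: "('o, 'm) cat \<Rightarrow> bool" where
  "congruence_modular C \<longleftrightarrow>
     finitely_complete C \<and>
     (\<forall>X\<in>obj C.
        (\<forall>R\<in>equivalence_relations C X. \<forall>S\<in>equivalence_relations C X.
           \<exists>J. is_equiv_join C X R S J) \<and>
        (\<forall>R\<in>equivalence_relations C X. \<forall>S\<in>equivalence_relations C X.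
         \<forall>T\<in>equivalence_relations C X. rel_le C R T \<longrightarrow>
           (\<forall>J I M K.
              is_equiv_join C X R S J \<and> is_rel_intersection C X J T I \<and>
              is_rel_intersection C X S T M \<and> is_equiv_join C X R M K \<longrightarrow>
              rel_eq C I K)))"


section \<open>Finitary algebraic theories and their internal algebras\<close>

datatype 'f trm = Var nat | App 'f "'f trm list"

text \<open>
  An axiom \<open>(k, s, t)\<close> is the equation \<open>s = t\<close> between terms in the
  variables \<open>0, \<dots>, k - 1\<close>.
\<close>

record 'f alg_theory =
  ops :: "'f set"
  arity :: "'f \<Rightarrow> nat"
  axioms :: "(nat \<times> 'f trm \<times> 'f trm) set"

fun wf_trm :: "'f alg_theory \<Rightarrow> nat \<Rightarrow> 'f trm \<Rightarrow> bool" where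
  "wf_trm T k (Var i) \<longleftrightarrow> i < k"
| "wf_trm T k (App f ts) \<longleftrightarrow>
     f \<in> ops T \<and> length ts = arity T f \<and> (\<forall>t\<in>set ts. wf_trm T k t)"

definition algebraic_theory :: "'f alg_theory \<Rightarrow> bool" where
  "algebraic_theory T \<longleftrightarrow> (\<forall>(k, s, t)\<in>axioms T. wf_trm T k s \<and> wf_trm T k t)"

text \<open>A chosen \<open>n\<close>-th power of \<open>X\<close>; it is meaningful whenever such a power exists.\<close>

definition power_cone :: "('o, 'm) cat \<Rightarrow> 'o \<Rightarrow> nat \<Rightarrow> 'o \<times> (nat \<Rightarrow> 'm)" where
  "power_cone C X n = (SOME (P, p). is_limit C n (\<lambda>_. X) {} P p)"

definition pow_obj :: "('o, 'm) cat \<Rightarrow> 'o \<Rightarrow> nat \<Rightarrow> 'o" where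
  "pow_obj C X n = fst (power_cone C X n)"

definition pow_proj :: "('o, 'm) cat \<Rightarrow> 'o \<Rightarrow> nat \<Rightarrow> nat \<Rightarrow> 'm" where
  "pow_proj C X n = snd (power_cone C X n)"

text \<open>The arrow from \<open>Z\<close> to the \<open>n\<close>-th power of \<open>X\<close> with components
  \<open>q 0, \<dots>, q (n - 1)\<close>.\<close>

definition tuple :: "('o, 'm) cat \<Rightarrow> 'o \<Rightarrow> nat \<Rightarrow> 'o \<Rightarrow> (nat \<Rightarrow> 'm) \<Rightarrow> 'm" where
  "tuple C X n Z q =
     (THE h. h \<in> hom C Z (pow_obj C X n) \<and> (\<forall>i<n. pow_proj C X n i \<odot>\<^bsub>C\<^esub> h = q i))"

text \<open>The arrow from the \<open>k\<close>-th power of \<open>X\<close> to \<open>X\<close> denoted by a term in \<open>k\<close> variables.\<close>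

primrec interp :: "('o, 'm) cat \<Rightarrow> 'o \<Rightarrow> ('f \<Rightarrow> 'm) \<Rightarrow> nat \<Rightarrow> 'f trm \<Rightarrow> 'm" where
  "interp C X \<alpha> k (Var i) = pow_proj C X k i"
| "interp C X \<alpha> k (App f ts) =
     \<alpha> f \<odot>\<^bsub>C\<^esub> tuple C X (length ts) (pow_obj C X k) (\<lambda>i. map (interp C X \<alpha> k) ts ! i)"

definition internal_algebras :: "'f alg_theory \<Rightarrow> ('o, 'm) cat \<Rightarrow> ('o \<times> ('f \<Rightarrow> 'm)) set" where
  "internal_algebras T C = {(X, \<alpha>). X \<in> obj C \<and>
     (\<forall>f\<in>ops T. \<alpha> f \<in> hom C (pow_obj C X (arity T f)) X) \<and>
     (\<forall>f. f \<notin> ops T \<longrightarrow> \<alpha> f = undefined) \<and>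
     (\<forall>(k, s, t)\<in>axioms T. interp C X \<alpha> k s = interp C X \<alpha> k t)}"

definition algebra_homs ::
    "'f alg_theory \<Rightarrow> ('o, 'm) cat \<Rightarrow> 'o \<times> ('f \<Rightarrow> 'm) \<Rightarrow> 'o \<times> ('f \<Rightarrow> 'm) \<Rightarrow> 'm set" where
  "algebra_homs T C = (\<lambda>(X, \<alpha>) (Y, \<beta>). {h \<in> hom C X Y. \<forall>f\<in>ops T.
     h \<odot>\<^bsub>C\<^esub> \<alpha> f =
       \<beta> f \<odot>\<^bsub>C\<^esub> tuple C Y (arity T f) (pow_obj C X (arity T f))
               (\<lambda>i. h \<odot>\<^bsub>C\<^esub> pow_proj C X (arity T f) i)})"

definition algebra_cat ::
    "'f alg_theory \<Rightarrow> ('o, 'm) cat \<Rightarrow> ('o \<times> ('f \<Rightarrow> 'm), 'm) cat" where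
  "algebra_cat T C =
     \<lparr> obj = internal_algebras T C, hom = algebra_homs T C,
       idt = (\<lambda>A. idt C (fst A)), cmp = cmp C \<rparr>"


section \<open>Sets and varieties\<close>

text \<open>
  The category of sets whose elements are drawn from the type \<open>'u\<close>.  A map from \<open>A\<close> to \<open>B\<close>
  is a partial function on \<open>'u\<close> which is defined exactly on \<open>A\<close> and has its values in \<open>B\<close>.
\<close>

definition set_cat :: "('u set, 'u \<rightharpoonup> 'u) cat" where
  "set_cat = \<lparr> obj = UNIV, hom = (\<lambda>A B. {f. dom f = A \<and> ran f \<subseteq> B}),
               idt = (\<lambda>A. Some |` A), cmp = (\<lambda>g f. g \<circ>\<^sub>m f) \<rparr>"

definition variety ::
    "'u itself \<Rightarrow> 'f alg_theory \<Rightarrow> ('u set \<times> ('f \<Rightarrow> 'u \<rightharpoonup> 'u), 'u \<rightharpoonup> 'u) cat" where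
  "variety _ T = algebra_cat T set_cat"

text \<open>
  HOL has no type of all sets, so the variety of a theory is taken over a universe \<open>'u\<close>.
  The universe is required to be infinite and to have at least as many elements as there are
  operation symbols; this makes room for the finitely generated free algebras.  Congruence
  modularity of \<open>variety TYPE('u) T\<close> for one such \<open>'u\<close> is implied by
  modularity of the congruence lattices of all \<open>T\<close>-algebras in all types.
\<close>

definition adequate_universe :: "'u itself \<Rightarrow> 'f alg_theory \<Rightarrow> bool" where
  "adequate_universe _ T \<longleftrightarrow> infinite (UNIV :: 'u set) \<and> (\<exists>e :: 'f \<Rightarrow> 'u. inj_on e (ops T))"

end

theory Submission
  imports Defs
begin

text \<open>
  The elements of an internal algebra \<open>X\<close> at a stage \<open>Z\<close>, i.e. the arrows from \<open>Z\<close> to \<open>X\<close>, form an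
  ordinary algebra, and an internal equivalence relation on \<open>X\<close> is a family of congruences of
  these algebras that is stable under restriction and representable.  So a proof of the modular
  law that works inside an algebra with equations, congruences and finite composites can be
  carried out with generalised elements.  Such a proof is Day's.

  Congruence modularity of the variety yields Day terms (\<open>day_terms_if_congruence_modular\<close>): in
  the free algebra on \<open>x, y, z, u\<close>, an instance of the modular law for the kernels of three
  renamings of the generators relates \<open>x\<close> and \<open>u\<close> by a finite chain of terms, and the links of
  this chain are equations between terms.  These equations are derivable from the axioms, so they
  hold for the elements of every internal algebra.

  In the category of internal algebras the join of \<open>\<Phi>\<close> and \<open>\<Psi>\<close> is the union of the chain of
  relations that starts with \<open>\<Psi>\<close> and replaces \<open>\<Lambda>\<close> by the composite \<open>\<Lambda> ; \<Phi> ; \<Lambda>\<close>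
  (\<open>join_exists\<close>).  That the union is transitive and compatible with the operations is a
  finitary condition on several pairs of elements; stability of unions under pullback along the
  projections of powers and under intersection allows one to assume that all these pairs belong to
  the same member of the chain (\<open>chain_union_finite\<close>).

  For the modular law let \<open>\<Phi> \<sqsubseteq> \<Gamma>\<close> and let \<open>N\<close> be the join of \<open>\<Phi>\<close> and \<open>\<Psi> \<sqinter> \<Gamma>\<close>.  Since intersection
  with \<open>\<Gamma>\<close> commutes with the union, it suffices that \<open>\<Lambda> \<sqinter> \<Gamma> \<sqsubseteq> N\<close> for all \<open>\<Lambda>\<close> in the chain, and
  this follows by induction, the Day terms giving the step from \<open>\<Lambda>\<close> to \<open>\<Lambda> ; \<Phi> ; \<Lambda>\<close>
  (\<open>day_shift\<close>).

  Regularity only enters through the existence of composites, that is, of images with an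
  elimination rule that is stable under restriction.  A topos also has such images, defined by
  quantification over subsets, and there unions of chains are preserved by inverse images and
  intersections because these have right adjoints.  Thus both parts of the theorem are instances of
  \<open>congruence_modular_if_day_terms\<close>.
\<close>

section \<open>Generalised elements and finite limits\<close>

text \<open>
  The arrows between objects only.  Below, an arrow \<open>x\<close> from \<open>Z\<close> to \<open>X\<close> is read as an element
  of \<open>X\<close> at stage \<open>Z\<close>, and composition with \<open>z\<close> from \<open>Z'\<close> to \<open>Z\<close> as its restriction along \<open>z\<close>.
\<close>

definition arr :: "('o, 'm) cat \<Rightarrow> 'o \<Rightarrow> 'o \<Rightarrow> 'm set" where
  "arr C A B = {f \<in> hom C A B. A \<in> obj C \<and> B \<in> obj C}"

lemma arr_obj: "f \<in> arr C A B \<Longrightarrow> A \<in> obj C" "f \<in> arr C A B \<Longrightarrow> B \<in> obj C"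
  and arr_hom: "f \<in> arr C A B \<Longrightarrow> f \<in> hom C A B"
  and hom_arr: "A \<in> obj C \<Longrightarrow> B \<in> obj C \<Longrightarrow> f \<in> hom C A B \<Longrightarrow> f \<in> arr C A B"
  by (auto simp: arr_def)

lemma tuple_cong: "(\<And>i. i < n \<Longrightarrow> q i = q' i) \<Longrightarrow> tuple C X n Z q = tuple C X n Z q'"
  unfolding tuple_def by (rule arg_cong[where f = The]) (auto simp: fun_eq_iff)

locale cat_setup =
  fixes C :: "('o, 'm) cat" (structure)
  assumes category: "category C"
begin

lemma comp_arr [intro]: "f \<in> arr C A B \<Longrightarrow> g \<in> arr C B D \<Longrightarrow> g \<odot> f \<in> arr C A D"
  using category unfolding category_def arr_def by blast

lemma assoc: "f \<in> arr C A B \<Longrightarrow> g \<in> arr C B D \<Longrightarrow> h \<in> arr C D F \<Longrightarrow> (h \<odot> g) \<odot> f = h \<odot> (g \<odot> f)"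
  using category unfolding category_def arr_def by blast

lemma idt_arr: "A \<in> obj C \<Longrightarrow> idt C A \<in> arr C A A"
  and idt_right: "f \<in> arr C A B \<Longrightarrow> f \<odot> idt C A = f"
  and idt_left: "f \<in> arr C A B \<Longrightarrow> idt C B \<odot> f = f"
  using category unfolding category_def arr_def by blast+

text \<open>
  Limits, pullbacks and products are used through elements.  For this purpose unique existence is
  split into existence and joint monicity of the projections.
\<close>

lemma is_limit_iff:
  assumes "is_diagram C n D W"
  shows "is_limit C n D W L p \<longleftrightarrow>
    L \<in> obj C \<and> (\<forall>i<n. p i \<in> arr C L (D i)) \<and> (\<forall>(i, j, f)\<in>W. f \<odot> p i = p j) \<and>
    (\<forall>Z q. Z \<in> obj C \<and> (\<forall>i<n. q i \<in> arr C Z (D i)) \<and> (\<forall>(i, j, f)\<in>W. f \<odot> q i = q j) \<longrightarrow>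
       (\<exists>h\<in>arr C Z L. \<forall>i<n. p i \<odot> h = q i)) \<and>
    (\<forall>Z. \<forall>g\<in>arr C Z L. \<forall>h\<in>arr C Z L. (\<forall>i<n. p i \<odot> g = p i \<odot> h) \<longrightarrow> g = h)"
    (is "?l \<longleftrightarrow> ?r")
proof
  have D: "\<And>i. i < n \<Longrightarrow> D i \<in> obj C"
    and W: "\<And>i j f. (i, j, f) \<in> W \<Longrightarrow> i < n \<and> j < n \<and> f \<in> arr C (D i) (D j)"
    using assms unfolding is_diagram_def arr_def by blast+
  have cone: "is_cone C n D W Z q \<longleftrightarrow>
      Z \<in> obj C \<and> (\<forall>i<n. q i \<in> arr C Z (D i)) \<and> (\<forall>(i, j, f)\<in>W. f \<odot> q i = q j)" for Z q
    using D unfolding is_cone_def arr_def by auto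
  {
    assume l: ?l
    then have c: "is_cone C n D W L p"
      and u: "\<And>Z q. is_cone C n D W Z q \<Longrightarrow> \<exists>!h. h \<in> hom C Z L \<and> (\<forall>i<n. p i \<odot> h = q i)"
      unfolding is_limit_def by blast+
    have "g = h" if "g \<in> arr C Z L" "h \<in> arr C Z L" "\<forall>i<n. p i \<odot> g = p i \<odot> h" for Z g h
    proof -
      have "is_cone C n D W Z (\<lambda>i. p i \<odot> g)"
        unfolding cone
      proof (intro conjI allI impI)
        show "Z \<in> obj C" using that arr_obj by fast
        show "p i \<odot> g \<in> arr C Z (D i)" if "i < n" for i
          using c \<open>g \<in> _\<close> that cone by blast
        have "f \<odot> (p i \<odot> g) = p j \<odot> g" if "(i, j, f) \<in> W" for i j f
          using assoc[of g Z L "p i" "D i" f "D j"] c \<open>g \<in> _\<close> that cone W by fastforce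
        then show "\<forall>(i, j, f)\<in>W. f \<odot> (p i \<odot> g) = p j \<odot> g" by blast
      qed
      from u[OF this] show ?thesis using that arr_hom by (metis (no_types, lifting))
    qed
    moreover have "\<exists>h\<in>arr C Z L. \<forall>i<n. p i \<odot> h = q i"
      if "Z \<in> obj C \<and> (\<forall>i<n. q i \<in> arr C Z (D i)) \<and> (\<forall>(i, j, f)\<in>W. f \<odot> q i = q j)" for Z q
      using u[of Z q] that c unfolding cone arr_def by blast
    ultimately show ?r using c unfolding cone by blast
  }
  {
    assume r: ?r
    have "\<exists>!h. h \<in> hom C Z L \<and> (\<forall>i<n. p i \<odot> h = q i)" if q: "is_cone C n D W Z q" for Z q
    proof -
      have Z: "Z \<in> obj C" and L: "L \<in> obj C" using q r unfolding cone by auto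
      obtain h where h: "h \<in> arr C Z L" "\<forall>i<n. p i \<odot> h = q i"
        using r q unfolding cone by blast
      show ?thesis
      proof (rule ex1I[of _ h])
        show "h \<in> hom C Z L \<and> (\<forall>i<n. p i \<odot> h = q i)" using h by (auto simp: arr_def)
        fix g assume g: "g \<in> hom C Z L \<and> (\<forall>i<n. p i \<odot> g = q i)"
        then have "g \<in> arr C Z L" using Z L by (simp add: arr_def)
        then show "g = h" using r h g by (metis (no_types, lifting))
      qed
    qed
    moreover have "is_cone C n D W L p"
      unfolding cone by (rule conjI[OF conjunct1[OF r] conjI[OF conjunct1[OF conjunct2[OF r]]
        conjunct1[OF conjunct2[OF conjunct2[OF r]]]]])
    ultimately show ?l unfolding is_limit_def by simp
  }
qed

lemma is_limitD:
  assumes d: "is_diagram C n D W" and l: "is_limit C n D W L p"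
  shows "L \<in> obj C" "\<And>i. i < n \<Longrightarrow> p i \<in> arr C L (D i)" "\<And>i j f. (i, j, f) \<in> W \<Longrightarrow> f \<odot> p i = p j"
    "\<And>Z q. Z \<in> obj C \<Longrightarrow> (\<And>i. i < n \<Longrightarrow> q i \<in> arr C Z (D i)) \<Longrightarrow> (\<And>i j f. (i, j, f) \<in> W \<Longrightarrow> f \<odot> q i = q j) \<Longrightarrow>
      \<exists>h\<in>arr C Z L. \<forall>i<n. p i \<odot> h = q i"
    "\<And>Z g h. g \<in> arr C Z L \<Longrightarrow> h \<in> arr C Z L \<Longrightarrow> (\<And>i. i < n \<Longrightarrow> p i \<odot> g = p i \<odot> h) \<Longrightarrow> g = h"
proof -
  note r = l[unfolded is_limit_iff[OF d]]
  note r1 = conjunct2[OF r] note r2 = conjunct2[OF r1] note r3 = conjunct2[OF r2]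
  show "L \<in> obj C" by (rule conjunct1[OF r])
  show "p i \<in> arr C L (D i)" if "i < n" for i using conjunct1[OF r1] that by simp
  show "f \<odot> p i = p j" if "(i, j, f) \<in> W" for i j f using bspec[OF conjunct1[OF r2] that] by simp
  show "\<exists>h\<in>arr C Z L. \<forall>i<n. p i \<odot> h = q i"
    if "Z \<in> obj C" "\<And>i. i < n \<Longrightarrow> q i \<in> arr C Z (D i)" "\<And>i j f. (i, j, f) \<in> W \<Longrightarrow> f \<odot> q i = q j" for Z q
    by (rule conjunct1[OF r3, THEN spec, THEN spec, THEN mp]) (use that in auto)
  show "g = h" if "g \<in> arr C Z L" "h \<in> arr C Z L" "\<And>i. i < n \<Longrightarrow> p i \<odot> g = p i \<odot> h" for Z g h
    by (rule conjunct2[OF r3, THEN spec, THEN bspec, THEN bspec, THEN mp]) (use that in auto)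
qed

lemma is_limitI:
  assumes d: "is_diagram C n D W"
    and L: "L \<in> obj C" and p: "\<And>i. i < n \<Longrightarrow> p i \<in> arr C L (D i)" and e: "\<And>i j f. (i, j, f) \<in> W \<Longrightarrow> f \<odot> p i = p j"
    and ex: "\<And>Z q. Z \<in> obj C \<Longrightarrow> (\<And>i. i < n \<Longrightarrow> q i \<in> arr C Z (D i)) \<Longrightarrow> (\<And>i j f. (i, j, f) \<in> W \<Longrightarrow> f \<odot> q i = q j) \<Longrightarrow>
      \<exists>h\<in>arr C Z L. \<forall>i<n. p i \<odot> h = q i"
    and un: "\<And>Z g h. g \<in> arr C Z L \<Longrightarrow> h \<in> arr C Z L \<Longrightarrow> (\<And>i. i < n \<Longrightarrow> p i \<odot> g = p i \<odot> h) \<Longrightarrow> g = h"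
  shows "is_limit C n D W L p"
  unfolding is_limit_iff[OF d]
proof (intro conjI allI impI ballI)
  show "L \<in> obj C" by (rule L)
  show "p i \<in> arr C L (D i)" if "i < n" for i using p[OF that] .
  show "case t of (i, j, f) \<Rightarrow> f \<odot> p i = p j" if "t \<in> W" for t using e that by (cases t) auto
  show "\<exists>h\<in>arr C Z L. \<forall>i<n. p i \<odot> h = q i"
    if "Z \<in> obj C \<and> (\<forall>i<n. q i \<in> arr C Z (D i)) \<and> (\<forall>(i, j, f)\<in>W. f \<odot> q i = q j)" for Z q
    by (rule ex) (use that in auto)
  show "g = h" if "g \<in> arr C Z L" "h \<in> arr C Z L" "\<forall>i<n. p i \<odot> g = p i \<odot> h" for Z g h
    by (rule un[OF that(1,2)]) (use that(3) in simp)
qed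

lemma is_pullback_iff:
  "is_pullback C A B X f g P p q \<longleftrightarrow>
     f \<in> arr C A X \<and> g \<in> arr C B X \<and> p \<in> arr C P A \<and> q \<in> arr C P B \<and> f \<odot> p = g \<odot> q \<and>
     (\<forall>Z. \<forall>u\<in>arr C Z A. \<forall>v\<in>arr C Z B. f \<odot> u = g \<odot> v \<longrightarrow> (\<exists>h\<in>arr C Z P. p \<odot> h = u \<and> q \<odot> h = v)) \<and>
     (\<forall>Z. \<forall>h\<in>arr C Z P. \<forall>k\<in>arr C Z P. p \<odot> h = p \<odot> k \<and> q \<odot> h = q \<odot> k \<longrightarrow> h = k)"
    (is "?l \<longleftrightarrow> ?r")
proof
  assume ?l
  then have o: "A \<in> obj C" "B \<in> obj C" "X \<in> obj C" "P \<in> obj C"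
    and a: "f \<in> arr C A X" "g \<in> arr C B X" "p \<in> arr C P A" "q \<in> arr C P B" and e: "f \<odot> p = g \<odot> q"
    and u: "\<And>Z u v. Z \<in> obj C \<Longrightarrow> u \<in> hom C Z A \<Longrightarrow> v \<in> hom C Z B \<Longrightarrow> f \<odot> u = g \<odot> v \<Longrightarrow>
        \<exists>!h. h \<in> hom C Z P \<and> p \<odot> h = u \<and> q \<odot> h = v"
    unfolding is_pullback_def by (auto intro: hom_arr)
  have "h = k" if h: "h \<in> arr C Z P" and k: "k \<in> arr C Z P" and eq: "p \<odot> h = p \<odot> k" "q \<odot> h = q \<odot> k" for Z h k
  proof -
    have "f \<odot> (p \<odot> h) = g \<odot> (q \<odot> h)"
      using assoc[OF h a(3) a(1)] assoc[OF h a(4) a(2)] e by simp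
    then have "\<exists>!l. l \<in> hom C Z P \<and> p \<odot> l = p \<odot> h \<and> q \<odot> l = q \<odot> h"
      using arr_obj(1)[OF h] arr_hom[OF comp_arr[OF h a(3)]] arr_hom[OF comp_arr[OF h a(4)]] by (intro u)
    then show ?thesis using arr_hom[OF h] arr_hom[OF k] eq by metis
  qed
  moreover have "\<exists>h\<in>arr C Z P. p \<odot> h = u \<and> q \<odot> h = v"
    if "u \<in> arr C Z A" "v \<in> arr C Z B" "f \<odot> u = g \<odot> v" for Z u v
    using u[of Z u v] that o arr_obj(1)[OF that(1)] by (meson arr_hom hom_arr)
  ultimately show ?r using a e by blast
next
  assume r: ?r
  then have o: "A \<in> obj C" "B \<in> obj C" "X \<in> obj C" "P \<in> obj C" by (auto simp: arr_def)
  have un: "h = k" if "h \<in> arr C Z P" "k \<in> arr C Z P" "p \<odot> h = p \<odot> k" "q \<odot> h = q \<odot> k" for Z h k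
    using r that by blast
  have "\<exists>!h. h \<in> hom C Z P \<and> p \<odot> h = u \<and> q \<odot> h = v"
    if uv: "Z \<in> obj C" "u \<in> hom C Z A" "v \<in> hom C Z B" "f \<odot> u = g \<odot> v" for Z u v
  proof -
    have "u \<in> arr C Z A" "v \<in> arr C Z B" using uv o by (auto simp: arr_def)
    then obtain h where "h \<in> arr C Z P" "p \<odot> h = u" "q \<odot> h = v" using r uv(4) by blast
    then have "h \<in> hom C Z P \<and> p \<odot> h = u \<and> q \<odot> h = v" by (simp add: arr_hom)
    moreover have "k = h" if "k \<in> hom C Z P \<and> p \<odot> k = u \<and> q \<odot> k = v" for k
      using un[OF hom_arr[OF uv(1) o(4)] \<open>h \<in> arr C Z P\<close>, of k] that \<open>p \<odot> h = u\<close> \<open>q \<odot> h = v\<close> by simp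
    ultimately show ?thesis by (rule ex1I)
  qed
  moreover have "f \<in> arr C A X" "g \<in> arr C B X" "p \<in> arr C P A" "q \<in> arr C P B" "f \<odot> p = g \<odot> q"
    using r by blast+
  ultimately show ?l using o unfolding is_pullback_def by (simp add: arr_def)
qed

lemma is_product_iff:
  "is_product C A B P p q \<longleftrightarrow>
     p \<in> arr C P A \<and> q \<in> arr C P B \<and>
     (\<forall>Z. \<forall>u\<in>arr C Z A. \<forall>v\<in>arr C Z B. \<exists>h\<in>arr C Z P. p \<odot> h = u \<and> q \<odot> h = v) \<and>
     (\<forall>Z. \<forall>h\<in>arr C Z P. \<forall>k\<in>arr C Z P. p \<odot> h = p \<odot> k \<and> q \<odot> h = q \<odot> k \<longrightarrow> h = k)"
    (is "?l \<longleftrightarrow> ?r")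
proof
  assume ?l
  then have o: "A \<in> obj C" "B \<in> obj C" "P \<in> obj C"
    and a: "p \<in> arr C P A" "q \<in> arr C P B"
    and u: "\<And>Z u v. Z \<in> obj C \<Longrightarrow> u \<in> hom C Z A \<Longrightarrow> v \<in> hom C Z B \<Longrightarrow>
        \<exists>!h. h \<in> hom C Z P \<and> p \<odot> h = u \<and> q \<odot> h = v"
    unfolding is_product_def by (auto intro: hom_arr)
  have "h = k" if h: "h \<in> arr C Z P" and k: "k \<in> arr C Z P" and eq: "p \<odot> h = p \<odot> k" "q \<odot> h = q \<odot> k" for Z h k
  proof -
    have "\<exists>!l. l \<in> hom C Z P \<and> p \<odot> l = p \<odot> h \<and> q \<odot> l = q \<odot> h"
      using arr_obj(1)[OF h] arr_hom[OF comp_arr[OF h a(1)]] arr_hom[OF comp_arr[OF h a(2)]] by (intro u)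
    then show ?thesis using arr_hom[OF h] arr_hom[OF k] eq by metis
  qed
  moreover have "\<exists>h\<in>arr C Z P. p \<odot> h = u \<and> q \<odot> h = v" if "u \<in> arr C Z A" "v \<in> arr C Z B" for Z u v
    using u[of Z u v] that o arr_obj(1)[OF that(1)] by (meson arr_hom hom_arr)
  ultimately show ?r using a by blast
next
  assume r: ?r
  then have o: "A \<in> obj C" "B \<in> obj C" "P \<in> obj C" by (auto simp: arr_def)
  have un: "h = k" if "h \<in> arr C Z P" "k \<in> arr C Z P" "p \<odot> h = p \<odot> k" "q \<odot> h = q \<odot> k" for Z h k
    using r that by blast
  have "\<exists>!h. h \<in> hom C Z P \<and> p \<odot> h = u \<and> q \<odot> h = v"
    if uv: "Z \<in> obj C" "u \<in> hom C Z A" "v \<in> hom C Z B" for Z u v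
  proof -
    have "u \<in> arr C Z A" "v \<in> arr C Z B" using uv o by (auto simp: arr_def)
    then obtain h where "h \<in> arr C Z P" "p \<odot> h = u" "q \<odot> h = v" using r by blast
    then have "h \<in> hom C Z P \<and> p \<odot> h = u \<and> q \<odot> h = v" by (simp add: arr_hom)
    moreover have "k = h" if "k \<in> hom C Z P \<and> p \<odot> k = u \<and> q \<odot> k = v" for k
      using un[OF hom_arr[OF uv(1) o(3)] \<open>h \<in> arr C Z P\<close>, of k] that \<open>p \<odot> h = u\<close> \<open>q \<odot> h = v\<close> by simp
    ultimately show ?thesis by (rule ex1I)
  qed
  moreover have "p \<in> arr C P A" "q \<in> arr C P B" using r by blast+
  ultimately show ?l using o unfolding is_product_def by (simp add: arr_def)
qed

end

locale lex_category =
  fixes C :: "('o, 'm) cat" (structure)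
  assumes finitely_complete: "finitely_complete C"

sublocale lex_category \<subseteq> cat_setup
  using finitely_complete by unfold_locales (simp add: finitely_complete_def)

context lex_category
begin

lemma limit_exists:
  "is_diagram C n D W \<Longrightarrow> \<exists>L p. is_limit C n D W L p"
  using finitely_complete by (auto simp: finitely_complete_def)

lemma product_exists:
  assumes "A \<in> obj C" "B \<in> obj C" shows "\<exists>P p q. is_product C A B P p q"
proof -
  let ?D = "\<lambda>i::nat. if i = 0 then A else B"
  have d: "is_diagram C 2 ?D {}" using assms by (auto simp: is_diagram_def)
  then obtain L p where l: "is_limit C 2 ?D {} L p" using limit_exists by blast
  then have p: "p 0 \<in> arr C L A" "p 1 \<in> arr C L B"
    and ex: "\<And>Z q. Z \<in> obj C \<Longrightarrow> (\<forall>i<2. q i \<in> arr C Z (?D i)) \<Longrightarrow> \<exists>h\<in>arr C Z L. \<forall>i<2. p i \<odot> h = q i"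
    and un: "\<And>Z g h. g \<in> arr C Z L \<Longrightarrow> h \<in> arr C Z L \<Longrightarrow> (\<forall>i<2. p i \<odot> g = p i \<odot> h) \<Longrightarrow> g = h"
    unfolding is_limit_iff[OF d] by (auto dest: spec[of _ 0] spec[of _ 1])
  have "\<exists>h\<in>arr C Z L. p 0 \<odot> h = u \<and> p 1 \<odot> h = v" if "u \<in> arr C Z A" "v \<in> arr C Z B" for Z u v
  proof -
    have "\<exists>h\<in>arr C Z L. \<forall>i<2. p i \<odot> h = (if i = 0 then u else v)"
      by (rule ex) (use that arr_obj in auto)
    then obtain h where "h \<in> arr C Z L" "\<And>i. i < 2 \<Longrightarrow> p i \<odot> h = (if i = 0 then u else v)" by blast
    from this(1) this(2)[of 0] this(2)[of 1] show ?thesis by auto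
  qed
  then have "is_product C A B L (p 0) (p 1)"
    using p un unfolding is_product_iff by (fastforce simp: less_2_cases_iff)
  then show ?thesis by blast
qed

lemma pullback_exists:
  assumes f: "f \<in> arr C A X" and g: "g \<in> arr C B X" shows "\<exists>P p q. is_pullback C A B X f g P p q"
proof -
  let ?D = "\<lambda>i::nat. if i = 0 then A else if i = 1 then B else X"
  let ?W = "{(0::nat, 2::nat, f), (1, 2, g)}"
  have d: "is_diagram C 3 ?D ?W" using f g by (auto simp: is_diagram_def arr_def)
  then obtain L p where l: "is_limit C 3 ?D ?W L p" using limit_exists by blast
  have i3: "i < 3 \<longleftrightarrow> i = 0 \<or> i = 1 \<or> i = 2" for i :: nat by auto
  from l have p: "p 0 \<in> arr C L A" "p 1 \<in> arr C L B" "f \<odot> p 0 = p 2" "g \<odot> p 1 = p 2"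
    and ex: "\<And>Z q. Z \<in> obj C \<Longrightarrow> (\<forall>i<3. q i \<in> arr C Z (?D i)) \<Longrightarrow> f \<odot> q 0 = q 2 \<Longrightarrow> g \<odot> q 1 = q 2 \<Longrightarrow>
      \<exists>h\<in>arr C Z L. \<forall>i<3. p i \<odot> h = q i"
    and un: "\<And>Z g h. g \<in> arr C Z L \<Longrightarrow> h \<in> arr C Z L \<Longrightarrow> (\<forall>i<3. p i \<odot> g = p i \<odot> h) \<Longrightarrow> g = h"
    unfolding is_limit_iff[OF d] by (auto simp: i3)
  have "\<exists>h\<in>arr C Z L. p 0 \<odot> h = u \<and> p 1 \<odot> h = v"
    if "u \<in> arr C Z A" "v \<in> arr C Z B" "f \<odot> u = g \<odot> v" for Z u v
  proof -
    let ?q = "\<lambda>i::nat. if i = 0 then u else if i = 1 then v else f \<odot> u"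
    have "\<exists>h\<in>arr C Z L. \<forall>i<3. p i \<odot> h = ?q i"
      by (rule ex) (use that comp_arr[OF that(2) g] arr_obj in auto)
    then obtain h where "h \<in> arr C Z L" "\<And>i. i < 3 \<Longrightarrow> p i \<odot> h = ?q i" by blast
    from this(1) this(2)[of 0] this(2)[of 1] show ?thesis by auto
  qed
  moreover have "h = k" if hk: "h \<in> arr C Z L" "k \<in> arr C Z L" "p 0 \<odot> h = p 0 \<odot> k" "p 1 \<odot> h = p 1 \<odot> k" for Z h k
  proof -
    have "p 2 \<odot> h = p 2 \<odot> k"
      using assoc[OF hk(1) p(1) f] assoc[OF hk(2) p(1) f] hk p(3) by simp
    then show ?thesis using un[OF hk(1,2)] hk by (auto simp: i3)
  qed
  ultimately have "is_pullback C A B X f g L (p 0) (p 1)"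
    unfolding is_pullback_iff using f g p by auto
  then show ?thesis by blast
qed

subsection \<open>Finite powers\<close>

lemma power_limit:
  assumes "X \<in> obj C" shows "is_limit C n (\<lambda>_. X) {} (pow_obj C X n) (pow_proj C X n)"
proof -
  have "is_diagram C n (\<lambda>_. X) {}" using assms by (simp add: is_diagram_def)
  then have "\<exists>c. case c of (P, p) \<Rightarrow> is_limit C n (\<lambda>_. X) {} P p" using limit_exists by auto
  then have "case power_cone C X n of (P, p) \<Rightarrow> is_limit C n (\<lambda>_. X) {} P p"
    unfolding power_cone_def by (rule someI_ex)
  then show ?thesis unfolding pow_obj_def pow_proj_def by (simp add: case_prod_beta)
qed

lemma
  assumes X: "X \<in> obj C"
  shows pow_obj: "pow_obj C X n \<in> obj C"
    and pow_proj: "i < n \<Longrightarrow> pow_proj C X n i \<in> arr C (pow_obj C X n) X"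
    and pow_ext: "g \<in> arr C Z (pow_obj C X n) \<Longrightarrow> h \<in> arr C Z (pow_obj C X n) \<Longrightarrow>
      (\<And>i. i < n \<Longrightarrow> pow_proj C X n i \<odot> g = pow_proj C X n i \<odot> h) \<Longrightarrow> g = h"
    and tuple_arr: "Z \<in> obj C \<Longrightarrow> \<forall>i<n. q i \<in> arr C Z X \<Longrightarrow> tuple C X n Z q \<in> arr C Z (pow_obj C X n)"
    and proj_tuple: "Z \<in> obj C \<Longrightarrow> \<forall>i<n. q i \<in> arr C Z X \<Longrightarrow> i < n \<Longrightarrow>
      pow_proj C X n i \<odot> tuple C X n Z q = q i"
proof -
  have d: "is_diagram C n (\<lambda>_. X) {}" using X by (simp add: is_diagram_def)
  note L = power_limit[OF X, of n, unfolded is_limit_iff[OF d]]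
  show "pow_obj C X n \<in> obj C" and "i < n \<Longrightarrow> pow_proj C X n i \<in> arr C (pow_obj C X n) X"
    using L by blast+
  show ext: "g = h" if "g \<in> arr C Z (pow_obj C X n)" "h \<in> arr C Z (pow_obj C X n)"
    "\<And>i. i < n \<Longrightarrow> pow_proj C X n i \<odot> g = pow_proj C X n i \<odot> h" for Z g h
    using L that by blast
  {
    assume Z: "Z \<in> obj C" and q: "\<forall>i<n. q i \<in> arr C Z X"
    have "\<exists>!h. h \<in> hom C Z (pow_obj C X n) \<and> (\<forall>i<n. pow_proj C X n i \<odot> h = q i)"
      using power_limit[OF X, of n] Z q X unfolding is_limit_def is_cone_def arr_def by auto
    from theI'[OF this]
    have "tuple C X n Z q \<in> hom C Z (pow_obj C X n) \<and> (\<forall>i<n. pow_proj C X n i \<odot> tuple C X n Z q = q i)"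
      unfolding tuple_def .
    then show "tuple C X n Z q \<in> arr C Z (pow_obj C X n)"
      and "i < n \<Longrightarrow> pow_proj C X n i \<odot> tuple C X n Z q = q i"
      using Z L by (auto simp: arr_def)
  }
qed

lemma tuple_proj:
  assumes X: "X \<in> obj C" and w: "w \<in> arr C Z (pow_obj C X n)"
  shows "tuple C X n Z (\<lambda>i. pow_proj C X n i \<odot> w) = w"
proof -
  have Z: "Z \<in> obj C" using w arr_obj by fast
  have q: "\<forall>i<n. pow_proj C X n i \<odot> w \<in> arr C Z X" using pow_proj[OF X] w by blast
  show ?thesis
    by (rule pow_ext[OF X tuple_arr[OF X Z q] w]) (simp_all add: proj_tuple[OF X Z q])
qed

lemma tuple_comp:
  assumes X: "X \<in> obj C" and z: "z \<in> arr C Z' Z" and q: "\<forall>i<n. q i \<in> arr C Z X"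
  shows "tuple C X n Z q \<odot> z = tuple C X n Z' (\<lambda>i. q i \<odot> z)"
proof -
  have Z: "Z \<in> obj C" and Z': "Z' \<in> obj C" using z arr_obj by fast+
  have qz: "\<forall>i<n. q i \<odot> z \<in> arr C Z' X" using q z by blast
  have t: "tuple C X n Z q \<in> arr C Z (pow_obj C X n)" by (rule tuple_arr[OF X Z q])
  have "pow_proj C X n i \<odot> (tuple C X n Z q \<odot> z) = pow_proj C X n i \<odot> tuple C X n Z' (\<lambda>i. q i \<odot> z)"
    if i: "i < n" for i
    using assoc[OF z t pow_proj[OF X i]] proj_tuple[OF X Z q i] proj_tuple[OF X Z' qz i] by simp
  then show ?thesis
    using pow_ext[OF X comp_arr[OF z t] tuple_arr[OF X Z', of n "\<lambda>i. q i \<odot> z"]] qz by simp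
qed

end

section \<open>Representable predicates\<close>

text \<open>
  A subobject \<open>M\<close> of \<open>X\<close> is determined by the elements of \<open>X\<close> that factor through it.  Hence
  subobjects and internal relations are replaced by the predicates on generalised elements that
  they represent; inclusions, inverse images and intersections become implications,
  substitutions and conjunctions.
\<close>

definition fac :: "('o, 'm) cat \<Rightarrow> 'o \<times> 'm \<Rightarrow> 'o \<Rightarrow> 'm \<Rightarrow> bool" where
  "fac C M Z x \<longleftrightarrow> (\<exists>k\<in>arr C Z (fst M). snd M \<odot>\<^bsub>C\<^esub> k = x)"

definition sub_pred :: "('o, 'm) cat \<Rightarrow> 'o \<Rightarrow> ('o \<Rightarrow> 'm \<Rightarrow> bool) \<Rightarrow> bool" where
  "sub_pred C X \<phi> \<longleftrightarrow> X \<in> obj C \<and> (\<exists>M\<in>subobjects C X. \<phi> = fac C M)"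

definition rel_elem :: "('o, 'm) cat \<Rightarrow> 'o \<times> 'm \<times> 'm \<Rightarrow> 'o \<Rightarrow> 'm \<Rightarrow> 'm \<Rightarrow> bool" where
  "rel_elem C R Z x y \<longleftrightarrow>
     (\<exists>k\<in>arr C Z (fst R). fst (snd R) \<odot>\<^bsub>C\<^esub> k = x \<and> snd (snd R) \<odot>\<^bsub>C\<^esub> k = y)"

definition rel_pred :: "('o, 'm) cat \<Rightarrow> 'o \<Rightarrow> ('o \<Rightarrow> 'm \<Rightarrow> 'm \<Rightarrow> bool) \<Rightarrow> bool" where
  "rel_pred C X \<Phi> \<longleftrightarrow> X \<in> obj C \<and> (\<exists>R\<in>relations C X. \<Phi> = rel_elem C R)"

definition pair :: "('o, 'm) cat \<Rightarrow> 'o \<Rightarrow> 'o \<Rightarrow> 'm \<Rightarrow> 'm \<Rightarrow> 'm" where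
  "pair C X Z x y = tuple C X 2 Z (\<lambda>i. if i = 0 then x else y)"

context cat_setup
begin

lemma subobjects_iff:
  assumes "X \<in> obj C"
  shows "M \<in> subobjects C X \<longleftrightarrow> snd M \<in> arr C (fst M) X \<and>
    (\<forall>Z. \<forall>g\<in>arr C Z (fst M). \<forall>h\<in>arr C Z (fst M). snd M \<odot> g = snd M \<odot> h \<longrightarrow> g = h)"
  using assms unfolding subobjects_def monic_def arr_def by (cases M) auto

lemma relations_iff:
  assumes "X \<in> obj C"
  shows "R \<in> relations C X \<longleftrightarrow>
    fst (snd R) \<in> arr C (fst R) X \<and> snd (snd R) \<in> arr C (fst R) X \<and>
    (\<forall>Z. \<forall>g\<in>arr C Z (fst R). \<forall>h\<in>arr C Z (fst R). fst (snd R) \<odot> g = fst (snd R) \<odot> h \<and>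
       snd (snd R) \<odot> g = snd (snd R) \<odot> h \<longrightarrow> g = h)"
  using assms unfolding relations_def arr_def by (cases R) auto

lemma sub_predI:
  assumes X: "X \<in> obj C" and m: "m \<in> arr C A X"
    and "\<And>Z g h. g \<in> arr C Z A \<Longrightarrow> h \<in> arr C Z A \<Longrightarrow> m \<odot> g = m \<odot> h \<Longrightarrow> g = h"
    and "\<And>Z x. \<phi> Z x \<longleftrightarrow> (\<exists>k\<in>arr C Z A. m \<odot> k = x)"
  shows "sub_pred C X \<phi>"
proof -
  have "(A, m) \<in> subobjects C X" using assms by (auto simp: subobjects_iff)
  moreover have "\<phi> = fac C (A, m)" using assms(4) by (simp add: fac_def fun_eq_iff)
  ultimately show ?thesis using X unfolding sub_pred_def by blast
qed

lemma sub_predE: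
  assumes "sub_pred C X \<phi>"
  obtains A m where "X \<in> obj C" "m \<in> arr C A X"
    "\<And>Z g h. g \<in> arr C Z A \<Longrightarrow> h \<in> arr C Z A \<Longrightarrow> m \<odot> g = m \<odot> h \<Longrightarrow> g = h"
    "\<And>Z x. \<phi> Z x \<longleftrightarrow> (\<exists>k\<in>arr C Z A. m \<odot> k = x)"
proof -
  obtain A m where X: "X \<in> obj C" and M: "(A, m) \<in> subobjects C X" and f: "\<phi> = fac C (A, m)"
    using assms unfolding sub_pred_def by auto
  show thesis
    by (rule that[of m A]) (use M f X in \<open>auto simp: fac_def subobjects_iff\<close>)
qed

lemma rel_predI:
  assumes X: "X \<in> obj C" and d: "d0 \<in> arr C R X" "d1 \<in> arr C R X"
    and "\<And>Z g h. g \<in> arr C Z R \<Longrightarrow> h \<in> arr C Z R \<Longrightarrow> d0 \<odot> g = d0 \<odot> h \<Longrightarrow> d1 \<odot> g = d1 \<odot> h \<Longrightarrow> g = h"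
    and "\<And>Z x y. \<Phi> Z x y \<longleftrightarrow> (\<exists>k\<in>arr C Z R. d0 \<odot> k = x \<and> d1 \<odot> k = y)"
  shows "rel_pred C X \<Phi>"
proof -
  have "(R, d0, d1) \<in> relations C X" using assms by (auto simp: relations_iff)
  moreover have "\<Phi> = rel_elem C (R, d0, d1)" using assms(5) by (simp add: rel_elem_def fun_eq_iff)
  ultimately show ?thesis using X unfolding rel_pred_def by blast
qed

lemma rel_predE:
  assumes "rel_pred C X \<Phi>"
  obtains R d0 d1 where "X \<in> obj C" "d0 \<in> arr C R X" "d1 \<in> arr C R X"
    "\<And>Z g h. g \<in> arr C Z R \<Longrightarrow> h \<in> arr C Z R \<Longrightarrow> d0 \<odot> g = d0 \<odot> h \<Longrightarrow> d1 \<odot> g = d1 \<odot> h \<Longrightarrow> g = h"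
    "\<And>Z x y. \<Phi> Z x y \<longleftrightarrow> (\<exists>k\<in>arr C Z R. d0 \<odot> k = x \<and> d1 \<odot> k = y)"
proof -
  obtain R d0 d1 where X: "X \<in> obj C" and M: "(R, d0, d1) \<in> relations C X" and f: "\<Phi> = rel_elem C (R, d0, d1)"
    using assms unfolding rel_pred_def by auto
  show thesis
    by (rule that[of d0 R d1]) (use M f X in \<open>auto simp: rel_elem_def relations_iff\<close>)
qed

lemma sub_pred_cong: "sub_pred C X \<phi> \<Longrightarrow> (\<And>Z x. \<phi> Z x \<longleftrightarrow> \<psi> Z x) \<Longrightarrow> sub_pred C X \<psi>"
  and rel_pred_cong: "rel_pred C X \<Phi> \<Longrightarrow> (\<And>Z x y. \<Phi> Z x y \<longleftrightarrow> \<Psi> Z x y) \<Longrightarrow> rel_pred C X \<Psi>"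
proof -
  show "sub_pred C X \<psi>" if "sub_pred C X \<phi>" "\<And>Z x. \<phi> Z x \<longleftrightarrow> \<psi> Z x"
  proof -
    have "\<phi> = \<psi>" using that(2) by (simp add: fun_eq_iff)
    then show ?thesis using that(1) by simp
  qed
  show "rel_pred C X \<Psi>" if "rel_pred C X \<Phi>" "\<And>Z x y. \<Phi> Z x y \<longleftrightarrow> \<Psi> Z x y"
  proof -
    have "\<Phi> = \<Psi>" using that(2) by (simp add: fun_eq_iff)
    then show ?thesis using that(1) by simp
  qed
qed

lemma sub_pred_arr: "sub_pred C X \<phi> \<Longrightarrow> \<phi> Z x \<Longrightarrow> x \<in> arr C Z X"
  by (erule sub_predE) auto

lemma sub_pred_restrict: "sub_pred C X \<phi> \<Longrightarrow> \<phi> Z x \<Longrightarrow> z \<in> arr C Z' Z \<Longrightarrow> \<phi> Z' (x \<odot> z)"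
proof -
  assume "sub_pred C X \<phi>" and x: "\<phi> Z x" and z: "z \<in> arr C Z' Z"
  then obtain A m where "X \<in> obj C" and m: "m \<in> arr C A X"
    and "\<And>Z g h. g \<in> arr C Z A \<Longrightarrow> h \<in> arr C Z A \<Longrightarrow> m \<odot> g = m \<odot> h \<Longrightarrow> g = h"
    and iff: "\<And>Z x. \<phi> Z x \<longleftrightarrow> (\<exists>k\<in>arr C Z A. m \<odot> k = x)" by (elim sub_predE) (rule that)
  from x obtain k where k: "k \<in> arr C Z A" "m \<odot> k = x" unfolding iff by blast
  show ?thesis unfolding iff using assoc[OF z k(1) m] comp_arr[OF z k(1)] k(2) by auto
qed

lemma rel_pred_arr:
  "rel_pred C X \<Phi> \<Longrightarrow> \<Phi> Z x y \<Longrightarrow> x \<in> arr C Z X" "rel_pred C X \<Phi> \<Longrightarrow> \<Phi> Z x y \<Longrightarrow> y \<in> arr C Z X"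
  by (erule rel_predE, auto)+

lemma rel_pred_restrict: "rel_pred C X \<Phi> \<Longrightarrow> \<Phi> Z x y \<Longrightarrow> z \<in> arr C Z' Z \<Longrightarrow> \<Phi> Z' (x \<odot> z) (y \<odot> z)"
proof -
  assume "rel_pred C X \<Phi>" and x: "\<Phi> Z x y" and z: "z \<in> arr C Z' Z"
  then obtain R d0 d1 where "X \<in> obj C" and d0: "d0 \<in> arr C R X" and d1: "d1 \<in> arr C R X"
    and "\<And>Z g h. g \<in> arr C Z R \<Longrightarrow> h \<in> arr C Z R \<Longrightarrow> d0 \<odot> g = d0 \<odot> h \<Longrightarrow> d1 \<odot> g = d1 \<odot> h \<Longrightarrow> g = h"
    and iff: "\<And>Z x y. \<Phi> Z x y \<longleftrightarrow> (\<exists>k\<in>arr C Z R. d0 \<odot> k = x \<and> d1 \<odot> k = y)" by (elim rel_predE) (rule that)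
  from x obtain k where k: "k \<in> arr C Z R" "d0 \<odot> k = x" "d1 \<odot> k = y" unfolding iff by blast
  show ?thesis
    unfolding iff using assoc[OF z k(1) d0] assoc[OF z k(1) d1] comp_arr[OF z k(1)] k(2,3) by auto
qed

lemma fac_sub_pred: "X \<in> obj C \<Longrightarrow> M \<in> subobjects C X \<Longrightarrow> sub_pred C X (fac C M)"
  by (auto simp: sub_pred_def)

lemma sub_le_iff:
  assumes X: "X \<in> obj C" and M: "M \<in> subobjects C X" and N: "N \<in> subobjects C X"
  shows "sub_le C M N \<longleftrightarrow> (\<forall>Z x. fac C M Z x \<longrightarrow> fac C N Z x)"
proof
  have m: "snd M \<in> arr C (fst M) X" and n: "snd N \<in> arr C (fst N) X"
    using M N X by (auto simp: subobjects_iff)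
  {
    assume "sub_le C M N"
    then obtain k where k: "k \<in> arr C (fst M) (fst N)" and e: "snd N \<odot> k = snd M"
      using arr_obj(1)[OF m] arr_obj(1)[OF n] unfolding sub_le_def arr_def by blast
    show "\<forall>Z x. fac C M Z x \<longrightarrow> fac C N Z x"
      unfolding fac_def using assoc[OF _ k n] comp_arr[OF _ k] e by metis
  }
  {
    assume "\<forall>Z x. fac C M Z x \<longrightarrow> fac C N Z x"
    moreover have "fac C M (fst M) (snd M)"
      unfolding fac_def using idt_arr[OF arr_obj(1)[OF m]] idt_right[OF m] by blast
    ultimately have "fac C N (fst M) (snd M)" by blast
    then show "sub_le C M N" unfolding fac_def sub_le_def by (auto dest: arr_hom)
  }
qed

lemma rel_le_iff:
  assumes X: "X \<in> obj C" and R: "R \<in> relations C X" and S: "S \<in> relations C X"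
  shows "rel_le C R S \<longleftrightarrow> (\<forall>Z x y. rel_elem C R Z x y \<longrightarrow> rel_elem C S Z x y)"
proof
  obtain R0 d0 d1 S0 e0 e1 where [simp]: "R = (R0, d0, d1)" "S = (S0, e0, e1)"
    by (cases R, cases S) auto
  have d: "d0 \<in> arr C R0 X" "d1 \<in> arr C R0 X" and e: "e0 \<in> arr C S0 X" "e1 \<in> arr C S0 X"
    using R S X by (auto simp: relations_iff)
  {
    assume "rel_le C R S"
    then obtain k where k: "k \<in> arr C R0 S0" and eq: "e0 \<odot> k = d0" "e1 \<odot> k = d1"
      using arr_obj(1)[OF d(1)] arr_obj(1)[OF e(1)] unfolding rel_le_def arr_def by auto
    show "\<forall>Z x y. rel_elem C R Z x y \<longrightarrow> rel_elem C S Z x y"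
      unfolding rel_elem_def using assoc[OF _ k e(1)] assoc[OF _ k e(2)] comp_arr[OF _ k] eq
      by simp metis
  }
  {
    assume "\<forall>Z x y. rel_elem C R Z x y \<longrightarrow> rel_elem C S Z x y"
    moreover have "rel_elem C R R0 d0 d1"
      unfolding rel_elem_def using idt_arr[OF arr_obj(1)[OF d(1)]] idt_right[OF d(1)] idt_right[OF d(2)]
      by auto
    ultimately have "rel_elem C S R0 d0 d1" by blast
    then show "rel_le C R S" unfolding rel_elem_def rel_le_def by (auto dest: arr_hom)
  }
qed

lemma sub_pred_true: "X \<in> obj C \<Longrightarrow> sub_pred C X (\<lambda>Z x. x \<in> arr C Z X)"
  by (rule sub_predI[OF _ idt_arr]) (auto simp: idt_left)

end

context lex_category
begin

lemma inverse_image_exists: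
  assumes M: "M \<in> subobjects C X" and u: "u \<in> arr C W X"
  obtains N where "N \<in> subobjects C W" "is_inverse_image C W X u M N"
    "\<And>Z w. fac C N Z w \<longleftrightarrow> w \<in> arr C Z W \<and> fac C M Z (u \<odot> w)"
proof -
  obtain A m where M_def: "M = (A, m)" by (cases M)
  have m: "m \<in> arr C A X"
    and mono: "\<And>Z g h. g \<in> arr C Z A \<Longrightarrow> h \<in> arr C Z A \<Longrightarrow> m \<odot> g = m \<odot> h \<Longrightarrow> g = h"
    using M unfolding subobjects_iff[OF arr_obj(2)[OF u]] M_def by auto
  obtain P p q where P: "is_pullback C W A X u m P p q" using pullback_exists[OF u m] by blast
  then have p: "p \<in> arr C P W" and q: "q \<in> arr C P A" and e: "u \<odot> p = m \<odot> q"
    and ex: "\<And>Z w a. w \<in> arr C Z W \<Longrightarrow> a \<in> arr C Z A \<Longrightarrow> u \<odot> w = m \<odot> a \<Longrightarrow> \<exists>h\<in>arr C Z P. p \<odot> h = w \<and> q \<odot> h = a"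
    and un: "\<And>Z h k. h \<in> arr C Z P \<Longrightarrow> k \<in> arr C Z P \<Longrightarrow> p \<odot> h = p \<odot> k \<Longrightarrow> q \<odot> h = q \<odot> k \<Longrightarrow> h = k"
    unfolding is_pullback_iff by blast+
  have e': "u \<odot> (p \<odot> h) = m \<odot> (q \<odot> h)" if "h \<in> arr C Z P" for Z h
    using assoc[OF that p u] assoc[OF that q m] e by simp
  have pm: "g = h" if "g \<in> arr C Z P" "h \<in> arr C Z P" "p \<odot> g = p \<odot> h" for Z g h
    using un[OF that] mono[OF comp_arr[OF that(1) q] comp_arr[OF that(2) q]] e'[OF that(1)] e'[OF that(2)] that(3)
    by metis
  show thesis
  proof (rule that[of "(P, p)"])
    show "(P, p) \<in> subobjects C W" unfolding subobjects_iff[OF arr_obj(1)[OF u]] using p pm by simp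
    show "is_inverse_image C W X u M (P, p)" unfolding is_inverse_image_def M_def using P by auto
    show "fac C (P, p) Z w \<longleftrightarrow> w \<in> arr C Z W \<and> fac C M Z (u \<odot> w)" for Z w
    proof
      assume "fac C (P, p) Z w"
      then obtain h where h: "h \<in> arr C Z P" and w: "w = p \<odot> h" unfolding fac_def by auto
      show "w \<in> arr C Z W \<and> fac C M Z (u \<odot> w)"
        unfolding fac_def M_def fst_conv snd_conv w e'[OF h] using comp_arr[OF h p] comp_arr[OF h q] by blast
    next
      assume "w \<in> arr C Z W \<and> fac C M Z (u \<odot> w)"
      then obtain k where "w \<in> arr C Z W" "k \<in> arr C Z A" "u \<odot> w = m \<odot> k"
        unfolding fac_def M_def by auto
      from ex[OF this] show "fac C (P, p) Z w" unfolding fac_def by auto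
    qed
  qed
qed

lemma sub_pred_pull:
  assumes \<phi>: "sub_pred C X \<phi>" and u: "u \<in> arr C W X"
  shows "sub_pred C W (\<lambda>Z w. w \<in> arr C Z W \<and> \<phi> Z (u \<odot> w))"
proof -
  obtain M where "M \<in> subobjects C X" and \<phi>_eq: "\<phi> = fac C M" using \<phi> unfolding sub_pred_def by blast
  then obtain N where N: "N \<in> subobjects C W" "\<And>Z w. fac C N Z w \<longleftrightarrow> w \<in> arr C Z W \<and> \<phi> Z (u \<odot> w)"
    using inverse_image_exists[OF _ u] by metis
  show ?thesis by (rule sub_pred_cong[OF fac_sub_pred[OF arr_obj(1)[OF u] N(1)] N(2)])
qed

lemma sub_pred_conj:
  assumes \<phi>: "sub_pred C X \<phi>" and \<psi>: "sub_pred C X \<psi>"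
  shows "sub_pred C X (\<lambda>Z x. \<phi> Z x \<and> \<psi> Z x)"
proof -
  from \<phi> obtain A m where X: "X \<in> obj C" and m: "m \<in> arr C A X"
    and mono: "\<And>Z g h. g \<in> arr C Z A \<Longrightarrow> h \<in> arr C Z A \<Longrightarrow> m \<odot> g = m \<odot> h \<Longrightarrow> g = h"
    and \<phi>_iff: "\<And>Z x. \<phi> Z x \<longleftrightarrow> (\<exists>k\<in>arr C Z A. m \<odot> k = x)" by (rule sub_predE) (rule that)
  from sub_pred_pull[OF \<psi> m] obtain B n where "A \<in> obj C" and n: "n \<in> arr C B A"
    and mono': "\<And>Z g h. g \<in> arr C Z B \<Longrightarrow> h \<in> arr C Z B \<Longrightarrow> n \<odot> g = n \<odot> h \<Longrightarrow> g = h"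
    and n_iff: "\<And>Z a. a \<in> arr C Z A \<and> \<psi> Z (m \<odot> a) \<longleftrightarrow> (\<exists>k\<in>arr C Z B. n \<odot> k = a)" by (rule sub_predE) (rule that)
  show ?thesis
  proof (rule sub_predI[OF X comp_arr[OF n m]])
    fix Z g h assume g: "g \<in> arr C Z B" "h \<in> arr C Z B" and eq: "(m \<odot> n) \<odot> g = (m \<odot> n) \<odot> h"
    then have "m \<odot> (n \<odot> g) = m \<odot> (n \<odot> h)" using assoc[OF _ n m] by metis
    then show "g = h" using g mono mono' comp_arr[OF _ n] by metis
  next
    fix Z x show "(\<phi> Z x \<and> \<psi> Z x) = (\<exists>k\<in>arr C Z B. (m \<odot> n) \<odot> k = x)"
      unfolding \<phi>_iff using n_iff[of _ Z] assoc[OF _ n m] by metis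
  qed
qed

lemma sub_pred_all:
  assumes X: "X \<in> obj C" and "\<And>i. i < n \<Longrightarrow> sub_pred C X (\<phi> (i::nat))"
  shows "sub_pred C X (\<lambda>Z x. x \<in> arr C Z X \<and> (\<forall>i<n. \<phi> i Z x))"
  using assms(2)
proof (induction n)
  case 0
  show ?case using sub_pred_true[OF X] by simp
next
  case (Suc n)
  have "sub_pred C X (\<lambda>Z x. (x \<in> arr C Z X \<and> (\<forall>i<n. \<phi> i Z x)) \<and> \<phi> n Z x)"
    by (rule sub_pred_conj) (use Suc in auto)
  then show ?case by (rule back_subst[of "sub_pred C X"]) (auto simp: less_Suc_eq fun_eq_iff)
qed

lemma pair:
  assumes x: "x \<in> arr C Z X" and y: "y \<in> arr C Z X"
  shows pair_arr: "pair C X Z x y \<in> arr C Z (pow_obj C X 2)"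
    and proj_pair: "pow_proj C X 2 0 \<odot> pair C X Z x y = x" "pow_proj C X 2 1 \<odot> pair C X Z x y = y"
    and pair_restrict: "z \<in> arr C Z' Z \<Longrightarrow> pair C X Z x y \<odot> z = pair C X Z' (x \<odot> z) (y \<odot> z)"
proof -
  have X: "X \<in> obj C" and Z: "Z \<in> obj C" using x arr_obj by fast+
  let ?q = "\<lambda>i::nat. if i = 0 then x else y"
  have q: "\<forall>i<2. ?q i \<in> arr C Z X" using x y by auto
  show "pair C X Z x y \<in> arr C Z (pow_obj C X 2)"
    unfolding pair_def by (rule tuple_arr[OF X Z q])
  show "pow_proj C X 2 0 \<odot> pair C X Z x y = x" "pow_proj C X 2 1 \<odot> pair C X Z x y = y"
    unfolding pair_def using proj_tuple[OF X Z q, of 0] proj_tuple[OF X Z q, of 1] by simp_all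
  show "pair C X Z x y \<odot> z = pair C X Z' (x \<odot> z) (y \<odot> z)" if "z \<in> arr C Z' Z"
    unfolding pair_def using tuple_comp[OF X that q] by (simp add: if_distrib[of "\<lambda>u. u \<odot> z"])
qed

lemma pair_proj:
  assumes X: "X \<in> obj C" and w: "w \<in> arr C Z (pow_obj C X 2)"
  shows "pair C X Z (pow_proj C X 2 0 \<odot> w) (pow_proj C X 2 1 \<odot> w) = w"
  using tuple_proj[OF X w] unfolding pair_def
  by (subst (asm) tuple_cong[of _ _ "\<lambda>i. if i = 0 then pow_proj C X 2 0 \<odot> w else pow_proj C X 2 1 \<odot> w"])
    (auto simp: less_2_cases_iff)

text \<open>
  Closure properties of representable predicates carry over to relations, since an internal
  relation on \<open>X\<close> amounts to a subobject of the square of \<open>X\<close>.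
\<close>

lemma rel_pred_sub_pred:
  assumes \<Phi>: "rel_pred C X \<Phi>"
  shows "sub_pred C (pow_obj C X 2) (\<lambda>Z w. w \<in> arr C Z (pow_obj C X 2) \<and> \<Phi> Z (pow_proj C X 2 0 \<odot> w) (pow_proj C X 2 1 \<odot> w))"
proof -
  from \<Phi> obtain R d0 d1 where X: "X \<in> obj C" and d0: "d0 \<in> arr C R X" and d1: "d1 \<in> arr C R X"
    and mono: "\<And>Z g h. g \<in> arr C Z R \<Longrightarrow> h \<in> arr C Z R \<Longrightarrow> d0 \<odot> g = d0 \<odot> h \<Longrightarrow> d1 \<odot> g = d1 \<odot> h \<Longrightarrow> g = h"
    and \<Phi>_iff: "\<And>Z x y. \<Phi> Z x y \<longleftrightarrow> (\<exists>k\<in>arr C Z R. d0 \<odot> k = x \<and> d1 \<odot> k = y)" by (rule rel_predE) (rule that)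
  note p = pow_proj[OF X, of _ 2]
  have P: "pair C X R d0 d1 \<odot> k = pair C X Z (d0 \<odot> k) (d1 \<odot> k)" if "k \<in> arr C Z R" for Z k
    using pair_restrict[OF d0 d1 that] .
  show ?thesis
  proof (rule sub_predI[OF pow_obj[OF X] pair_arr[OF d0 d1]])
    fix Z g h assume g: "g \<in> arr C Z R" "h \<in> arr C Z R"
      and eq: "pair C X R d0 d1 \<odot> g = pair C X R d0 d1 \<odot> h"
    then have "pair C X Z (d0 \<odot> g) (d1 \<odot> g) = pair C X Z (d0 \<odot> h) (d1 \<odot> h)" using P by metis
    then have "d0 \<odot> g = d0 \<odot> h" "d1 \<odot> g = d1 \<odot> h"
      using proj_pair[OF comp_arr[OF g(1) d0] comp_arr[OF g(1) d1]]
        proj_pair[OF comp_arr[OF g(2) d0] comp_arr[OF g(2) d1]] by metis+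
    then show "g = h" using mono g by blast
  next
    fix Z w
    show "(w \<in> arr C Z (pow_obj C X 2) \<and> \<Phi> Z (pow_proj C X 2 0 \<odot> w) (pow_proj C X 2 1 \<odot> w)) =
        (\<exists>k\<in>arr C Z R. pair C X R d0 d1 \<odot> k = w)"
    proof
      assume "w \<in> arr C Z (pow_obj C X 2) \<and> \<Phi> Z (pow_proj C X 2 0 \<odot> w) (pow_proj C X 2 1 \<odot> w)"
      then show "\<exists>k\<in>arr C Z R. pair C X R d0 d1 \<odot> k = w"
        unfolding \<Phi>_iff using P pair_proj[OF X] by metis
    next
      assume "\<exists>k\<in>arr C Z R. pair C X R d0 d1 \<odot> k = w"
      then obtain k where k: "k \<in> arr C Z R" "w = pair C X Z (d0 \<odot> k) (d1 \<odot> k)" using P by metis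
      note dk = comp_arr[OF k(1) d0] comp_arr[OF k(1) d1]
      show "w \<in> arr C Z (pow_obj C X 2) \<and> \<Phi> Z (pow_proj C X 2 0 \<odot> w) (pow_proj C X 2 1 \<odot> w)"
        using pair_arr[OF dk] proj_pair[OF dk] k unfolding \<Phi>_iff by auto
    qed
  qed
qed

lemma sub_pred_rel_pred:
  assumes \<phi>: "sub_pred C (pow_obj C X 2) \<phi>" and X: "X \<in> obj C"
  shows "rel_pred C X (\<lambda>Z x y. x \<in> arr C Z X \<and> y \<in> arr C Z X \<and> \<phi> Z (pair C X Z x y))"
proof -
  from \<phi> obtain A m where "pow_obj C X 2 \<in> obj C" and m: "m \<in> arr C A (pow_obj C X 2)"
    and mono: "\<And>Z g h. g \<in> arr C Z A \<Longrightarrow> h \<in> arr C Z A \<Longrightarrow> m \<odot> g = m \<odot> h \<Longrightarrow> g = h"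
    and \<phi>_iff: "\<And>Z x. \<phi> Z x \<longleftrightarrow> (\<exists>k\<in>arr C Z A. m \<odot> k = x)" by (rule sub_predE) (rule that)
  have p0: "pow_proj C X 2 0 \<in> arr C (pow_obj C X 2) X" and p1: "pow_proj C X 2 1 \<in> arr C (pow_obj C X 2) X"
    using pow_proj[OF X, of _ 2] by auto
  have a: "(pow_proj C X 2 0 \<odot> m) \<odot> k = pow_proj C X 2 0 \<odot> (m \<odot> k)"
    "(pow_proj C X 2 1 \<odot> m) \<odot> k = pow_proj C X 2 1 \<odot> (m \<odot> k)" if "k \<in> arr C Z A" for k Z
    using assoc[OF that m p0] assoc[OF that m p1] by auto
  show ?thesis
  proof (rule rel_predI[OF X comp_arr[OF m p0] comp_arr[OF m p1]])
    fix Z g h assume g: "g \<in> arr C Z A" "h \<in> arr C Z A"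
      and eq: "(pow_proj C X 2 0 \<odot> m) \<odot> g = (pow_proj C X 2 0 \<odot> m) \<odot> h"
         "(pow_proj C X 2 1 \<odot> m) \<odot> g = (pow_proj C X 2 1 \<odot> m) \<odot> h"
    then have "m \<odot> g = m \<odot> h"
      using pair_proj[OF X comp_arr[OF g(1) m]] pair_proj[OF X comp_arr[OF g(2) m]] a[OF g(1)] a[OF g(2)] by metis
    then show "g = h" using mono g by blast
  next
    fix Z x y
    show "(x \<in> arr C Z X \<and> y \<in> arr C Z X \<and> \<phi> Z (pair C X Z x y)) =
      (\<exists>k\<in>arr C Z A. (pow_proj C X 2 0 \<odot> m) \<odot> k = x \<and> (pow_proj C X 2 1 \<odot> m) \<odot> k = y)"
    proof
      assume "x \<in> arr C Z X \<and> y \<in> arr C Z X \<and> \<phi> Z (pair C X Z x y)"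
      then show "\<exists>k\<in>arr C Z A. (pow_proj C X 2 0 \<odot> m) \<odot> k = x \<and> (pow_proj C X 2 1 \<odot> m) \<odot> k = y"
        unfolding \<phi>_iff using a proj_pair by metis
    next
      assume "\<exists>k\<in>arr C Z A. (pow_proj C X 2 0 \<odot> m) \<odot> k = x \<and> (pow_proj C X 2 1 \<odot> m) \<odot> k = y"
      then obtain k where k: "k \<in> arr C Z A" and xy: "x = pow_proj C X 2 0 \<odot> (m \<odot> k)" "y = pow_proj C X 2 1 \<odot> (m \<odot> k)"
        using a by metis
      note mk = comp_arr[OF k m]
      show "x \<in> arr C Z X \<and> y \<in> arr C Z X \<and> \<phi> Z (pair C X Z x y)"
        unfolding \<phi>_iff xy pair_proj[OF X mk] using k comp_arr[OF mk p0] comp_arr[OF mk p1] by blast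
    qed
  qed
qed

lemma rel_pred_pull:
  assumes \<Phi>: "rel_pred C X \<Phi>" and u: "u \<in> arr C W X" and v: "v \<in> arr C W X"
  shows "sub_pred C W (\<lambda>Z w. w \<in> arr C Z W \<and> \<Phi> Z (u \<odot> w) (v \<odot> w))"
proof -
  have "w \<in> arr C Z W \<Longrightarrow> pair C X W u v \<odot> w = pair C X Z (u \<odot> w) (v \<odot> w)" for Z w
    using pair_restrict[OF u v] .
  then have *: "w \<in> arr C Z W \<Longrightarrow> pair C X W u v \<odot> w \<in> arr C Z (pow_obj C X 2) \<and>
      pow_proj C X 2 0 \<odot> (pair C X W u v \<odot> w) = u \<odot> w \<and> pow_proj C X 2 1 \<odot> (pair C X W u v \<odot> w) = v \<odot> w" for Z w
    using pair[OF comp_arr[OF _ u] comp_arr[OF _ v]] by metis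
  show ?thesis
  proof (rule sub_pred_cong[OF sub_pred_pull[OF rel_pred_sub_pred[OF \<Phi>] pair_arr[OF u v]]], rule conj_cong[OF refl])
    fix Z w assume "w \<in> arr C Z W"
    from *[OF this] show "(pair C X W u v \<odot> w \<in> arr C Z (pow_obj C X 2) \<and>
        \<Phi> Z (pow_proj C X 2 0 \<odot> (pair C X W u v \<odot> w)) (pow_proj C X 2 1 \<odot> (pair C X W u v \<odot> w))) =
        \<Phi> Z (u \<odot> w) (v \<odot> w)"
      by (elim conjE) (simp only: simp_thms)
  qed
qed

lemma rel_pred_conj:
  assumes \<Phi>: "rel_pred C X \<Phi>" and \<Psi>: "rel_pred C X \<Psi>"
  shows "rel_pred C X (\<lambda>Z x y. \<Phi> Z x y \<and> \<Psi> Z x y)"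
proof -
  have X: "X \<in> obj C" using \<Phi> by (simp add: rel_pred_def)
  show ?thesis
    by (rule rel_pred_cong[OF sub_pred_rel_pred[OF sub_pred_conj[OF rel_pred_sub_pred[OF \<Phi>]
      rel_pred_sub_pred[OF \<Psi>]] X]]) (use pair_arr proj_pair rel_pred_arr[OF \<Phi>] in metis)
qed

lemma rel_pred_eq:
  assumes X: "X \<in> obj C" shows "rel_pred C X (\<lambda>Z x y. x \<in> arr C Z X \<and> x = y)"
  by (rule rel_predI[OF X idt_arr[OF X] idt_arr[OF X]]) (auto simp: idt_left)

end

section \<open>Internal algebras and their generalised elements\<close>

text \<open>
  The elements of an internal algebra at a fixed stage form an ordinary algebra, and restriction
  preserves the operations.  \<open>opr\<close> and \<open>evl\<close> are the operations and the term functions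
  of this algebra.
\<close>

definition opr ::
    "'f alg_theory \<Rightarrow> ('o, 'm) cat \<Rightarrow> 'o \<times> ('f \<Rightarrow> 'm) \<Rightarrow> 'f \<Rightarrow> 'o \<Rightarrow> (nat \<Rightarrow> 'm) \<Rightarrow> 'm" where
  "opr T C A f Z xs = snd A f \<odot>\<^bsub>C\<^esub> tuple C (fst A) (arity T f) Z xs"

primrec evl :: "('o, 'm) cat \<Rightarrow> 'o \<times> ('f \<Rightarrow> 'm) \<Rightarrow> 'o \<Rightarrow> (nat \<Rightarrow> 'm) \<Rightarrow> 'f trm \<Rightarrow> 'm" where
  "evl C A Z xs (Var i) = xs i"
| "evl C A Z xs (App f ts) =
     snd A f \<odot>\<^bsub>C\<^esub> tuple C (fst A) (length ts) Z (\<lambda>i. map (evl C A Z xs) ts ! i)"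

definition operations :: "'f alg_theory \<Rightarrow> ('o, 'm) cat \<Rightarrow> 'o \<times> ('f \<Rightarrow> 'm) \<Rightarrow> bool" where
  "operations T C A \<longleftrightarrow> fst A \<in> obj C \<and>
     (\<forall>f\<in>ops T. snd A f \<in> arr C (pow_obj C (fst A) (arity T f)) (fst A))"

text \<open>The interpretation of a term is its value at the generic tuple of elements.\<close>

lemma interp_evl: "interp C X \<alpha> k t = evl C (X, \<alpha>) (pow_obj C X k) (pow_proj C X k) t"
  by (induction t) (simp_all cong: map_cong)

lemma evl_App:
  "wf_trm T k (App f ts) \<Longrightarrow> evl C A Z xs (App f ts) = opr T C A f Z (\<lambda>i. evl C A Z xs (ts ! i))"
  unfolding evl.simps opr_def by (rule arg_cong[of _ _ "cmp C (snd A f)"]) (auto intro: tuple_cong)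

lemma algebra_cat_simps [simp]:
  "obj (algebra_cat T C) = internal_algebras T C" "hom (algebra_cat T C) = algebra_homs T C"
  "idt (algebra_cat T C) A = idt C (fst A)" "cmp (algebra_cat T C) = cmp C"
  by (simp_all add: algebra_cat_def)

context lex_category
begin

context
  fixes T :: "'f alg_theory" and A :: "'o \<times> ('f \<Rightarrow> 'm)"
  assumes A: "operations T C A"
begin

lemma operations_obj: "fst A \<in> obj C"
  using A by (simp add: operations_def)

lemma opr_arr:
  assumes "f \<in> ops T" "Z \<in> obj C" "\<forall>i<arity T f. xs i \<in> arr C Z (fst A)"
  shows "opr T C A f Z xs \<in> arr C Z (fst A)"
proof -
  have "snd A f \<in> arr C (pow_obj C (fst A) (arity T f)) (fst A)" using A assms by (auto simp: operations_def)
  then show ?thesis unfolding opr_def using tuple_arr[OF operations_obj assms(2,3)] by blast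
qed

lemma opr_restrict:
  assumes f: "f \<in> ops T" and z: "z \<in> arr C Z' Z" and xs: "\<forall>i<arity T f. xs i \<in> arr C Z (fst A)"
  shows "opr T C A f Z xs \<odot> z = opr T C A f Z' (\<lambda>i. xs i \<odot> z)"
proof -
  have "snd A f \<in> arr C (pow_obj C (fst A) (arity T f)) (fst A)" using A f by (auto simp: operations_def)
  then show ?thesis
    unfolding opr_def using assoc[OF z tuple_arr[OF operations_obj arr_obj(2)[OF z] xs]]
      tuple_comp[OF operations_obj z xs] by simp
qed

lemma opr_generic:
  assumes f: "f \<in> ops T"
  shows "opr T C A f (pow_obj C (fst A) (arity T f)) (pow_proj C (fst A) (arity T f)) = snd A f"
proof -
  let ?P = "pow_obj C (fst A) (arity T f)"
  have P: "?P \<in> obj C" using pow_obj operations_obj by blast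
  have "tuple C (fst A) (arity T f) ?P (pow_proj C (fst A) (arity T f)) = idt C ?P"
    using tuple_proj[OF operations_obj idt_arr[OF P]] idt_right[OF pow_proj[OF operations_obj]]
    by (metis (no_types, lifting) tuple_cong)
  then show ?thesis
    unfolding opr_def using A f idt_right by (metis operations_def)
qed

lemma opr_cong: "(\<And>i. i < arity T f \<Longrightarrow> xs i = ys i) \<Longrightarrow> opr T C A f Z xs = opr T C A f Z ys"
  unfolding opr_def by (metis tuple_cong)

lemma evl_arr:
  "wf_trm T k t \<Longrightarrow> Z \<in> obj C \<Longrightarrow> \<forall>i<k. xs i \<in> arr C Z (fst A) \<Longrightarrow> evl C A Z xs t \<in> arr C Z (fst A)"
proof (induction t)
  case (App f ts)
  show ?case unfolding evl_App[OF App.prems(1)] by (rule opr_arr) (use App in auto)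
qed simp

lemma evl_restrict:
  "wf_trm T k t \<Longrightarrow> z \<in> arr C Z' Z \<Longrightarrow> \<forall>i<k. xs i \<in> arr C Z (fst A) \<Longrightarrow>
    evl C A Z xs t \<odot> z = evl C A Z' (\<lambda>i. xs i \<odot> z) t"
proof (induction t)
  case (App f ts)
  have f: "f \<in> ops T" and l: "length ts = arity T f" and w: "\<And>i. i < arity T f \<Longrightarrow> wf_trm T k (ts ! i)"
    using App.prems(1) by auto
  have "evl C A Z xs (App f ts) \<odot> z = opr T C A f Z' (\<lambda>i. evl C A Z xs (ts ! i) \<odot> z)"
    unfolding evl_App[OF App.prems(1)]
    by (rule opr_restrict[OF f App.prems(2)]) (use evl_arr[OF w arr_obj(2)[OF App.prems(2)] App.prems(3)] in blast)
  also have "\<dots> = opr T C A f Z' (\<lambda>i. evl C A Z' (\<lambda>i. xs i \<odot> z) (ts ! i))"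
    by (rule opr_cong) (use App l w in auto)
  finally show ?case unfolding evl_App[OF App.prems(1)] .
qed simp

end

lemma internal_algebras_iff:
  assumes T: "algebraic_theory T"
  shows "A \<in> internal_algebras T C \<longleftrightarrow> operations T C A \<and> (\<forall>f. f \<notin> ops T \<longrightarrow> snd A f = undefined) \<and>
    (\<forall>(k, s, t)\<in>axioms T. \<forall>Z\<in>obj C. \<forall>xs. (\<forall>i<k. xs i \<in> arr C Z (fst A)) \<longrightarrow> evl C A Z xs s = evl C A Z xs t)"
    (is "?l \<longleftrightarrow> ?r")
proof -
  obtain X \<alpha> where A: "A = (X, \<alpha>)" by (cases A)
  have 1: "?l \<longleftrightarrow> operations T C A \<and> (\<forall>f. f \<notin> ops T \<longrightarrow> snd A f = undefined) \<and>
      (\<forall>(k, s, t)\<in>axioms T. interp C X \<alpha> k s = interp C X \<alpha> k t)"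
    unfolding internal_algebras_def operations_def arr_def A using pow_obj by auto
  have 2: "interp C X \<alpha> k s = interp C X \<alpha> k t \<longleftrightarrow>
      (\<forall>Z\<in>obj C. \<forall>xs. (\<forall>i<k. xs i \<in> arr C Z (fst A)) \<longrightarrow> evl C A Z xs s = evl C A Z xs t)" (is "?i \<longleftrightarrow> ?e")
    if ops: "operations T C A" and ax: "(k, s, t) \<in> axioms T" for k s t
  proof
    have wf: "wf_trm T k s" "wf_trm T k t" using T ax unfolding algebraic_theory_def by auto
    have X: "X \<in> obj C" using ops A operations_obj by fastforce
    note p = pow_proj[OF X, of _ k]
    show ?e if ?i
    proof (intro ballI allI impI)
      fix Z xs assume Z: "Z \<in> obj C" and "\<forall>i<k. xs i \<in> arr C Z (fst A)"
      then have xs: "\<forall>i<k. xs i \<in> arr C Z X" using A by simp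
      have e: "evl C A Z xs u = interp C X \<alpha> k u \<odot> tuple C X k Z xs" if "wf_trm T k u" for u
      proof -
        have "interp C X \<alpha> k u \<odot> tuple C X k Z xs = evl C A Z (\<lambda>i. pow_proj C X k i \<odot> tuple C X k Z xs) u"
          unfolding interp_evl A[symmetric]
          by (rule evl_restrict[OF ops that tuple_arr[OF X Z xs]]) (use p A in auto)
        also have "\<dots> = evl C A Z xs u"
          using that
        proof (induction u)
          case (Var i)
          then show ?case using proj_tuple[OF X Z xs] by simp
        next
          case (App f ts)
          show ?case unfolding evl_App[OF App.prems]
            by (rule opr_cong[OF ops]) (use App in auto)
        qed
        finally show ?thesis by simp
      qed
      show "evl C A Z xs s = evl C A Z xs t" using e wf \<open>?i\<close> by simp
    qed
    show ?i if ?e unfolding interp_evl A[symmetric] using that pow_obj[OF X] p A by auto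
  qed
  show ?thesis unfolding 1 using 2 by (auto 0 3)
qed

lemma algebra_axiom:
  assumes "algebraic_theory T" "A \<in> internal_algebras T C" "(k, s, t) \<in> axioms T"
    "Z \<in> obj C" "\<forall>i<k. xs i \<in> arr C Z (fst A)"
  shows "evl C A Z xs s = evl C A Z xs t"
proof -
  have "\<forall>(k, s, t)\<in>axioms T. \<forall>Z\<in>obj C. \<forall>xs. (\<forall>i<k. xs i \<in> arr C Z (fst A)) \<longrightarrow> evl C A Z xs s = evl C A Z xs t"
    using assms(2) unfolding internal_algebras_iff[OF assms(1)] by (elim conjE)
  from bspec[OF this assms(3)] show ?thesis using assms(4,5) by simp
qed

lemma algebra_operations: "A \<in> internal_algebras T C \<Longrightarrow> operations T C A"
  unfolding internal_algebras_def operations_def arr_def using pow_obj by auto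

lemma alg_arr_iff:
  "h \<in> arr (algebra_cat T C) A B \<longleftrightarrow>
    A \<in> internal_algebras T C \<and> B \<in> internal_algebras T C \<and> h \<in> arr C (fst A) (fst B) \<and>
    (\<forall>f\<in>ops T. \<forall>Z\<in>obj C. \<forall>xs. (\<forall>i<arity T f. xs i \<in> arr C Z (fst A)) \<longrightarrow>
      h \<odot> opr T C A f Z xs = opr T C B f Z (\<lambda>i. h \<odot> xs i))"
    (is "_ \<longleftrightarrow> ?A \<and> ?B \<and> ?h \<and> ?p")
proof -
  obtain X \<alpha> Y \<beta> where AB: "A = (X, \<alpha>)" "B = (Y, \<beta>)" by (cases A, cases B)
  have 1: "h \<in> arr (algebra_cat T C) A B \<longleftrightarrow> ?A \<and> ?B \<and> ?h \<and> (\<forall>f\<in>ops T.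
      h \<odot> snd A f = opr T C B f (pow_obj C X (arity T f)) (\<lambda>i. h \<odot> pow_proj C X (arity T f) i))"
    using operations_obj[OF algebra_operations, of "(X, \<alpha>)" T] operations_obj[OF algebra_operations, of "(Y, \<beta>)" T]
    unfolding arr_def algebra_cat_simps algebra_homs_def opr_def AB by auto
  have "?p \<longleftrightarrow> (\<forall>f\<in>ops T.
      h \<odot> snd A f = opr T C B f (pow_obj C X (arity T f)) (\<lambda>i. h \<odot> pow_proj C X (arity T f) i))"
    if "?A" "?B" and h: "?h"
  proof (intro iffI ballI allI impI)
    note oA = algebra_operations[OF \<open>?A\<close>] and oB = algebra_operations[OF \<open>?B\<close>]
    have X: "X \<in> obj C" using operations_obj[OF oA] AB by simp
    {
      fix f assume p: ?p and f: "f \<in> ops T"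
      then show "h \<odot> snd A f = opr T C B f (pow_obj C X (arity T f)) (\<lambda>i. h \<odot> pow_proj C X (arity T f) i)"
        using opr_generic[OF oA f] pow_obj[OF X] pow_proj[OF X] AB by (metis fst_conv)
    }
    {
      fix f Z xs
      assume g: "\<forall>f\<in>ops T. h \<odot> snd A f = opr T C B f (pow_obj C X (arity T f)) (\<lambda>i. h \<odot> pow_proj C X (arity T f) i)"
        and f: "f \<in> ops T" and Z: "Z \<in> obj C" and xs: "\<forall>i<arity T f. xs i \<in> arr C Z (fst A)"
      let ?n = "arity T f" let ?t = "tuple C X ?n Z xs"
      have t: "?t \<in> arr C Z (pow_obj C X ?n)" using tuple_arr[OF X Z] xs AB by simp
      have a: "snd A f \<in> arr C (pow_obj C X ?n) X" using oA f AB unfolding operations_def by auto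
      have h': "h \<in> arr C X (fst B)" using h AB by simp
      have hp: "\<forall>i<?n. h \<odot> pow_proj C X ?n i \<in> arr C (pow_obj C X ?n) (fst B)"
        using h' pow_proj[OF X] by blast
      have "h \<odot> opr T C A f Z xs = (h \<odot> snd A f) \<odot> ?t"
        unfolding opr_def using assoc[OF t a h'] AB by simp
      also have "\<dots> = opr T C B f Z (\<lambda>i. (h \<odot> pow_proj C X ?n i) \<odot> ?t)"
        using g f opr_restrict[OF oB f t hp] by simp
      also have "\<dots> = opr T C B f Z (\<lambda>i. h \<odot> xs i)"
      proof (rule opr_cong[OF oB])
        fix i assume i: "i < ?n"
        show "(h \<odot> pow_proj C X ?n i) \<odot> ?t = h \<odot> xs i"
          using assoc[OF t pow_proj[OF X i] h'] proj_tuple[OF X Z _ i, of xs] xs AB by simp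
      qed
      finally show "h \<odot> opr T C A f Z xs = opr T C B f Z (\<lambda>i. h \<odot> xs i)" .
    }
  qed
  then show ?thesis unfolding 1 by blast
qed

lemma alg_arrD:
  assumes "h \<in> arr (algebra_cat T C) A B"
  shows "A \<in> internal_algebras T C" "B \<in> internal_algebras T C" "h \<in> arr C (fst A) (fst B)"
    "f \<in> ops T \<Longrightarrow> Z \<in> obj C \<Longrightarrow> \<forall>i<arity T f. xs i \<in> arr C Z (fst A) \<Longrightarrow>
      h \<odot> opr T C A f Z xs = opr T C B f Z (\<lambda>i. h \<odot> xs i)"
  using assms unfolding alg_arr_iff by blast+

lemma algebra_cat_category: "cat_setup (algebra_cat T C)"
proof
  let ?K = "algebra_cat T C"
  have i: "idt C (fst A) \<in> arr ?K A A" if A: "A \<in> internal_algebras T C" for A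
  proof -
    note o = algebra_operations[OF A]
    have "idt C (fst A) \<odot> opr T C A f Z xs = opr T C A f Z (\<lambda>i. idt C (fst A) \<odot> xs i)"
      if "f \<in> ops T" "Z \<in> obj C" "\<forall>i<arity T f. xs i \<in> arr C Z (fst A)" for f Z xs
      using idt_left[OF opr_arr[OF o that]] opr_cong[OF o, of f "\<lambda>i. idt C (fst A) \<odot> xs i" xs Z] idt_left that(3)
      by metis
    then show ?thesis unfolding alg_arr_iff using A idt_arr[OF operations_obj[OF o]] by blast
  qed
  have c: "g \<odot> f \<in> arr ?K A D" if f: "f \<in> arr ?K A B" and g: "g \<in> arr ?K B D" for A B D f g
  proof -
    note f' = alg_arrD[OF f] and g' = alg_arrD[OF g]
    note oA = algebra_operations[OF f'(1)] and oD = algebra_operations[OF g'(2)]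
    have "(g \<odot> f) \<odot> opr T C A u Z xs = opr T C D u Z (\<lambda>i. (g \<odot> f) \<odot> xs i)"
      if u: "u \<in> ops T" "Z \<in> obj C" "\<forall>i<arity T u. xs i \<in> arr C Z (fst A)" for u Z xs
    proof -
      have "(g \<odot> f) \<odot> opr T C A u Z xs = g \<odot> opr T C B u Z (\<lambda>i. f \<odot> xs i)"
        using assoc[OF opr_arr[OF oA u] f'(3) g'(3)] f'(4)[OF u] by simp
      also have "\<dots> = opr T C D u Z (\<lambda>i. g \<odot> (f \<odot> xs i))"
        by (rule g'(4)[OF u(1,2)]) (use u(3) f'(3) in blast)
      also have "\<dots> = opr T C D u Z (\<lambda>i. (g \<odot> f) \<odot> xs i)"
        by (rule opr_cong[OF oD]) (use assoc[OF _ f'(3) g'(3)] u(3) in metis)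
      finally show ?thesis .
    qed
    then show ?thesis unfolding alg_arr_iff using f'(1) g'(2) comp_arr[OF f'(3) g'(3)] by blast
  qed
  have "idt C (fst A) \<in> hom ?K A A" if "A \<in> obj ?K" for A
    using i[of A] that arr_hom by fastforce
  moreover have "g \<odot> f \<in> hom ?K A D"
    if "A \<in> obj ?K" "B \<in> obj ?K" "D \<in> obj ?K" "f \<in> hom ?K A B" "g \<in> hom ?K B D" for A B D f g
    using c[OF hom_arr[OF that(1,2,4)] hom_arr[OF that(2,3,5)]] by (rule arr_hom)
  moreover have "f \<odot> idt C (fst A) = f \<and> idt C (fst B) \<odot> f = f"
    if "A \<in> obj ?K" "B \<in> obj ?K" "f \<in> hom ?K A B" for A B f
    using alg_arrD(3)[OF hom_arr[OF that]] idt_left idt_right by blast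
  moreover have "(h \<odot> g) \<odot> f = h \<odot> (g \<odot> f)"
    if "A \<in> obj ?K" "B \<in> obj ?K" "D \<in> obj ?K" "F \<in> obj ?K" "f \<in> hom ?K A B" "g \<in> hom ?K B D" "h \<in> hom ?K D F"
    for A B D F f g h
    using assoc[OF alg_arrD(3)[OF hom_arr[OF that(1,2,5)]] alg_arrD(3)[OF hom_arr[OF that(2,3,6)]]
      alg_arrD(3)[OF hom_arr[OF that(3,4,7)]]] .
  ultimately show "category ?K" unfolding category_def by simp
qed

subsection \<open>Construction of algebras\<close>

text \<open>Yoneda: a natural family of operations on elements comes from a unique internal operation.\<close>

lemma algebra_of_natural_operations:
  assumes T: "algebraic_theory T" and L: "L \<in> obj C"
    and o_arr: "\<And>f Z xs. f \<in> ops T \<Longrightarrow> Z \<in> obj C \<Longrightarrow> \<forall>i<arity T f. xs i \<in> arr C Z L \<Longrightarrow> u f Z xs \<in> arr C Z L"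
    and o_nat: "\<And>f Z xs z Z'. f \<in> ops T \<Longrightarrow> z \<in> arr C Z' Z \<Longrightarrow> \<forall>i<arity T f. xs i \<in> arr C Z L \<Longrightarrow>
      u f Z xs \<odot> z = u f Z' (\<lambda>i. xs i \<odot> z)"
    and o_cong: "\<And>f Z xs ys. f \<in> ops T \<Longrightarrow> (\<And>i. i < arity T f \<Longrightarrow> xs i = ys i) \<Longrightarrow> u f Z xs = u f Z ys"
  obtains l where "operations T C (L, l)" "\<And>f. f \<notin> ops T \<Longrightarrow> l f = undefined"
    "\<And>f Z xs. f \<in> ops T \<Longrightarrow> Z \<in> obj C \<Longrightarrow> \<forall>i<arity T f. xs i \<in> arr C Z L \<Longrightarrow>
      opr T C (L, l) f Z xs = u f Z xs"
proof -
  let ?l = "\<lambda>f. if f \<in> ops T then u f (pow_obj C L (arity T f)) (pow_proj C L (arity T f)) else undefined"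
  have "operations T C (L, ?l)" unfolding operations_def using L pow_obj[OF L] pow_proj[OF L] o_arr by simp
  moreover have "opr T C (L, ?l) f Z xs = u f Z xs"
    if f: "f \<in> ops T" and Z: "Z \<in> obj C" and xs: "\<forall>i<arity T f. xs i \<in> arr C Z L" for f Z xs
  proof -
    have "opr T C (L, ?l) f Z xs = u f Z (\<lambda>i. pow_proj C L (arity T f) i \<odot> tuple C L (arity T f) Z xs)"
      unfolding opr_def using f o_nat[OF f tuple_arr[OF L Z xs]] pow_proj[OF L] by simp
    also have "\<dots> = u f Z xs" by (rule o_cong[OF f]) (rule proj_tuple[OF L Z xs])
    finally show ?thesis .
  qed
  ultimately show thesis using that[of ?l] by simp
qed

text \<open>
  Limits of algebras and compatible relations on an algebra carry the same kind of algebra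
  structure: the one that is forced by a jointly monic family of homomorphisms.
\<close>

lemma algebra_along_jointly_monic:
  fixes A :: "nat \<Rightarrow> 'o \<times> ('f \<Rightarrow> 'm)"
  assumes T: "algebraic_theory T" and L: "L \<in> obj C"
    and A: "\<And>i. i < n \<Longrightarrow> A i \<in> internal_algebras T C" and p: "\<And>i. i < n \<Longrightarrow> p i \<in> arr C L (fst (A i))"
    and jm: "\<And>Z g h. g \<in> arr C Z L \<Longrightarrow> h \<in> arr C Z L \<Longrightarrow> (\<And>i. i < n \<Longrightarrow> p i \<odot> g = p i \<odot> h) \<Longrightarrow> g = h"
    and closed: "\<And>f Z xs. f \<in> ops T \<Longrightarrow> Z \<in> obj C \<Longrightarrow> \<forall>j<arity T f. xs j \<in> arr C Z L \<Longrightarrow>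
      \<exists>h\<in>arr C Z L. \<forall>i<n. p i \<odot> h = opr T C (A i) f Z (\<lambda>j. p i \<odot> xs j)"
  obtains l where "(L, l) \<in> internal_algebras T C" "\<And>i. i < n \<Longrightarrow> p i \<in> arr (algebra_cat T C) (L, l) (A i)"
proof -
  note o = algebra_operations[OF A]
  define u where "u f Z xs = (SOME h. h \<in> arr C Z L \<and> (\<forall>i<n. p i \<odot> h = opr T C (A i) f Z (\<lambda>j. p i \<odot> xs j)))" for f Z xs
  have u: "u f Z xs \<in> arr C Z L \<and> (\<forall>i<n. p i \<odot> u f Z xs = opr T C (A i) f Z (\<lambda>j. p i \<odot> xs j))"
    if "f \<in> ops T" "Z \<in> obj C" "\<forall>j<arity T f. xs j \<in> arr C Z L" for f Z xs
    unfolding u_def by (rule someI_ex) (use closed[OF that] in blast)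
  have u_nat: "u f Z xs \<odot> z = u f Z' (\<lambda>i. xs i \<odot> z)"
    if f: "f \<in> ops T" and z: "z \<in> arr C Z' Z" and xs: "\<forall>i<arity T f. xs i \<in> arr C Z L" for f Z xs z Z'
  proof (rule jm)
    have Z: "Z \<in> obj C" "Z' \<in> obj C" using z arr_obj by fast+
    have xz: "\<forall>i<arity T f. xs i \<odot> z \<in> arr C Z' L" using xs z by blast
    note 1 = u[OF f Z(1) xs] and 2 = u[OF f Z(2), of "\<lambda>i. xs i \<odot> z"]
    show "u f Z xs \<odot> z \<in> arr C Z' L" "u f Z' (\<lambda>i. xs i \<odot> z) \<in> arr C Z' L" using 1 2 xz z by blast+
    fix i assume i: "i < n"
    have px: "\<forall>j<arity T f. p i \<odot> xs j \<in> arr C Z (fst (A i))" using p[OF i] xs by blast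
    have "p i \<odot> (u f Z xs \<odot> z) = opr T C (A i) f Z (\<lambda>j. p i \<odot> xs j) \<odot> z"
      using assoc[OF z conjunct1[OF 1] p[OF i]] 1 i by simp
    also have "\<dots> = opr T C (A i) f Z' (\<lambda>j. (p i \<odot> xs j) \<odot> z)" by (rule opr_restrict[OF o[OF i] f z px])
    also have "\<dots> = opr T C (A i) f Z' (\<lambda>j. p i \<odot> (xs j \<odot> z))"
      by (rule opr_cong[OF o[OF i]]) (use assoc[OF z _ p[OF i]] xs in simp)
    also have "\<dots> = p i \<odot> u f Z' (\<lambda>i. xs i \<odot> z)" using 2 xz i by simp
    finally show "p i \<odot> (u f Z xs \<odot> z) = p i \<odot> u f Z' (\<lambda>i. xs i \<odot> z)" .
  qed
  have u_cong: "u f Z xs = u f Z ys" if "f \<in> ops T" "\<And>i. i < arity T f \<Longrightarrow> xs i = ys i" for f Z xs ys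
  proof -
    have "opr T C (A i) f Z (\<lambda>j. p i \<odot> xs j) = opr T C (A i) f Z (\<lambda>j. p i \<odot> ys j)" if "i < n" for i
      by (rule opr_cong[OF o[OF that]]) (simp add: \<open>\<And>i. i < arity T f \<Longrightarrow> xs i = ys i\<close>)
    then show ?thesis unfolding u_def by (intro arg_cong[of _ _ Eps]) (auto simp: fun_eq_iff)
  qed
  obtain l where l: "operations T C (L, l)" "\<And>f. f \<notin> ops T \<Longrightarrow> l f = undefined"
    "\<And>f Z xs. f \<in> ops T \<Longrightarrow> Z \<in> obj C \<Longrightarrow> \<forall>i<arity T f. xs i \<in> arr C Z L \<Longrightarrow>
      opr T C (L, l) f Z xs = u f Z xs"
    using algebra_of_natural_operations[OF T L, of u] u u_nat u_cong by blast
  have pe: "p i \<odot> opr T C (L, l) f Z xs = opr T C (A i) f Z (\<lambda>j. p i \<odot> xs j)"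
    if "i < n" "f \<in> ops T" "Z \<in> obj C" "\<forall>j<arity T f. xs j \<in> arr C Z L" for i f Z xs
    using u[OF that(2-4)] l(3)[OF that(2-4)] that(1) by simp
  have pevl: "p i \<odot> evl C (L, l) Z xs t = evl C (A i) Z (\<lambda>j. p i \<odot> xs j) t"
    if i: "i < n" and Z: "Z \<in> obj C" and xs: "\<forall>j<k. xs j \<in> arr C Z L" and wf: "wf_trm T k t" for i k Z xs t
    using wf
  proof (induction t)
    case (App f ts)
    have f: "f \<in> ops T" and len: "length ts = arity T f" and w: "\<And>i. i < arity T f \<Longrightarrow> wf_trm T k (ts ! i)"
      using App.prems(1) by auto
    have "p i \<odot> evl C (L, l) Z xs (App f ts) = opr T C (A i) f Z (\<lambda>j. p i \<odot> evl C (L, l) Z xs (ts ! j))"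
      unfolding evl_App[OF App.prems(1)]
      by (rule pe[OF i f Z]) (use evl_arr[OF l(1) w Z] xs in simp)
    also have "\<dots> = opr T C (A i) f Z (\<lambda>j. evl C (A i) Z (\<lambda>j. p i \<odot> xs j) (ts ! j))"
      by (rule opr_cong[OF o[OF i]]) (use App len w in auto)
    finally show ?case unfolding evl_App[OF App.prems(1)] .
  qed simp
  have "evl C (L, l) Z xs s = evl C (L, l) Z xs t"
    if ax: "(k, s, t) \<in> axioms T" and Z: "Z \<in> obj C" and xs: "\<forall>j<k. xs j \<in> arr C Z L" for k s t Z xs
  proof (rule jm)
    have wf: "wf_trm T k s" "wf_trm T k t" using T ax unfolding algebraic_theory_def by auto
    show "evl C (L, l) Z xs s \<in> arr C Z L" "evl C (L, l) Z xs t \<in> arr C Z L"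
      using evl_arr[OF l(1) wf(1) Z] evl_arr[OF l(1) wf(2) Z] xs by simp_all
    fix i assume i: "i < n"
    have px: "\<forall>j<k. p i \<odot> xs j \<in> arr C Z (fst (A i))" using p[OF i] xs by blast
    have "evl C (A i) Z (\<lambda>j. p i \<odot> xs j) s = evl C (A i) Z (\<lambda>j. p i \<odot> xs j) t"
      by (rule algebra_axiom[OF T A[OF i] ax Z px])
    then show "p i \<odot> evl C (L, l) Z xs s = p i \<odot> evl C (L, l) Z xs t"
      using pevl[OF i Z xs wf(1)] pevl[OF i Z xs wf(2)] by simp
  qed
  then have alg: "(L, l) \<in> internal_algebras T C"
    unfolding internal_algebras_iff[OF T] using l(1,2) by auto
  moreover have "p i \<in> arr (algebra_cat T C) (L, l) (A i)" if "i < n" for i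
    unfolding alg_arr_iff using alg A[OF that] p[OF that] pe[OF that] by simp
  ultimately show thesis by (rule that)
qed

lemma hom_along_jointly_monic:
  assumes p: "\<And>i. i < n \<Longrightarrow> p i \<in> arr (algebra_cat T C) L (A i)"
    and jm: "\<And>Z g h. g \<in> arr C Z (fst L) \<Longrightarrow> h \<in> arr C Z (fst L) \<Longrightarrow> (\<And>i. i < n \<Longrightarrow> p i \<odot> g = p i \<odot> h) \<Longrightarrow> g = h"
    and L: "L \<in> internal_algebras T C" and B: "B \<in> internal_algebras T C" and h: "h \<in> arr C (fst B) (fst L)"
    and ph: "\<And>i. i < n \<Longrightarrow> p i \<odot> h \<in> arr (algebra_cat T C) B (A i)"
  shows "h \<in> arr (algebra_cat T C) B L"
proof -
  note oL = algebra_operations[OF L] and oB = algebra_operations[OF B]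
  have "h \<odot> opr T C B f Z xs = opr T C L f Z (\<lambda>i. h \<odot> xs i)"
    if f: "f \<in> ops T" "Z \<in> obj C" "\<forall>i<arity T f. xs i \<in> arr C Z (fst B)" for f Z xs
  proof (rule jm)
    have hx: "\<forall>i<arity T f. h \<odot> xs i \<in> arr C Z (fst L)" using h f(3) by blast
    show "h \<odot> opr T C B f Z xs \<in> arr C Z (fst L)" "opr T C L f Z (\<lambda>i. h \<odot> xs i) \<in> arr C Z (fst L)"
      using opr_arr[OF oB f] opr_arr[OF oL f(1,2) hx] h by blast+
    fix i assume i: "i < n"
    note p' = alg_arrD[OF p[OF i]] and ph' = alg_arrD[OF ph[OF i]]
    have "p i \<odot> (h \<odot> opr T C B f Z xs) = opr T C (A i) f Z (\<lambda>j. (p i \<odot> h) \<odot> xs j)"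
      using assoc[OF opr_arr[OF oB f] h p'(3)] ph'(4)[OF f] by simp
    also have "\<dots> = opr T C (A i) f Z (\<lambda>j. p i \<odot> (h \<odot> xs j))"
      by (rule opr_cong[OF algebra_operations[OF p'(2)]]) (use assoc[OF _ h p'(3)] f(3) in metis)
    also have "\<dots> = p i \<odot> opr T C L f Z (\<lambda>i. h \<odot> xs i)"
      using p'(4)[OF f(1,2) hx] by simp
    finally show "p i \<odot> (h \<odot> opr T C B f Z xs) = p i \<odot> opr T C L f Z (\<lambda>i. h \<odot> xs i)" .
  qed
  then show ?thesis unfolding alg_arr_iff using B L h by blast
qed

lemma algebra_cat_finitely_complete:
  assumes T: "algebraic_theory T"
  shows "finitely_complete (algebra_cat T C)"
proof -
  interpret K: cat_setup "algebra_cat T C" by (rule algebra_cat_category)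
  have "\<exists>L p. is_limit (algebra_cat T C) n D W L p" if d: "is_diagram (algebra_cat T C) n D W" for n D W
  proof -
    have D: "\<And>i. i < n \<Longrightarrow> D i \<in> internal_algebras T C"
      and W: "\<And>i j f. (i, j, f) \<in> W \<Longrightarrow> i < n \<and> j < n \<and> f \<in> arr (algebra_cat T C) (D i) (D j)"
      using d unfolding is_diagram_def arr_def by auto
    have d': "is_diagram C n (fst \<circ> D) W"
    proof -
      have "f \<in> hom C (fst (D i)) (fst (D j))" if "(i, j, f) \<in> W" for i j f
        using arr_hom[OF alg_arrD(3)[OF conjunct2[OF conjunct2[OF W[OF that]]]]] .
      then have "\<forall>(i, j, f)\<in>W. i < n \<and> j < n \<and> f \<in> hom C ((fst \<circ> D) i) ((fst \<circ> D) j)"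
        using W by (auto simp del: split_paired_All)
      then show ?thesis
        using d operations_obj[OF algebra_operations[OF D]] by (simp add: is_diagram_def)
    qed
    obtain L p where "is_limit C n (fst \<circ> D) W L p" using limit_exists[OF d'] by blast
    note lim = is_limitD[OF d' this, unfolded comp_def]
    note L = lim(1) and p = lim(2) and edge = lim(3) and ex = lim(4) and jm = lim(5)
    have closed: "\<exists>h\<in>arr C Z L. \<forall>i<n. p i \<odot> h = opr T C (D i) f Z (\<lambda>j. p i \<odot> xs j)"
      if f: "f \<in> ops T" "Z \<in> obj C" and xs: "\<forall>j<arity T f. xs j \<in> arr C Z L" for f Z xs
    proof -
      have px: "\<forall>j<arity T f. p i \<odot> xs j \<in> arr C Z (fst (D i))" if "i < n" for i using p[OF that] xs by blast
      show ?thesis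
      proof (rule ex[OF f(2)])
        show "opr T C (D i) f Z (\<lambda>j. p i \<odot> xs j) \<in> arr C Z (fst (D i))" if "i < n" for i
          by (rule opr_arr[OF algebra_operations[OF D[OF that]] f px[OF that]])
        fix i j g assume e: "(i, j, g) \<in> W"
        note g = W[OF e] and g' = alg_arrD[OF conjunct2[OF conjunct2[OF W[OF e]]]]
        have i: "i < n" and j: "j < n" using g by auto
        have "g \<odot> opr T C (D i) f Z (\<lambda>j. p i \<odot> xs j) = opr T C (D j) f Z (\<lambda>k. g \<odot> (p i \<odot> xs k))"
          by (rule g'(4)[OF f px[OF i]])
        also have "\<dots> = opr T C (D j) f Z (\<lambda>k. p j \<odot> xs k)"
          by (rule opr_cong[OF algebra_operations[OF D[OF j]]]) (use assoc[OF _ p[OF i] g'(3)] xs edge[OF e] in metis)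
        finally show "g \<odot> opr T C (D i) f Z (\<lambda>j. p i \<odot> xs j) = opr T C (D j) f Z (\<lambda>k. p j \<odot> xs k)" .
      qed
    qed
    obtain l where l: "(L, l) \<in> internal_algebras T C"
      "\<And>i. i < n \<Longrightarrow> p i \<in> arr (algebra_cat T C) (L, l) (D i)"
      by (rule algebra_along_jointly_monic[OF T L, of n D p]) (use D p jm closed in \<open>(blast intro: that)+\<close>)
    have "is_limit (algebra_cat T C) n D W (L, l) p"
    proof (rule K.is_limitI[OF d], unfold algebra_cat_simps)
      show "(L, l) \<in> internal_algebras T C" by (rule l(1))
      show "p i \<in> arr (algebra_cat T C) (L, l) (D i)" if "i < n" for i by (rule l(2)[OF that])
      show "f \<odot> p i = p j" if "(i, j, f) \<in> W" for i j f by (rule edge[OF that])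
    next
      fix B q assume B: "B \<in> internal_algebras T C" and q: "\<And>i. i < n \<Longrightarrow> q i \<in> arr (algebra_cat T C) B (D i)"
        and qe: "\<And>i j f. (i, j, f) \<in> W \<Longrightarrow> f \<odot> q i = q j"
      have "\<exists>h\<in>arr C (fst B) L. \<forall>i<n. p i \<odot> h = q i"
        by (rule ex[OF operations_obj[OF algebra_operations[OF B]] alg_arrD(3)[OF q] qe])
      then obtain h where h: "h \<in> arr C (fst B) L" "\<And>i. i < n \<Longrightarrow> p i \<odot> h = q i" by blast
      have "h \<in> arr (algebra_cat T C) B (L, l)"
        by (rule hom_along_jointly_monic[OF l(2) _ l(1) B]) (use jm h q in auto)
      then show "\<exists>h\<in>arr (algebra_cat T C) B (L, l). \<forall>i<n. p i \<odot> h = q i" using h(2) by blast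
    next
      fix B g h assume g: "g \<in> arr (algebra_cat T C) B (L, l)" "h \<in> arr (algebra_cat T C) B (L, l)"
        and e: "\<And>i. i < n \<Longrightarrow> p i \<odot> g = p i \<odot> h"
      show "g = h" using jm[of g "fst B" h] alg_arrD(3)[OF g(1)] alg_arrD(3)[OF g(2)] e by simp
    qed
    then show ?thesis by blast
  qed
  then show ?thesis using K.category by (simp add: finitely_complete_def)
qed

end

section \<open>Congruences of an internal algebra\<close>

text \<open>
  Equivalence relations in the category of algebras are identified with the compatible
  representable equivalence relations on elements.  This turns congruence modularity of the
  category of algebras into a statement about such predicates, and it applies both to the variety
  and to the internal algebras.
\<close>

definition compatible ::
    "'f alg_theory \<Rightarrow> ('o, 'm) cat \<Rightarrow> 'o \<times> ('f \<Rightarrow> 'm) \<Rightarrow> ('o \<Rightarrow> 'm \<Rightarrow> 'm \<Rightarrow> bool) \<Rightarrow> bool" where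
  "compatible T C A \<Phi> \<longleftrightarrow> (\<forall>f\<in>ops T. \<forall>Z\<in>obj C. \<forall>xs ys.
     (\<forall>i<arity T f. \<Phi> Z (xs i) (ys i)) \<longrightarrow> \<Phi> Z (opr T C A f Z xs) (opr T C A f Z ys))"

definition congruence ::
    "'f alg_theory \<Rightarrow> ('o, 'm) cat \<Rightarrow> 'o \<times> ('f \<Rightarrow> 'm) \<Rightarrow> ('o \<Rightarrow> 'm \<Rightarrow> 'm \<Rightarrow> bool) \<Rightarrow> bool" where
  "congruence T C A \<Phi> \<longleftrightarrow> rel_pred C (fst A) \<Phi> \<and> compatible T C A \<Phi> \<and>
     (\<forall>Z. \<forall>x\<in>arr C Z (fst A). \<Phi> Z x x) \<and> (\<forall>Z x y. \<Phi> Z x y \<longrightarrow> \<Phi> Z y x) \<and>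
     (\<forall>Z x y z. \<Phi> Z x y \<longrightarrow> \<Phi> Z y z \<longrightarrow> \<Phi> Z x z)"

abbreviation (input) pred_le (infix \<open>\<sqsubseteq>\<close> 50) where
  "\<Phi> \<sqsubseteq> \<Psi> \<equiv> \<forall>Z x y. \<Phi> Z x y \<longrightarrow> \<Psi> Z x y"

abbreviation (input) pred_meet (infixl \<open>\<sqinter>\<close> 70) where
  "\<Phi> \<sqinter> \<Psi> \<equiv> \<lambda>Z x y. \<Phi> Z x y \<and> \<Psi> Z x y"

definition congruence_join ::
    "'f alg_theory \<Rightarrow> ('o, 'm) cat \<Rightarrow> 'o \<times> ('f \<Rightarrow> 'm) \<Rightarrow> ('o \<Rightarrow> 'm \<Rightarrow> 'm \<Rightarrow> bool) \<Rightarrow>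
      ('o \<Rightarrow> 'm \<Rightarrow> 'm \<Rightarrow> bool) \<Rightarrow> ('o \<Rightarrow> 'm \<Rightarrow> 'm \<Rightarrow> bool) \<Rightarrow> bool" where
  "congruence_join T C A \<Phi> \<Psi> J \<longleftrightarrow> congruence T C A J \<and> \<Phi> \<sqsubseteq> J \<and> \<Psi> \<sqsubseteq> J \<and>
     (\<forall>J'. congruence T C A J' \<and> \<Phi> \<sqsubseteq> J' \<and> \<Psi> \<sqsubseteq> J' \<longrightarrow> J \<sqsubseteq> J')"

text \<open>Relations between algebras are compared through the relations that underlie them.\<close>

definition alg_rel_elem ::
    "('o, 'm) cat \<Rightarrow> ('o \<times> ('f \<Rightarrow> 'm)) \<times> 'm \<times> 'm \<Rightarrow> 'o \<Rightarrow> 'm \<Rightarrow> 'm \<Rightarrow> bool" where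
  "alg_rel_elem C R = rel_elem C (fst (fst R), snd R)"

lemma congruenceD:
  assumes "congruence T C A \<Phi>"
  shows "rel_pred C (fst A) \<Phi>" "compatible T C A \<Phi>"
    "x \<in> arr C Z (fst A) \<Longrightarrow> \<Phi> Z x x" "\<Phi> Z x y \<Longrightarrow> \<Phi> Z y x" "\<Phi> Z x y \<Longrightarrow> \<Phi> Z y z \<Longrightarrow> \<Phi> Z x z"
  using assms unfolding congruence_def by blast+

lemma congruence_joinD:
  assumes "congruence_join T C A \<Phi> \<Psi> J"
  shows "congruence T C A J" "\<Phi> \<sqsubseteq> J" "\<Psi> \<sqsubseteq> J"
    "congruence T C A J' \<Longrightarrow> \<Phi> \<sqsubseteq> J' \<Longrightarrow> \<Psi> \<sqsubseteq> J' \<Longrightarrow> J \<sqsubseteq> J'"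
proof -
  note j = assms[unfolded congruence_join_def]
  show "congruence T C A J" "\<Phi> \<sqsubseteq> J" "\<Psi> \<sqsubseteq> J" using j by simp_all
  show "J \<sqsubseteq> J'" if "congruence T C A J'" "\<Phi> \<sqsubseteq> J'" "\<Psi> \<sqsubseteq> J'"
    by (rule j[THEN conjunct2, THEN conjunct2, THEN conjunct2, THEN spec, THEN mp]) (intro conjI that)
qed

lemma compatibleD:
  assumes "compatible T C A \<Phi>" "f \<in> ops T" "Z \<in> obj C" "\<forall>i<arity T f. \<Phi> Z (xs i) (ys i)"
  shows "\<Phi> Z (opr T C A f Z xs) (opr T C A f Z ys)"
  using assms unfolding compatible_def by blast

locale algebras_in_lex_category = lex_category C for C :: "('o, 'm) cat" (structure) +
  fixes T :: "'f alg_theory"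
  assumes T: "algebraic_theory T"
begin

sublocale K: lex_category "algebra_cat T C"
  rewrites "obj (algebra_cat T C) = internal_algebras T C" and "cmp (algebra_cat T C) = cmp C"
    and "\<And>A. idt (algebra_cat T C) A = idt C (fst A)"
  using algebra_cat_finitely_complete[OF T] by unfold_locales simp_all

lemma hom_along_pair:
  assumes d: "d0 \<in> arr (algebra_cat T C) B A" "d1 \<in> arr (algebra_cat T C) B A"
    and jm: "\<And>Z g h. g \<in> arr C Z (fst B) \<Longrightarrow> h \<in> arr C Z (fst B) \<Longrightarrow> d0 \<odot> g = d0 \<odot> h \<Longrightarrow> d1 \<odot> g = d1 \<odot> h \<Longrightarrow> g = h"
    and D: "D \<in> internal_algebras T C" and k: "k \<in> arr C (fst D) (fst B)"
    and dk: "d0 \<odot> k \<in> arr (algebra_cat T C) D A" "d1 \<odot> k \<in> arr (algebra_cat T C) D A"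
  shows "k \<in> arr (algebra_cat T C) D B"
proof (rule hom_along_jointly_monic[of 2 "\<lambda>i. if i = 0 then d0 else d1" T B "\<lambda>_. A"])
  fix Z g h assume g: "g \<in> arr C Z (fst B)" "h \<in> arr C Z (fst B)"
    and e: "\<And>i::nat. i < 2 \<Longrightarrow> (if i = 0 then d0 else d1) \<odot> g = (if i = 0 then d0 else d1) \<odot> h"
  show "g = h" by (rule jm[OF g]) (use e[of 0] e[of 1] in simp_all)
qed (use d dk D k alg_arrD(1)[OF d(1)] in auto)

text \<open>
  The object that represents a compatible relation is closed under the operations, so the two
  projections force an algebra structure on it.
\<close>

lemma compatible_relation_lifts:
  assumes A: "A \<in> internal_algebras T C" and \<Phi>: "rel_pred C (fst A) \<Phi>" and c: "compatible T C A \<Phi>"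
  obtains R where "R \<in> relations (algebra_cat T C) A" "alg_rel_elem C R = \<Phi>"
    "(fst (fst R), snd R) \<in> relations C (fst A)"
proof -
  from \<Phi> obtain L d0 d1 where X: "fst A \<in> obj C" and d0: "d0 \<in> arr C L (fst A)" and d1: "d1 \<in> arr C L (fst A)"
    and mono: "\<And>Z g h. g \<in> arr C Z L \<Longrightarrow> h \<in> arr C Z L \<Longrightarrow> d0 \<odot> g = d0 \<odot> h \<Longrightarrow> d1 \<odot> g = d1 \<odot> h \<Longrightarrow> g = h"
    and \<Phi>_iff: "\<And>Z x y. \<Phi> Z x y \<longleftrightarrow> (\<exists>k\<in>arr C Z L. d0 \<odot> k = x \<and> d1 \<odot> k = y)" by (rule rel_predE) (rule that)
  let ?p = "\<lambda>i::nat. if i = 0 then d0 else d1"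
  have jm: "g = h" if "g \<in> arr C Z L" "h \<in> arr C Z L" "\<And>i. i < 2 \<Longrightarrow> ?p i \<odot> g = ?p i \<odot> h" for Z g h
    using mono[OF that(1,2)] that(3)[of 0] that(3)[of 1] by simp
  have closed: "\<exists>h\<in>arr C Z L. \<forall>i<2. ?p i \<odot> h = opr T C A f Z (\<lambda>j. ?p i \<odot> xs j)"
    if f: "f \<in> ops T" "Z \<in> obj C" "\<forall>j<arity T f. xs j \<in> arr C Z L" for f Z xs
  proof -
    have "\<forall>j<arity T f. \<Phi> Z (d0 \<odot> xs j) (d1 \<odot> xs j)" unfolding \<Phi>_iff using f(3) by blast
    from compatibleD[OF c f(1,2) this] show ?thesis unfolding \<Phi>_iff by auto
  qed
  have p: "?p i \<in> arr C L (fst A)" for i using d0 d1 by simp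
  obtain l where l: "(L, l) \<in> internal_algebras T C"
    "\<And>i. i < 2 \<Longrightarrow> ?p i \<in> arr (algebra_cat T C) (L, l) A"
    using algebra_along_jointly_monic[OF T arr_obj(1)[OF d0], of 2 "\<lambda>_. A" ?p] A p jm closed by blast
  have d: "d0 \<in> arr (algebra_cat T C) (L, l) A" "d1 \<in> arr (algebra_cat T C) (L, l) A"
    using l(2)[of 0] l(2)[of 1] by simp_all
  have "((L, l), d0, d1) \<in> relations (algebra_cat T C) A"
    unfolding K.relations_iff[OF A] fst_conv snd_conv
  proof (intro conjI allI ballI impI d)
    fix D g h assume g: "g \<in> arr (algebra_cat T C) D (L, l)" "h \<in> arr (algebra_cat T C) D (L, l)"
      and e: "d0 \<odot> g = d0 \<odot> h \<and> d1 \<odot> g = d1 \<odot> h"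
    show "g = h" using mono[of g "fst D" h] alg_arrD(3)[OF g(1)] alg_arrD(3)[OF g(2)] e by simp
  qed
  moreover have "alg_rel_elem C ((L, l), d0, d1) = \<Phi>"
    unfolding alg_rel_elem_def rel_elem_def by (simp add: \<Phi>_iff fun_eq_iff)
  moreover have "(L, d0, d1) \<in> relations C (fst A)"
    unfolding relations_iff[OF X] using d0 d1 mono by simp
  ultimately show thesis by (intro that) auto
qed

text \<open>
  A relation in the category of algebras is jointly monic with respect to homomorphisms only.
  That its two legs are jointly monic in the base category is seen on their joint kernel pair,
  which exists in the base category and is itself an algebra.
\<close>

lemma alg_relation:
  assumes A: "A \<in> internal_algebras T C" and R: "R \<in> relations (algebra_cat T C) A"
  shows alg_relation_underlying: "(fst (fst R), snd R) \<in> relations C (fst A)"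
    and alg_relation_rel_pred: "rel_pred C (fst A) (alg_rel_elem C R)"
    and alg_relation_compatible: "compatible T C A (alg_rel_elem C R)"
proof -
  obtain B d0 d1 where R_def: "R = (B, d0, d1)" by (cases R)
  have X: "fst A \<in> obj C" by (rule operations_obj[OF algebra_operations[OF A]])
  have d: "d0 \<in> arr (algebra_cat T C) B A" "d1 \<in> arr (algebra_cat T C) B A"
    and mono: "\<And>D g h. g \<in> arr (algebra_cat T C) D B \<Longrightarrow> h \<in> arr (algebra_cat T C) D B \<Longrightarrow>
      d0 \<odot> g = d0 \<odot> h \<Longrightarrow> d1 \<odot> g = d1 \<odot> h \<Longrightarrow> g = h"
    using R unfolding K.relations_iff[OF A] R_def by auto
  note d0 = alg_arrD[OF d(1)] and d1 = alg_arrD[OF d(2)]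
  note B = d0(1)
  have B0: "fst B \<in> obj C" by (rule operations_obj[OF algebra_operations[OF B]])
  \<comment> \<open>The joint kernel pair of \<open>d0\<close> and \<open>d1\<close>; its projections to \<open>B\<close> will turn out to be equal.\<close>
  let ?E = "\<lambda>Z r s. r \<in> arr C Z (fst B) \<and> s \<in> arr C Z (fst B) \<and> d0 \<odot> r = d0 \<odot> s \<and> d1 \<odot> r = d1 \<odot> s"
  let ?P = "pow_obj C (fst B) 2" let ?p0 = "pow_proj C (fst B) 2 0" let ?p1 = "pow_proj C (fst B) 2 1"
  have p: "?p0 \<in> arr C ?P (fst B)" "?p1 \<in> arr C ?P (fst B)" using pow_proj[OF B0, of _ 2] by auto
  have "rel_pred C (fst B) ?E"
  proof (rule rel_pred_cong[OF sub_pred_rel_pred[OF sub_pred_conj B0]])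
    show "sub_pred C ?P (\<lambda>Z w. w \<in> arr C Z ?P \<and> ((d0 \<odot> ?p0) \<odot> w \<in> arr C Z (fst A) \<and> (d0 \<odot> ?p0) \<odot> w = (d0 \<odot> ?p1) \<odot> w))"
      by (rule rel_pred_pull[OF rel_pred_eq[OF X] comp_arr[OF p(1) d0(3)] comp_arr[OF p(2) d0(3)]])
    show "sub_pred C ?P (\<lambda>Z w. w \<in> arr C Z ?P \<and> ((d1 \<odot> ?p0) \<odot> w \<in> arr C Z (fst A) \<and> (d1 \<odot> ?p0) \<odot> w = (d1 \<odot> ?p1) \<odot> w))"
      by (rule rel_pred_pull[OF rel_pred_eq[OF X] comp_arr[OF p(1) d1(3)] comp_arr[OF p(2) d1(3)]])
    fix Z r s
    show "(r \<in> arr C Z (fst B) \<and> s \<in> arr C Z (fst B) \<and>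
        (pair C (fst B) Z r s \<in> arr C Z ?P \<and> ((d0 \<odot> ?p0) \<odot> pair C (fst B) Z r s \<in> arr C Z (fst A) \<and>
          (d0 \<odot> ?p0) \<odot> pair C (fst B) Z r s = (d0 \<odot> ?p1) \<odot> pair C (fst B) Z r s)) \<and>
        (pair C (fst B) Z r s \<in> arr C Z ?P \<and> ((d1 \<odot> ?p0) \<odot> pair C (fst B) Z r s \<in> arr C Z (fst A) \<and>
          (d1 \<odot> ?p0) \<odot> pair C (fst B) Z r s = (d1 \<odot> ?p1) \<odot> pair C (fst B) Z r s))) = ?E Z r s"
    proof (cases "r \<in> arr C Z (fst B) \<and> s \<in> arr C Z (fst B)")
      case True
      then have rs: "pair C (fst B) Z r s \<in> arr C Z ?P"
        "?p0 \<odot> pair C (fst B) Z r s = r" "?p1 \<odot> pair C (fst B) Z r s = s"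
        using pair_arr proj_pair by blast+
      have "d0 \<odot> r \<in> arr C Z (fst A)" "d1 \<odot> r \<in> arr C Z (fst A)" using True d0(3) d1(3) by blast+
      then show ?thesis
        using True rs assoc[OF rs(1) p(1) d0(3)] assoc[OF rs(1) p(2) d0(3)]
          assoc[OF rs(1) p(1) d1(3)] assoc[OF rs(1) p(2) d1(3)] by simp
    qed blast
  qed
  moreover have "compatible T C B ?E"
    unfolding compatible_def
  proof (intro ballI allI impI)
    fix f Z xs ys assume f: "f \<in> ops T" "Z \<in> obj C" and e: "\<forall>i<arity T f. ?E Z (xs i) (ys i)"
    have xs: "\<forall>i<arity T f. xs i \<in> arr C Z (fst B)" and ys: "\<forall>i<arity T f. ys i \<in> arr C Z (fst B)" using e by auto
    note oB = algebra_operations[OF B] and oA = algebra_operations[OF A]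
    have "opr T C A f Z (\<lambda>i. d0 \<odot> xs i) = opr T C A f Z (\<lambda>i. d0 \<odot> ys i)"
      "opr T C A f Z (\<lambda>i. d1 \<odot> xs i) = opr T C A f Z (\<lambda>i. d1 \<odot> ys i)"
      by (rule opr_cong[OF oA], use e in simp)+
    then show "?E Z (opr T C B f Z xs) (opr T C B f Z ys)"
      using opr_arr[OF oB f xs] opr_arr[OF oB f ys] d0(4)[OF f xs] d0(4)[OF f ys] d1(4)[OF f xs] d1(4)[OF f ys]
      by simp
  qed
  ultimately obtain E where E: "E \<in> relations (algebra_cat T C) B" "alg_rel_elem C E = ?E"
    by (rule compatible_relation_lifts[OF B]) (rule that)
  obtain M a b where E_def: "E = (M, a, b)" by (cases E)
  have ab: "a \<in> arr (algebra_cat T C) M B" "b \<in> arr (algebra_cat T C) M B"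
    using E(1) unfolding K.relations_iff[OF B] E_def by auto
  have E_iff: "?E Z r s \<longleftrightarrow> (\<exists>k\<in>arr C Z (fst M). a \<odot> k = r \<and> b \<odot> k = s)" for Z r s
    using E(2) unfolding alg_rel_elem_def rel_elem_def E_def by (auto simp: fun_eq_iff)
  note a = alg_arrD(3)[OF ab(1)] and b = alg_arrD(3)[OF ab(2)]
  have "?E (fst M) a b"
    unfolding E_iff using idt_arr[OF arr_obj(1)[OF a]] idt_right[OF a] idt_right[OF b] by blast
  then have "a = b" using mono[OF ab] by blast
  then have jm: "r = s" if "r \<in> arr C Z (fst B)" "s \<in> arr C Z (fst B)" "d0 \<odot> r = d0 \<odot> s" "d1 \<odot> r = d1 \<odot> s" for Z r s
    using E_iff[where Z = Z and r = r and s = s] that by auto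
  then show 1: "(fst (fst R), snd R) \<in> relations C (fst A)"
    unfolding relations_iff[OF X] R_def using d0(3) d1(3) by simp
  then show "rel_pred C (fst A) (alg_rel_elem C R)"
    unfolding rel_pred_def alg_rel_elem_def using X by blast
  have el: "alg_rel_elem C R Z x y \<longleftrightarrow> (\<exists>k\<in>arr C Z (fst B). d0 \<odot> k = x \<and> d1 \<odot> k = y)" for Z x y
    by (simp add: alg_rel_elem_def rel_elem_def R_def)
  show "compatible T C A (alg_rel_elem C R)"
    unfolding compatible_def el
  proof (intro ballI allI impI)
    fix f Z xs ys assume f: "f \<in> ops T" "Z \<in> obj C"
      and "\<forall>i<arity T f. \<exists>k\<in>arr C Z (fst B). d0 \<odot> k = xs i \<and> d1 \<odot> k = ys i"
    then obtain k where k: "\<forall>i<arity T f. k i \<in> arr C Z (fst B)"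
      and e: "\<And>i. i < arity T f \<Longrightarrow> d0 \<odot> k i = xs i \<and> d1 \<odot> k i = ys i" by metis
    note oB = algebra_operations[OF B] and oA = algebra_operations[OF A]
    have "d0 \<odot> opr T C B f Z k = opr T C A f Z xs" "d1 \<odot> opr T C B f Z k = opr T C A f Z ys"
      unfolding d0(4)[OF f k] d1(4)[OF f k] by (rule opr_cong[OF oA], use e in simp)+
    then show "\<exists>k\<in>arr C Z (fst B). d0 \<odot> k = opr T C A f Z xs \<and> d1 \<odot> k = opr T C A f Z ys"
      using opr_arr[OF oB f k] by blast
  qed
qed

lemma alg_rel_le_iff:
  assumes A: "A \<in> internal_algebras T C" and R: "R \<in> relations (algebra_cat T C) A"
    and S: "S \<in> relations (algebra_cat T C) A"
  shows "rel_le (algebra_cat T C) R S \<longleftrightarrow> alg_rel_elem C R \<sqsubseteq> alg_rel_elem C S"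
proof
  have X: "fst A \<in> obj C" by (rule operations_obj[OF algebra_operations[OF A]])
  note u = alg_relation_underlying[OF A R] alg_relation_underlying[OF A S]
  obtain B d0 d1 D e0 e1 where RS: "R = (B, d0, d1)" "S = (D, e0, e1)" by (cases R, cases S)
  have d: "d0 \<in> arr (algebra_cat T C) B A" "d1 \<in> arr (algebra_cat T C) B A"
    and e: "e0 \<in> arr (algebra_cat T C) D A" "e1 \<in> arr (algebra_cat T C) D A"
    using R S unfolding K.relations_iff[OF A] RS by auto
  {
    assume "rel_le (algebra_cat T C) R S"
    then obtain k where "k \<in> hom (algebra_cat T C) B D" and eq: "e0 \<odot> k = d0" "e1 \<odot> k = d1"
      unfolding rel_le_def RS by auto
    then have "k \<in> arr C (fst B) (fst D)"
      using alg_arrD(3)[OF hom_arr, of B T D k] alg_arrD(1)[OF d(1)] alg_arrD(1)[OF e(1)] by simp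
    then have "rel_le C (fst (fst R), snd R) (fst (fst S), snd S)"
      using eq unfolding rel_le_def RS by (auto dest: arr_hom)
    then show "alg_rel_elem C R \<sqsubseteq> alg_rel_elem C S"
      unfolding rel_le_iff[OF X u] alg_rel_elem_def .
  }
  {
    assume "alg_rel_elem C R \<sqsubseteq> alg_rel_elem C S"
    then have "rel_le C (fst (fst R), snd R) (fst (fst S), snd S)"
      unfolding rel_le_iff[OF X u] alg_rel_elem_def .
    then obtain k where k: "k \<in> arr C (fst B) (fst D)" and eq: "e0 \<odot> k = d0" "e1 \<odot> k = d1"
      using arr_obj(1)[OF alg_arrD(3)[OF d(1)]] arr_obj(1)[OF alg_arrD(3)[OF e(1)]]
      unfolding rel_le_def RS by (auto intro: hom_arr)
    have "k \<in> arr (algebra_cat T C) B D"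
    proof (rule hom_along_pair[OF e _ alg_arrD(1)[OF d(1)] k])
      show "g = h" if "g \<in> arr C Z (fst D)" "h \<in> arr C Z (fst D)" "e0 \<odot> g = e0 \<odot> h" "e1 \<odot> g = e1 \<odot> h" for Z g h
        using u(2) that unfolding relations_iff[OF X] RS by simp
    qed (simp_all add: eq d)
    from arr_hom[OF this] show "rel_le (algebra_cat T C) R S"
      using eq unfolding rel_le_def RS by auto
  }
qed

lemma alg_rel_intersection_iff:
  assumes A: "A \<in> internal_algebras T C" and R: "R \<in> relations (algebra_cat T C) A"
    and S: "S \<in> relations (algebra_cat T C) A"
  shows "is_rel_intersection (algebra_cat T C) A R S I \<longleftrightarrow>
    I \<in> relations (algebra_cat T C) A \<and> alg_rel_elem C I = alg_rel_elem C R \<sqinter> alg_rel_elem C S"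
proof -
  let ?e = "alg_rel_elem C"
  have "compatible T C A (?e R \<sqinter> ?e S)"
    using alg_relation_compatible[OF A R] alg_relation_compatible[OF A S] unfolding compatible_def by blast
  with rel_pred_conj[OF alg_relation_rel_pred[OF A R] alg_relation_rel_pred[OF A S]]
  obtain M where M: "M \<in> relations (algebra_cat T C) A" "?e M = ?e R \<sqinter> ?e S"
    by (rule compatible_relation_lifts[OF A])
  show ?thesis
  proof
    assume "is_rel_intersection (algebra_cat T C) A R S I"
    then have I: "I \<in> relations (algebra_cat T C) A" and l: "rel_le (algebra_cat T C) I R" "rel_le (algebra_cat T C) I S"
      and g: "\<And>V. V \<in> relations (algebra_cat T C) A \<Longrightarrow> rel_le (algebra_cat T C) V R \<Longrightarrow>
        rel_le (algebra_cat T C) V S \<Longrightarrow> rel_le (algebra_cat T C) V I"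
      unfolding is_rel_intersection_def is_glb_def by auto
    have "rel_le (algebra_cat T C) M I"
      by (rule g[OF M(1)]) (simp_all add: alg_rel_le_iff[OF A M(1)] R S M(2))
    then have "?e R \<sqinter> ?e S \<sqsubseteq> ?e I" using alg_rel_le_iff[OF A M(1) I] M(2) by simp
    moreover have "?e I \<sqsubseteq> ?e R" "?e I \<sqsubseteq> ?e S" using l alg_rel_le_iff[OF A I R] alg_rel_le_iff[OF A I S] by auto
    ultimately have "?e I = ?e R \<sqinter> ?e S" by (intro ext) blast
    with I show "I \<in> relations (algebra_cat T C) A \<and> ?e I = ?e R \<sqinter> ?e S" by blast
  next
    assume I: "I \<in> relations (algebra_cat T C) A \<and> ?e I = ?e R \<sqinter> ?e S"
    then show "is_rel_intersection (algebra_cat T C) A R S I"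
      unfolding is_rel_intersection_def is_glb_def
      using alg_rel_le_iff[OF A] R S by simp
  qed
qed

lemma equivalence_relation_congruence:
  assumes A: "A \<in> internal_algebras T C" and R: "R \<in> equivalence_relations (algebra_cat T C) A"
  shows "congruence T C A (alg_rel_elem C R)"
proof -
  obtain B d0 d1 where R_def: "R = (B, d0, d1)" by (cases R)
  have R': "R \<in> relations (algebra_cat T C) A" using R unfolding equivalence_relations_def by auto
  have d: "d0 \<in> arr (algebra_cat T C) B A" "d1 \<in> arr (algebra_cat T C) B A"
    using R' unfolding K.relations_iff[OF A] R_def by auto
  note d0 = alg_arrD(3)[OF d(1)] and d1 = alg_arrD(3)[OF d(2)] and B = alg_arrD(1)[OF d(1)]
  have el: "alg_rel_elem C R Z x y \<longleftrightarrow> (\<exists>k\<in>arr C Z (fst B). d0 \<odot> k = x \<and> d1 \<odot> k = y)" for Z x y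
    by (simp add: alg_rel_elem_def rel_elem_def R_def)
  obtain s \<sigma> P p q t where s: "s \<in> hom (algebra_cat T C) A B" "d0 \<odot> s = idt C (fst A)" "d1 \<odot> s = idt C (fst A)"
    and \<sigma>: "\<sigma> \<in> hom (algebra_cat T C) B B" "d0 \<odot> \<sigma> = d1" "d1 \<odot> \<sigma> = d0"
    and P: "is_pullback (algebra_cat T C) B B A d1 d0 P p q"
    and t: "t \<in> hom (algebra_cat T C) P B" "d0 \<odot> t = d0 \<odot> p" "d1 \<odot> t = d1 \<odot> q"
    using R unfolding equivalence_relations_def R_def by auto
  have P': "P \<in> internal_algebras T C" "p \<in> arr (algebra_cat T C) P B" "q \<in> arr (algebra_cat T C) P B"
    using P unfolding K.is_pullback_iff by (auto simp: arr_def)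
  have s': "s \<in> arr C (fst A) (fst B)" and \<sigma>': "\<sigma> \<in> arr C (fst B) (fst B)" and t': "t \<in> arr C (fst P) (fst B)"
    using alg_arrD(3)[OF hom_arr[of A "algebra_cat T C" B s]] alg_arrD(3)[OF hom_arr[of B "algebra_cat T C" B \<sigma>]]
      alg_arrD(3)[OF hom_arr[of P "algebra_cat T C" B t]] s(1) \<sigma>(1) t(1) A B P'(1) by simp_all
  have "alg_rel_elem C R Z x x" if x: "x \<in> arr C Z (fst A)" for Z x
    unfolding el using assoc[OF x s' d0] assoc[OF x s' d1] s(2,3) idt_left[OF x] comp_arr[OF x s'] by metis
  moreover have "alg_rel_elem C R Z y x" if "alg_rel_elem C R Z x y" for Z x y
    using that unfolding el using assoc[OF _ \<sigma>' d0] assoc[OF _ \<sigma>' d1] \<sigma>(2,3) comp_arr[OF _ \<sigma>'] by metis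
  moreover have "alg_rel_elem C R Z x z" if xyz: "alg_rel_elem C R Z x y" "alg_rel_elem C R Z y z" for Z x y z
  proof -
    obtain k l where k: "k \<in> arr C Z (fst B)" "d0 \<odot> k = x" "d1 \<odot> k = y"
      and l: "l \<in> arr C Z (fst B)" "d0 \<odot> l = y" "d1 \<odot> l = z" using xyz unfolding el by blast
    \<comment> \<open>The pairs of composable elements form an algebra, and \<open>P\<close> classifies them by homomorphisms.\<close>
    obtain Q u v where Q: "is_pullback C (fst B) (fst B) (fst A) d1 d0 Q u v"
      using pullback_exists[OF d1 d0] by blast
    then have u: "u \<in> arr C Q (fst B)" and v: "v \<in> arr C Q (fst B)" and uv: "d1 \<odot> u = d0 \<odot> v"
      and ex: "\<And>Z k l. k \<in> arr C Z (fst B) \<Longrightarrow> l \<in> arr C Z (fst B) \<Longrightarrow> d1 \<odot> k = d0 \<odot> l \<Longrightarrow>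
         \<exists>h\<in>arr C Z Q. u \<odot> h = k \<and> v \<odot> h = l"
      and jm: "\<And>Z g h. g \<in> arr C Z Q \<Longrightarrow> h \<in> arr C Z Q \<Longrightarrow> u \<odot> g = u \<odot> h \<Longrightarrow> v \<odot> g = v \<odot> h \<Longrightarrow> g = h"
      unfolding is_pullback_iff by blast+
    let ?p = "\<lambda>i::nat. if i = 0 then u else v"
    have jm': "g = h" if "g \<in> arr C Z Q" "h \<in> arr C Z Q" "\<And>i. i < 2 \<Longrightarrow> ?p i \<odot> g = ?p i \<odot> h" for Z g h
      using jm[OF that(1,2)] that(3)[of 0] that(3)[of 1] by simp
    have closed: "\<exists>h\<in>arr C Z Q. \<forall>i<2. ?p i \<odot> h = opr T C B f Z (\<lambda>j. ?p i \<odot> xs j)"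
      if f: "f \<in> ops T" "Z \<in> obj C" "\<forall>j<arity T f. xs j \<in> arr C Z Q" for f Z xs
    proof -
      have ux: "\<forall>j<arity T f. u \<odot> xs j \<in> arr C Z (fst B)" and vx: "\<forall>j<arity T f. v \<odot> xs j \<in> arr C Z (fst B)"
        using f(3) u v by blast+
      have "opr T C A f Z (\<lambda>j. d1 \<odot> (u \<odot> xs j)) = opr T C A f Z (\<lambda>j. d0 \<odot> (v \<odot> xs j))"
        by (rule opr_cong[OF algebra_operations[OF A]]) (use f(3) uv assoc[OF _ u d1] assoc[OF _ v d0] in metis)
      then have "d1 \<odot> opr T C B f Z (\<lambda>j. u \<odot> xs j) = d0 \<odot> opr T C B f Z (\<lambda>j. v \<odot> xs j)"
        using alg_arrD(4)[OF d(2) f(1,2) ux] alg_arrD(4)[OF d(1) f(1,2) vx] by simp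
      from ex[OF opr_arr[OF algebra_operations[OF B] f(1,2) ux] opr_arr[OF algebra_operations[OF B] f(1,2) vx] this]
      show ?thesis by auto
    qed
    have "?p i \<in> arr C Q (fst B)" for i using u v by simp
    then obtain \<rho> where \<rho>: "(Q, \<rho>) \<in> internal_algebras T C"
      "\<And>i. i < 2 \<Longrightarrow> ?p i \<in> arr (algebra_cat T C) (Q, \<rho>) B"
      using algebra_along_jointly_monic[OF T arr_obj(1)[OF u], of 2 "\<lambda>_. B" ?p] B jm' closed by blast
    have uv': "u \<in> arr (algebra_cat T C) (Q, \<rho>) B" "v \<in> arr (algebra_cat T C) (Q, \<rho>) B"
      using \<rho>(2)[of 0] \<rho>(2)[of 1] by simp_all
    then obtain w where w: "w \<in> arr (algebra_cat T C) (Q, \<rho>) P" "p \<odot> w = u" "q \<odot> w = v"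
      using P uv unfolding K.is_pullback_iff by blast
    note w' = alg_arrD(3)[OF w(1), simplified] and p' = alg_arrD(3)[OF P'(2)] and q' = alg_arrD(3)[OF P'(3)]
    obtain h where h: "h \<in> arr C Z Q" "u \<odot> h = k" "v \<odot> h = l" using ex[OF k(1) l(1)] k(3) l(2) by auto
    have wh: "w \<odot> h \<in> arr C Z (fst P)" using h(1) w' by blast
    have "d0 \<odot> (t \<odot> (w \<odot> h)) = d0 \<odot> k"
      using assoc[OF wh t' d0] assoc[OF wh p' d0] assoc[OF h(1) w' p'] t(2) w(2) h(2) by simp
    moreover have "d1 \<odot> (t \<odot> (w \<odot> h)) = d1 \<odot> l"
      using assoc[OF wh t' d1] assoc[OF wh q' d1] assoc[OF h(1) w' q'] t(3) w(3) h(3) by simp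
    ultimately show ?thesis unfolding el using comp_arr[OF wh t'] k(2) l(3) by auto
  qed
  ultimately show ?thesis
    unfolding congruence_def using alg_relation_rel_pred[OF A R'] alg_relation_compatible[OF A R'] by blast
qed

text \<open>
  The structure arrows of the equivalence relation are obtained by applying reflexivity, symmetry
  and transitivity to generic elements.
\<close>

lemma congruence_equivalence_relation:
  assumes A: "A \<in> internal_algebras T C" and \<Phi>: "congruence T C A \<Phi>"
  obtains R where "R \<in> equivalence_relations (algebra_cat T C) A" "alg_rel_elem C R = \<Phi>"
proof -
  obtain R where R: "R \<in> relations (algebra_cat T C) A" and e: "alg_rel_elem C R = \<Phi>"
    and U: "(fst (fst R), snd R) \<in> relations C (fst A)"
    by (rule compatible_relation_lifts[OF A congruenceD(1,2)[OF \<Phi>]])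
  obtain B d0 d1 where R_def: "R = (B, d0, d1)" by (cases R)
  have X: "fst A \<in> obj C" by (rule operations_obj[OF algebra_operations[OF A]])
  have d: "d0 \<in> arr (algebra_cat T C) B A" "d1 \<in> arr (algebra_cat T C) B A"
    using R unfolding K.relations_iff[OF A] R_def by auto
  note d0 = alg_arrD(3)[OF d(1)] and d1 = alg_arrD(3)[OF d(2)] and B = alg_arrD(1)[OF d(1)]
  have B0: "fst B \<in> obj C" by (rule operations_obj[OF algebra_operations[OF B]])
  have jm: "\<And>Z g h. g \<in> arr C Z (fst B) \<Longrightarrow> h \<in> arr C Z (fst B) \<Longrightarrow> d0 \<odot> g = d0 \<odot> h \<Longrightarrow> d1 \<odot> g = d1 \<odot> h \<Longrightarrow> g = h"
    using U unfolding relations_iff[OF X] R_def by auto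
  have el: "\<Phi> Z x y \<longleftrightarrow> (\<exists>k\<in>arr C Z (fst B). d0 \<odot> k = x \<and> d1 \<odot> k = y)" for Z x y
    unfolding e[symmetric] by (simp add: alg_rel_elem_def rel_elem_def R_def)
  \<comment> \<open>An arrow into the relation is a homomorphism as soon as its two components are.\<close>
  have lift: "k \<in> arr (algebra_cat T C) D B"
    if "k \<in> arr C (fst D) (fst B)" "d0 \<odot> k \<in> arr (algebra_cat T C) D A" "d1 \<odot> k \<in> arr (algebra_cat T C) D A" for k D
    using hom_along_pair[OF d] jm B alg_arrD(1)[OF that(2)] that by blast
  have gen: "\<Phi> (fst B) d0 d1"
    unfolding el using idt_arr[OF B0] idt_right[OF d0] idt_right[OF d1] by blast
  have id: "idt C (fst A) \<in> arr (algebra_cat T C) A A"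
    using K.idt_arr[OF A] by simp
  have "\<Phi> (fst A) (idt C (fst A)) (idt C (fst A))" using congruenceD(3)[OF \<Phi> idt_arr[OF X]] .
  then obtain s where "s \<in> arr C (fst A) (fst B)" "d0 \<odot> s = idt C (fst A)" "d1 \<odot> s = idt C (fst A)"
    unfolding el by blast
  then have s: "s \<in> arr (algebra_cat T C) A B" "d0 \<odot> s = idt C (fst A)" "d1 \<odot> s = idt C (fst A)"
    using lift[of s A] id by simp_all
  obtain \<sigma> where "\<sigma> \<in> arr C (fst B) (fst B)" "d0 \<odot> \<sigma> = d1" "d1 \<odot> \<sigma> = d0"
    using congruenceD(4)[OF \<Phi> gen] unfolding el by blast
  then have \<sigma>: "\<sigma> \<in> arr (algebra_cat T C) B B" "d0 \<odot> \<sigma> = d1" "d1 \<odot> \<sigma> = d0"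
    using lift[of \<sigma> B] d by simp_all
  obtain P p q where P: "is_pullback (algebra_cat T C) B B A d1 d0 P p q"
    using K.pullback_exists[OF d(2) d(1)] by blast
  then have p: "p \<in> arr (algebra_cat T C) P B" and q: "q \<in> arr (algebra_cat T C) P B" and pq: "d1 \<odot> p = d0 \<odot> q"
    unfolding K.is_pullback_iff by blast+
  have "\<Phi> (fst P) (d0 \<odot> p) (d1 \<odot> p)" "\<Phi> (fst P) (d0 \<odot> q) (d1 \<odot> q)"
    unfolding el using alg_arrD(3)[OF p] alg_arrD(3)[OF q] by blast+
  then have "\<Phi> (fst P) (d0 \<odot> p) (d1 \<odot> q)" using congruenceD(5)[OF \<Phi>] pq by metis
  then obtain t where "t \<in> arr C (fst P) (fst B)" "d0 \<odot> t = d0 \<odot> p" "d1 \<odot> t = d1 \<odot> q"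
    unfolding el by blast
  then have t: "t \<in> arr (algebra_cat T C) P B" "d0 \<odot> t = d0 \<odot> p" "d1 \<odot> t = d1 \<odot> q"
    using lift[of t P] K.comp_arr[OF p d(1)] K.comp_arr[OF q d(2)] by simp_all
  have "R \<in> equivalence_relations (algebra_cat T C) A"
    unfolding equivalence_relations_def R_def mem_Collect_eq split_conv algebra_cat_simps(3,4)
  proof (intro conjI)
    show "(B, d0, d1) \<in> relations (algebra_cat T C) A" using R R_def by simp
    show "\<exists>s\<in>hom (algebra_cat T C) A B. d0 \<odot> s = idt C (fst A) \<and> d1 \<odot> s = idt C (fst A)"
      using arr_hom[OF s(1)] s(2,3) by blast
    show "\<exists>\<sigma>\<in>hom (algebra_cat T C) B B. d0 \<odot> \<sigma> = d1 \<and> d1 \<odot> \<sigma> = d0"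
      using arr_hom[OF \<sigma>(1)] \<sigma>(2,3) by blast
    show "\<exists>P p q. is_pullback (algebra_cat T C) B B A d1 d0 P p q \<and>
        (\<exists>t\<in>hom (algebra_cat T C) P B. d0 \<odot> t = d0 \<odot> p \<and> d1 \<odot> t = d1 \<odot> q)"
      using P arr_hom[OF t(1)] t(2,3) by blast
  qed
  then show thesis using that e by blast
qed

lemma is_equiv_join_iff:
  assumes A: "A \<in> internal_algebras T C" and R: "R \<in> relations (algebra_cat T C) A"
    and S: "S \<in> relations (algebra_cat T C) A"
  shows "is_equiv_join (algebra_cat T C) A R S J \<longleftrightarrow> J \<in> equivalence_relations (algebra_cat T C) A \<and>
    congruence_join T C A (alg_rel_elem C R) (alg_rel_elem C S) (alg_rel_elem C J)"
proof -
  let ?E = "equivalence_relations (algebra_cat T C) A"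
  have E: "\<And>V. V \<in> ?E \<Longrightarrow> V \<in> relations (algebra_cat T C) A"
    unfolding equivalence_relations_def by auto
  have "is_equiv_join (algebra_cat T C) A R S J \<longleftrightarrow> J \<in> ?E \<and> alg_rel_elem C R \<sqsubseteq> alg_rel_elem C J \<and>
      alg_rel_elem C S \<sqsubseteq> alg_rel_elem C J \<and>
      (\<forall>V\<in>?E. alg_rel_elem C R \<sqsubseteq> alg_rel_elem C V \<and> alg_rel_elem C S \<sqsubseteq> alg_rel_elem C V \<longrightarrow>
        alg_rel_elem C J \<sqsubseteq> alg_rel_elem C V)"
  proof -
    have le: "rel_le (algebra_cat T C) U V \<longleftrightarrow> alg_rel_elem C U \<sqsubseteq> alg_rel_elem C V"
      if "U \<in> relations (algebra_cat T C) A" "V \<in> ?E" for U V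
      by (rule alg_rel_le_iff[OF A that(1) E[OF that(2)]])
    show ?thesis
      unfolding is_equiv_join_def is_lub_def ball_simps insert_iff empty_iff simp_thms conj_assoc
      by (intro conj_cong refl ball_cong imp_cong le R S E; assumption?)
  qed
  also have "\<dots> \<longleftrightarrow> J \<in> ?E \<and> congruence_join T C A (alg_rel_elem C R) (alg_rel_elem C S) (alg_rel_elem C J)"
  proof (rule conj_cong[OF refl])
    assume J: "J \<in> ?E"
    have img: "congruence T C A \<Phi> \<longleftrightarrow> (\<exists>V\<in>?E. alg_rel_elem C V = \<Phi>)" for \<Phi>
      using equivalence_relation_congruence[OF A] congruence_equivalence_relation[OF A] by metis
    show "(alg_rel_elem C R \<sqsubseteq> alg_rel_elem C J \<and> alg_rel_elem C S \<sqsubseteq> alg_rel_elem C J \<and>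
      (\<forall>V\<in>?E. alg_rel_elem C R \<sqsubseteq> alg_rel_elem C V \<and> alg_rel_elem C S \<sqsubseteq> alg_rel_elem C V \<longrightarrow>
        alg_rel_elem C J \<sqsubseteq> alg_rel_elem C V)) =
      congruence_join T C A (alg_rel_elem C R) (alg_rel_elem C S) (alg_rel_elem C J)"
      unfolding congruence_join_def img using J by (auto simp only:)
  qed
  finally show ?thesis .
qed

theorem congruence_modular_iff:
  "congruence_modular (algebra_cat T C) \<longleftrightarrow> (\<forall>A\<in>internal_algebras T C.
     (\<forall>\<Phi> \<Psi>. congruence T C A \<Phi> \<and> congruence T C A \<Psi> \<longrightarrow> (\<exists>J. congruence_join T C A \<Phi> \<Psi> J)) \<and>
     (\<forall>\<Phi> \<Psi> \<Gamma> J N. congruence T C A \<Phi> \<and> congruence T C A \<Psi> \<and> congruence T C A \<Gamma> \<and> \<Phi> \<sqsubseteq> \<Gamma> \<and>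
        congruence_join T C A \<Phi> \<Psi> J \<and> congruence_join T C A \<Phi> (\<Psi> \<sqinter> \<Gamma>) N \<longrightarrow> J \<sqinter> \<Gamma> = N))"
    (is "?l \<longleftrightarrow> (\<forall>A\<in>_. ?j A \<and> ?m A)")
proof -
  let ?E = "\<lambda>A. equivalence_relations (algebra_cat T C) A" let ?e = "alg_rel_elem C"
  have E: "\<And>A V. V \<in> ?E A \<Longrightarrow> V \<in> relations (algebra_cat T C) A"
    unfolding equivalence_relations_def by auto
  have j: "(\<forall>R\<in>?E A. \<forall>S\<in>?E A. \<exists>J. is_equiv_join (algebra_cat T C) A R S J) \<longleftrightarrow> ?j A"
    if A: "A \<in> internal_algebras T C" for A
  proof (intro iffI allI ballI impI; (elim conjE)?)
    fix \<Phi> \<Psi> assume l: "\<forall>R\<in>?E A. \<forall>S\<in>?E A. \<exists>J. is_equiv_join (algebra_cat T C) A R S J"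
      and c: "congruence T C A \<Phi>" "congruence T C A \<Psi>"
    obtain R S where R: "R \<in> ?E A" "?e R = \<Phi>" and S: "S \<in> ?E A" "?e S = \<Psi>"
      using congruence_equivalence_relation[OF A] c by metis
    then show "\<exists>J. congruence_join T C A \<Phi> \<Psi> J"
      using l is_equiv_join_iff[OF A E[OF R(1)] E[OF S(1)]] by metis
  next
    fix R S assume r: "?j A" and R: "R \<in> ?E A" and S: "S \<in> ?E A"
    then obtain J where J: "congruence_join T C A (?e R) (?e S) J"
      using equivalence_relation_congruence[OF A] by blast
    then obtain J' where "J' \<in> ?E A" "?e J' = J"
      using congruence_equivalence_relation[OF A] unfolding congruence_join_def by metis
    then show "\<exists>J. is_equiv_join (algebra_cat T C) A R S J"
      using J is_equiv_join_iff[OF A E[OF R] E[OF S]] by blast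
  qed
  have m: "(\<forall>R\<in>?E A. \<forall>S\<in>?E A. \<forall>V\<in>?E A. rel_le (algebra_cat T C) R V \<longrightarrow>
      (\<forall>J I M N. is_equiv_join (algebra_cat T C) A R S J \<and> is_rel_intersection (algebra_cat T C) A J V I \<and>
         is_rel_intersection (algebra_cat T C) A S V M \<and> is_equiv_join (algebra_cat T C) A R M N \<longrightarrow>
         rel_eq (algebra_cat T C) I N)) \<longleftrightarrow> ?m A" (is "?l' \<longleftrightarrow> _")
    if A: "A \<in> internal_algebras T C" for A
  proof
    assume l: ?l'
    show "?m A"
    proof (intro allI impI; elim conjE)
      fix \<Phi> \<Psi> \<Gamma> J N
      assume c: "congruence T C A \<Phi>" "congruence T C A \<Psi>" "congruence T C A \<Gamma>" and le: "\<Phi> \<sqsubseteq> \<Gamma>"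
        and J: "congruence_join T C A \<Phi> \<Psi> J" and N: "congruence_join T C A \<Phi> (\<Psi> \<sqinter> \<Gamma>) N"
      have cJ: "congruence T C A J" and cN: "congruence T C A N" using J N unfolding congruence_join_def by auto
      obtain R where R: "R \<in> ?E A" "?e R = \<Phi>" by (rule congruence_equivalence_relation[OF A c(1)])
      obtain S where S: "S \<in> ?E A" "?e S = \<Psi>" by (rule congruence_equivalence_relation[OF A c(2)])
      obtain V where V: "V \<in> ?E A" "?e V = \<Gamma>" by (rule congruence_equivalence_relation[OF A c(3)])
      obtain J' where J': "J' \<in> ?E A" "?e J' = J" by (rule congruence_equivalence_relation[OF A cJ])
      obtain N' where N': "N' \<in> ?E A" "?e N' = N" by (rule congruence_equivalence_relation[OF A cN])
      have meet: "\<exists>M. M \<in> relations (algebra_cat T C) A \<and> ?e M = ?e U \<sqinter> ?e W" if "U \<in> ?E A" "W \<in> ?E A" for U W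
      proof -
        note U = E[OF that(1)] and W = E[OF that(2)]
        have "compatible T C A (?e U \<sqinter> ?e W)"
          using alg_relation_compatible[OF A U] alg_relation_compatible[OF A W] unfolding compatible_def by blast
        with rel_pred_conj[OF alg_relation_rel_pred[OF A U] alg_relation_rel_pred[OF A W]]
        show ?thesis by (rule compatible_relation_lifts[OF A]) blast
      qed
      obtain I M where I: "I \<in> relations (algebra_cat T C) A" "?e I = ?e J' \<sqinter> ?e V"
        and M: "M \<in> relations (algebra_cat T C) A" "?e M = ?e S \<sqinter> ?e V"
        using meet[OF J'(1) V(1)] meet[OF S(1) V(1)] by blast
      have "rel_le (algebra_cat T C) R V" using alg_rel_le_iff[OF A E[OF R(1)] E[OF V(1)]] R V le by simp
      moreover have "is_equiv_join (algebra_cat T C) A R S J'"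
        using is_equiv_join_iff[OF A E[OF R(1)] E[OF S(1)]] J J' R S by simp
      moreover have "is_equiv_join (algebra_cat T C) A R M N'"
        using is_equiv_join_iff[OF A E[OF R(1)] M(1)] N N' R S V M by simp
      moreover have "is_rel_intersection (algebra_cat T C) A J' V I"
        using alg_rel_intersection_iff[OF A E[OF J'(1)] E[OF V(1)]] I by simp
      moreover have "is_rel_intersection (algebra_cat T C) A S V M"
        using alg_rel_intersection_iff[OF A E[OF S(1)] E[OF V(1)]] M by simp
      ultimately have "rel_eq (algebra_cat T C) I N'" using l R(1) S(1) V(1) by blast
      then have "?e I \<sqsubseteq> ?e N'" "?e N' \<sqsubseteq> ?e I"
        unfolding rel_eq_def using alg_rel_le_iff[OF A I(1) E[OF N'(1)]] alg_rel_le_iff[OF A E[OF N'(1)] I(1)] by auto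
      then have "?e I = ?e N'" by (intro ext) blast
      then show "J \<sqinter> \<Gamma> = N" using I J' V N' by simp
    qed
  next
    assume r: "?m A"
    show ?l'
    proof (intro ballI allI impI; elim conjE)
      fix R S V J I M N
      assume RSV: "R \<in> ?E A" "S \<in> ?E A" "V \<in> ?E A" and le: "rel_le (algebra_cat T C) R V"
        and J: "is_equiv_join (algebra_cat T C) A R S J" and I: "is_rel_intersection (algebra_cat T C) A J V I"
        and M: "is_rel_intersection (algebra_cat T C) A S V M" and N: "is_equiv_join (algebra_cat T C) A R M N"
      note R = E[OF RSV(1)] and S = E[OF RSV(2)] and V = E[OF RSV(3)]
      have J': "J \<in> ?E A" "congruence_join T C A (?e R) (?e S) (?e J)"
        using J is_equiv_join_iff[OF A R S] by auto
      have I': "I \<in> relations (algebra_cat T C) A" "?e I = ?e J \<sqinter> ?e V"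
        using I alg_rel_intersection_iff[OF A E[OF J'(1)] V] by auto
      have M': "M \<in> relations (algebra_cat T C) A" "?e M = ?e S \<sqinter> ?e V"
        using M alg_rel_intersection_iff[OF A S V] by auto
      have N': "N \<in> ?E A" "congruence_join T C A (?e R) (?e S \<sqinter> ?e V) (?e N)"
        using N is_equiv_join_iff[OF A R M'(1)] M'(2) by auto
      have "?e J \<sqinter> ?e V = ?e N"
        using r equivalence_relation_congruence[OF A] RSV J'(2) N'(2) le alg_rel_le_iff[OF A R V] by blast
      then show "rel_eq (algebra_cat T C) I N"
        unfolding rel_eq_def using alg_rel_le_iff[OF A I'(1) E[OF N'(1)]] alg_rel_le_iff[OF A E[OF N'(1)] I'(1)] I'(2)
        by simp
    qed
  qed
  show ?thesis
    unfolding congruence_modular_def using algebra_cat_finitely_complete[OF T] j m by auto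
qed

end

section \<open>Images and unions of chains\<close>

text \<open>
  The two properties of the base category that the construction of joins uses.  The first is the
  elimination rule of an existential quantifier: an element of the image of \<open>f\<close> may be
  replaced by a value of \<open>f\<close> when a representable predicate is to be proved, since such a predicate
  holds as soon as it holds at all stages at which the element lifts along \<open>f\<close>.  The second says that inverse images along split
  epimorphisms and intersections commute with suprema of chains.
\<close>

definition stable_images :: "('o, 'm) cat \<Rightarrow> bool" where
  "stable_images C \<longleftrightarrow> (\<forall>K Y. \<forall>f\<in>arr C K Y. \<exists>\<iota>. sub_pred C Y \<iota> \<and> \<iota> K f \<and>
     (\<forall>Z x \<phi>. \<iota> Z x \<longrightarrow> sub_pred C Z \<phi> \<longrightarrow>
        (\<forall>Z'. \<forall>z\<in>arr C Z' Z. \<forall>k\<in>arr C Z' K. f \<odot>\<^bsub>C\<^esub> k = x \<odot>\<^bsub>C\<^esub> z \<longrightarrow> \<phi> Z' z) \<longrightarrow> \<phi> Z (idt C Z)))"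

definition chain_distributive :: "('o, 'm) cat \<Rightarrow> bool" where
  "chain_distributive C \<longleftrightarrow> (\<forall>W Y g A U \<beta> \<phi>.
     g \<in> arr C W Y \<and> split_epi C W Y g \<and> is_chain C Y A \<and> is_chain_sup C Y A U \<and>
     sub_pred C W \<beta> \<and> sub_pred C W \<phi> \<and> (\<forall>k Z w. \<beta> Z w \<longrightarrow> fac C (A k) Z (g \<odot>\<^bsub>C\<^esub> w) \<longrightarrow> \<phi> Z w) \<longrightarrow>
     (\<forall>Z w. \<beta> Z w \<longrightarrow> fac C U Z (g \<odot>\<^bsub>C\<^esub> w) \<longrightarrow> \<phi> Z w))"

context lex_category
begin

lemma chain_sup_iff:
  assumes Y: "Y \<in> obj C" and A: "\<And>i. A i \<in> subobjects C Y"
  shows "is_chain_sup C Y A U \<longleftrightarrow> U \<in> subobjects C Y \<and> (\<forall>i Z x. fac C (A i) Z x \<longrightarrow> fac C U Z x) \<and>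
    (\<forall>\<phi>. sub_pred C Y \<phi> \<longrightarrow> (\<forall>i Z x. fac C (A i) Z x \<longrightarrow> \<phi> Z x) \<longrightarrow> (\<forall>Z x. fac C U Z x \<longrightarrow> \<phi> Z x))"
proof -
  have "(\<forall>V\<in>subobjects C Y. (\<forall>i. sub_le C (A i) V) \<longrightarrow> sub_le C U V) \<longleftrightarrow>
      (\<forall>\<phi>. sub_pred C Y \<phi> \<longrightarrow> (\<forall>i Z x. fac C (A i) Z x \<longrightarrow> \<phi> Z x) \<longrightarrow> (\<forall>Z x. fac C U Z x \<longrightarrow> \<phi> Z x))"
    if U: "U \<in> subobjects C Y"
  proof -
    have "(\<forall>V\<in>subobjects C Y. (\<forall>i. sub_le C (A i) V) \<longrightarrow> sub_le C U V) \<longleftrightarrow>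
        (\<forall>V\<in>subobjects C Y. (\<forall>i Z x. fac C (A i) Z x \<longrightarrow> fac C V Z x) \<longrightarrow> (\<forall>Z x. fac C U Z x \<longrightarrow> fac C V Z x))"
      using sub_le_iff[OF Y A] sub_le_iff[OF Y U] by (intro ball_cong refl) simp
    also have "\<dots> \<longleftrightarrow>
        (\<forall>\<phi>. sub_pred C Y \<phi> \<longrightarrow> (\<forall>i Z x. fac C (A i) Z x \<longrightarrow> \<phi> Z x) \<longrightarrow> (\<forall>Z x. fac C U Z x \<longrightarrow> \<phi> Z x))"
    proof (intro iffI allI impI ballI)
      fix \<phi> Z x
      assume l: "\<forall>V\<in>subobjects C Y. (\<forall>i Z x. fac C (A i) Z x \<longrightarrow> fac C V Z x) \<longrightarrow> (\<forall>Z x. fac C U Z x \<longrightarrow> fac C V Z x)"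
        and \<phi>: "sub_pred C Y \<phi>" and le: "\<forall>i Z x. fac C (A i) Z x \<longrightarrow> \<phi> Z x" and x: "fac C U Z x"
      obtain V where "V \<in> subobjects C Y" "\<phi> = fac C V" using \<phi> unfolding sub_pred_def by blast
      then show "\<phi> Z x" using bspec[OF l, of V] le x by simp
    next
      fix V Z x
      assume r: "\<forall>\<phi>. sub_pred C Y \<phi> \<longrightarrow> (\<forall>i Z x. fac C (A i) Z x \<longrightarrow> \<phi> Z x) \<longrightarrow> (\<forall>Z x. fac C U Z x \<longrightarrow> \<phi> Z x)"
        and V: "V \<in> subobjects C Y" and le: "\<forall>i Z x. fac C (A i) Z x \<longrightarrow> fac C V Z x" and x: "fac C U Z x"
      show "fac C V Z x" using r[THEN spec, of "fac C V"] fac_sub_pred[OF Y V] le x by simp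
    qed
    finally show ?thesis .
  qed
  moreover have "(\<forall>i. sub_le C (A i) U) \<longleftrightarrow> (\<forall>i Z x. fac C (A i) Z x \<longrightarrow> fac C U Z x)"
    if "U \<in> subobjects C Y"
    using sub_le_iff[OF Y A that] by simp
  moreover have "is_chain_sup C Y A U \<longleftrightarrow> U \<in> subobjects C Y \<and> (\<forall>i. sub_le C (A i) U) \<and>
      (\<forall>V\<in>subobjects C Y. (\<forall>i. sub_le C (A i) V) \<longrightarrow> sub_le C U V)"
    unfolding is_chain_sup_def is_lub_def by simp
  ultimately show ?thesis by (cases "U \<in> subobjects C Y") (simp_all only: simp_thms)
qed

lemma intersectionI:
  assumes X: "X \<in> obj C" and M: "M \<in> subobjects C X" "N \<in> subobjects C X" and I: "I \<in> subobjects C X"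
    and e: "\<And>Z x. fac C I Z x \<longleftrightarrow> fac C M Z x \<and> fac C N Z x"
  shows "is_intersection C X M N I"
  unfolding is_intersection_def is_glb_def using M I e sub_le_iff[OF X] by auto

text \<open>
  The chain is first pulled back along \<open>g\<close> and then intersected with \<open>\<beta>\<close>; the supremum is
  preserved each time, so any bound of the resulting chain is a bound of its supremum.
\<close>

lemma chain_distributive_if_stable:
  assumes split: "chain_suprema_stable_split_epi C" and inter: "chain_suprema_stable_intersection C"
  shows "chain_distributive C"
  unfolding chain_distributive_def
proof (intro allI impI; elim conjE)
  fix W Y g A U \<beta> \<phi> Z w
  assume g: "g \<in> arr C W Y" "split_epi C W Y g" and A: "is_chain C Y A" and U: "is_chain_sup C Y A U"
    and \<beta>: "sub_pred C W \<beta>" and \<phi>: "sub_pred C W \<phi>"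
    and le: "\<forall>k Z w. \<beta> Z w \<longrightarrow> fac C (A k) Z (g \<odot> w) \<longrightarrow> \<phi> Z w"
    and w: "\<beta> Z w" "fac C U Z (g \<odot> w)"
  have W: "W \<in> obj C" and Y: "Y \<in> obj C" using g arr_obj by fast+
  have A': "A k \<in> subobjects C Y" for k using A by (simp add: is_chain_def)
  have U': "U \<in> subobjects C Y" using U by (simp add: is_chain_sup_def is_lub_def)
  have "\<forall>k. \<exists>N. N \<in> subobjects C W \<and> is_inverse_image C W Y g (A k) N \<and>
      (\<forall>Z w. fac C N Z w \<longleftrightarrow> w \<in> arr C Z W \<and> fac C (A k) Z (g \<odot> w))"
    using inverse_image_exists[OF A' g(1)] by metis
  then obtain G where G: "\<And>k. G k \<in> subobjects C W" "\<And>k. is_inverse_image C W Y g (A k) (G k)"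
    "\<And>k Z w. fac C (G k) Z w \<longleftrightarrow> w \<in> arr C Z W \<and> fac C (A k) Z (g \<odot> w)" by metis
  obtain H where H: "H \<in> subobjects C W" "is_inverse_image C W Y g U H"
    "\<And>Z w. fac C H Z w \<longleftrightarrow> w \<in> arr C Z W \<and> fac C U Z (g \<odot> w)"
    using inverse_image_exists[OF U' g(1)] by metis
  have GH: "is_chain_sup C W G H"
    using split W Y g(2) A U G(2) H(2) unfolding chain_suprema_stable_split_epi_def by blast
  have step: "fac C (A k) Z x \<Longrightarrow> fac C (A (Suc k)) Z x" for k Z x
    using A sub_le_iff[OF Y A' A'] unfolding is_chain_def by blast
  have chain: "is_chain C W G"
    unfolding is_chain_def using G(1) sub_le_iff[OF W G(1) G(1)] G(3) step by auto
  obtain B where B: "B \<in> subobjects C W" "\<beta> = fac C B" using \<beta> unfolding sub_pred_def by blast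
  have meet: "\<exists>I\<in>subobjects C W. \<forall>Z x. fac C I Z x \<longleftrightarrow> fac C N Z x \<and> fac C B Z x" if "N \<in> subobjects C W" for N
    using sub_pred_conj[OF fac_sub_pred[OF W that] fac_sub_pred[OF W B(1)]] unfolding sub_pred_def
    by (auto simp: fun_eq_iff)
  have "\<forall>k. \<exists>I. I \<in> subobjects C W \<and> (\<forall>Z x. fac C I Z x \<longleftrightarrow> fac C (G k) Z x \<and> fac C B Z x)"
    using meet[OF G(1)] by blast
  from choice[OF this] obtain G' where
    G': "\<And>k. G' k \<in> subobjects C W" "\<And>k Z x. fac C (G' k) Z x \<longleftrightarrow> fac C (G k) Z x \<and> fac C B Z x" by blast
  obtain H' where H': "H' \<in> subobjects C W" "\<And>Z x. fac C H' Z x \<longleftrightarrow> fac C H Z x \<and> fac C B Z x"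
    using meet[OF H(1)] by blast
  have "is_intersection C W (G k) B (G' k)" for k
    by (rule intersectionI[OF W G(1) B(1) G'(1) G'(2)])
  moreover have "is_intersection C W H B H'"
    by (rule intersectionI[OF W H(1) B(1) H'(1) H'(2)])
  ultimately have "is_chain_sup C W G' H'"
    using inter W chain GH B(1) unfolding chain_suprema_stable_intersection_def by blast
  then have lub: "\<forall>\<phi>. sub_pred C W \<phi> \<longrightarrow> (\<forall>i Z x. fac C (G' i) Z x \<longrightarrow> \<phi> Z x) \<longrightarrow> (\<forall>Z x. fac C H' Z x \<longrightarrow> \<phi> Z x)"
    unfolding chain_sup_iff[OF W G'(1)] by (elim conjE)
  have "fac C H' Z x \<longrightarrow> \<phi> Z x" for Z x
    by (rule lub[rule_format, OF \<phi>, THEN impI]) (use le B(2) G'(2) G(3) in auto)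
  moreover have "fac C H Z w" using H(3) sub_pred_arr[OF \<beta> w(1)] w(2) by blast
  moreover have "fac C B Z w" using w(1) B(2) by simp
  ultimately show "\<phi> Z w" using H'(2) by blast
qed

section \<open>Regular categories\<close>

text \<open>
  Representable predicates are local for regular epimorphisms: if \<open>e\<close> factors through a monic
  arrow, the factor coequalizes the same pair as \<open>e\<close> and hence extends along \<open>e\<close>.
\<close>

lemma regular_epi_local:
  assumes e: "regular_epi C A Q e" and \<phi>: "sub_pred C Q \<phi>" and a: "\<phi> A e"
  shows "\<phi> Q (idt C Q)"
proof -
  obtain K u v where K: "is_coequalizer C K A u v Q e" using e unfolding regular_epi_def by blast
  then have u: "u \<in> arr C K A" and v: "v \<in> arr C K A" and e: "e \<in> arr C A Q" and uv: "e \<odot> u = e \<odot> v"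
    and ex: "\<And>Y g. g \<in> arr C A Y \<Longrightarrow> g \<odot> u = g \<odot> v \<Longrightarrow> \<exists>!h. h \<in> hom C Q Y \<and> h \<odot> e = g"
    unfolding is_coequalizer_def by (auto simp: arr_def)
  from \<phi> obtain M m where Q: "Q \<in> obj C" and m: "m \<in> arr C M Q"
    and mono: "\<And>Z g h. g \<in> arr C Z M \<Longrightarrow> h \<in> arr C Z M \<Longrightarrow> m \<odot> g = m \<odot> h \<Longrightarrow> g = h"
    and \<phi>_iff: "\<And>Z x. \<phi> Z x \<longleftrightarrow> (\<exists>k\<in>arr C Z M. m \<odot> k = x)" by (rule sub_predE) (rule that)
  obtain k where k: "k \<in> arr C A M" "m \<odot> k = e" using a \<phi>_iff by blast
  have "m \<odot> (k \<odot> u) = m \<odot> (k \<odot> v)" using assoc[OF u k(1) m] assoc[OF v k(1) m] k(2) uv by simp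
  then have "k \<odot> u = k \<odot> v" using mono comp_arr[OF u k(1)] comp_arr[OF v k(1)] by blast
  then obtain h where "h \<in> hom C Q M" and he: "h \<odot> e = k" using ex[OF k(1)] by blast
  then have h: "h \<in> arr C Q M" using Q arr_obj(1)[OF m] by (simp add: arr_def)
  have "(m \<odot> h) \<odot> e = e" "idt C Q \<odot> e = e" using assoc[OF e h m] he k(2) idt_left[OF e] by simp_all
  then have "m \<odot> h = idt C Q"
    using ex[OF e uv] arr_hom[OF comp_arr[OF h m]] arr_hom[OF idt_arr[OF Q]] by blast
  then show ?thesis using \<phi>_iff h by blast
qed

lemma regular_epi_epic:
  assumes e: "regular_epi C A Q e" and g: "g \<in> arr C Q Y" and h: "h \<in> arr C Q Y" and eq: "g \<odot> e = h \<odot> e"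
  shows "g = h"
proof -
  obtain K u v where K: "is_coequalizer C K A u v Q e" using e unfolding regular_epi_def by blast
  then have u: "u \<in> arr C K A" and v: "v \<in> arr C K A" and e: "e \<in> arr C A Q" and uv: "e \<odot> u = e \<odot> v"
    and ex: "\<And>Y g. g \<in> arr C A Y \<Longrightarrow> g \<odot> u = g \<odot> v \<Longrightarrow> \<exists>!h. h \<in> hom C Q Y \<and> h \<odot> e = g"
    unfolding is_coequalizer_def by (auto simp: arr_def)
  have "(g \<odot> e) \<odot> u = (g \<odot> e) \<odot> v" using assoc[OF u e g] assoc[OF v e g] uv by simp
  then show ?thesis using ex[OF comp_arr[OF e g]] arr_hom[OF g] arr_hom[OF h] eq by metis
qed

text \<open>
  The image of \<open>f\<close> is the coequalizer \<open>e\<close> of its kernel pair, followed by the induced \<open>m\<close>.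
  To see that \<open>m\<close> is monic, two elements of the quotient with the same value are lifted
  along \<open>e\<close>, one after the other, by pulling \<open>e\<close> back.
\<close>

lemma regular_stable_images:
  assumes R: "regular_category C"
  shows "stable_images C"
  unfolding stable_images_def
proof (intro allI ballI)
  fix K Y f assume f: "f \<in> arr C K Y"
  obtain N p q where N: "is_pullback C K K Y f f N p q" using pullback_exists[OF f f] by blast
  then obtain Q e where co: "is_coequalizer C N K p q Q e" using R unfolding regular_category_def by blast
  then have reg: "regular_epi C K Q e" unfolding regular_epi_def by blast
  have p: "p \<in> arr C N K" and q: "q \<in> arr C N K" and e: "e \<in> arr C K Q" and pq: "e \<odot> p = e \<odot> q"
    and ex: "\<And>Y g. g \<in> arr C K Y \<Longrightarrow> g \<odot> p = g \<odot> q \<Longrightarrow> \<exists>!h. h \<in> hom C Q Y \<and> h \<odot> e = g"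
    using co unfolding is_coequalizer_def by (auto simp: arr_def)
  have fpq: "f \<odot> p = f \<odot> q"
    and ker: "\<And>Z u v. u \<in> arr C Z K \<Longrightarrow> v \<in> arr C Z K \<Longrightarrow> f \<odot> u = f \<odot> v \<Longrightarrow> \<exists>h\<in>arr C Z N. p \<odot> h = u \<and> q \<odot> h = v"
    using N unfolding is_pullback_iff by blast+
  obtain m where "m \<in> hom C Q Y" and me: "m \<odot> e = f" using ex[OF f fpq] by blast
  then have m: "m \<in> arr C Q Y" using arr_obj(2)[OF e] arr_obj(2)[OF f] by (simp add: arr_def)
  have lift: "\<exists>P z a. regular_epi C P Z z \<and> z \<in> arr C P Z \<and> a \<in> arr C P K \<and> e \<odot> a = x \<odot> z" if x: "x \<in> arr C Z Q" for Z x
  proof -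
    obtain P z a where P: "is_pullback C Z K Q x e P z a" using pullback_exists[OF x e] by blast
    then have "regular_epi C P Z z" using R reg unfolding regular_category_def by blast
    then show ?thesis using P unfolding is_pullback_iff by metis
  qed
  have mono: "g = h" if g: "g \<in> arr C Z Q" and h: "h \<in> arr C Z Q" and eq: "m \<odot> g = m \<odot> h" for Z g h
  proof -
    obtain P z a where z: "regular_epi C P Z z" "z \<in> arr C P Z" and a: "a \<in> arr C P K" "e \<odot> a = g \<odot> z"
      using lift[OF g] by blast
    obtain P' z' b where z': "regular_epi C P' P z'" "z' \<in> arr C P' P" and b: "b \<in> arr C P' K" "e \<odot> b = (h \<odot> z) \<odot> z'"
      using lift[OF comp_arr[OF z(2) h]] by blast
    have a': "a \<odot> z' \<in> arr C P' K" "e \<odot> (a \<odot> z') = (g \<odot> z) \<odot> z'"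
      using comp_arr[OF z'(2) a(1)] assoc[OF z'(2) a(1) e] a(2) by simp_all
    have fa: "f \<odot> (a \<odot> z') = m \<odot> ((g \<odot> z) \<odot> z')" using assoc[OF a'(1) e m] me a'(2) by simp
    have fb: "f \<odot> b = m \<odot> ((h \<odot> z) \<odot> z')" using assoc[OF b(1) e m] me b(2) by simp
    have "m \<odot> ((g \<odot> z) \<odot> z') = ((m \<odot> g) \<odot> z) \<odot> z'" "m \<odot> ((h \<odot> z) \<odot> z') = ((m \<odot> h) \<odot> z) \<odot> z'"
      using assoc[OF z'(2) comp_arr[OF z(2) g] m] assoc[OF z'(2) comp_arr[OF z(2) h] m]
        assoc[OF z(2) g m] assoc[OF z(2) h m] by simp_all
    then have "f \<odot> (a \<odot> z') = f \<odot> b" using fa fb eq by simp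
    then obtain k where k: "k \<in> arr C P' N" "p \<odot> k = a \<odot> z'" "q \<odot> k = b" using ker[OF a'(1) b(1)] by blast
    have "e \<odot> (a \<odot> z') = e \<odot> b" using assoc[OF k(1) p e] assoc[OF k(1) q e] k pq by simp
    then have "(g \<odot> z) \<odot> z' = (h \<odot> z) \<odot> z'" using a'(2) b(2) by simp
    then have "g \<odot> z = h \<odot> z" using regular_epi_epic[OF z'(1) comp_arr[OF z(2) g] comp_arr[OF z(2) h]] by blast
    then show ?thesis using regular_epi_epic[OF z(1) g h] by blast
  qed
  let ?i = "\<lambda>Z x. \<exists>k\<in>arr C Z Q. m \<odot> k = x"
  have "sub_pred C Y ?i" by (rule sub_predI[OF arr_obj(2)[OF f] m]) (use mono in auto)
  moreover have "?i K f" using e me by blast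
  moreover have "\<phi> Z (idt C Z)" if x: "?i Z x" and \<phi>: "sub_pred C Z \<phi>"
    and loc: "\<forall>Z'. \<forall>z\<in>arr C Z' Z. \<forall>k\<in>arr C Z' K. f \<odot> k = x \<odot> z \<longrightarrow> \<phi> Z' z" for Z x \<phi>
  proof -
    obtain y where y: "y \<in> arr C Z Q" "m \<odot> y = x" using x by blast
    obtain P z a where z: "regular_epi C P Z z" "z \<in> arr C P Z" and a: "a \<in> arr C P K" "e \<odot> a = y \<odot> z"
      using lift[OF y(1)] by blast
    have "f \<odot> a = x \<odot> z" using assoc[OF a(1) e m] assoc[OF z(2) y(1) m] me a(2) y(2) by simp
    then have "\<phi> P z" using loc z(2) a(1) by blast
    then show ?thesis by (rule regular_epi_local[OF z(1) \<phi>])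
  qed
  ultimately show "\<exists>\<iota>. sub_pred C Y \<iota> \<and> \<iota> K f \<and> (\<forall>Z x \<phi>. \<iota> Z x \<longrightarrow> sub_pred C Z \<phi> \<longrightarrow>
      (\<forall>Z'. \<forall>z\<in>arr C Z' Z. \<forall>k\<in>arr C Z' K. f \<odot> k = x \<odot> z \<longrightarrow> \<phi> Z' z) \<longrightarrow> \<phi> Z (idt C Z))"
    by (intro exI[of _ ?i] conjI allI impI) blast+
qed

end

section \<open>Toposes\<close>

text \<open>
  In a topos both properties follow from universal quantification along an arrow, which in turn
  is an equalizer of two maps into a power object.  Neither coequalizers nor slices are needed.
\<close>

context lex_category
begin

lemma subobject_classifier:
  assumes "has_subobject_classifier C"
  obtains \<Omega> \<tau> where "sub_pred C \<Omega> \<tau>"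
    "\<And>X \<phi>. sub_pred C X \<phi> \<Longrightarrow> \<exists>\<chi>\<in>arr C X \<Omega>. \<forall>Z. \<forall>x\<in>arr C Z X. \<phi> Z x \<longleftrightarrow> \<tau> Z (\<chi> \<odot> x)"
    "\<And>X \<chi> \<chi>'. \<chi> \<in> arr C X \<Omega> \<Longrightarrow> \<chi>' \<in> arr C X \<Omega> \<Longrightarrow>
      \<forall>Z. \<forall>x\<in>arr C Z X. \<tau> Z (\<chi> \<odot> x) \<longleftrightarrow> \<tau> Z (\<chi>' \<odot> x) \<Longrightarrow> \<chi> = \<chi>'"
proof -
  obtain I \<Omega> t where I: "is_terminal C I" and \<Omega>: "\<Omega> \<in> obj C" and "t \<in> hom C I \<Omega>"
    and all: "\<forall>X\<in>obj C. \<forall>(A, m)\<in>subobjects C X.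
      \<exists>!\<chi>. \<chi> \<in> hom C X \<Omega> \<and> (\<exists>u. is_pullback C X I \<Omega> \<chi> t A m u)"
    using assms unfolding has_subobject_classifier_def by blast
  have cl: "\<exists>!\<chi>. \<chi> \<in> hom C X \<Omega> \<and> (\<exists>u. is_pullback C X I \<Omega> \<chi> t A m u)"
    if "X \<in> obj C" "(A, m) \<in> subobjects C X" for X A m
    using bspec[OF bspec[OF all that(1)] that(2)] by (simp only: split_conv)
  have I_obj: "I \<in> obj C" and I_un: "\<And>Z i j. i \<in> arr C Z I \<Longrightarrow> j \<in> arr C Z I \<Longrightarrow> i = j"
    using I unfolding is_terminal_def arr_def by auto
  have t: "t \<in> arr C I \<Omega>" using \<open>t \<in> hom C I \<Omega>\<close> I_obj \<Omega> by (rule hom_arr[rotated 2])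
  let ?t = "\<lambda>Z w. \<exists>i\<in>arr C Z I. t \<odot> i = w"
  have \<tau>: "sub_pred C \<Omega> ?t" by (rule sub_predI[OF \<Omega> t]) (use I_un in auto)
  have pb: "(\<exists>u. is_pullback C X I \<Omega> \<chi> t A m u) \<longleftrightarrow> (\<forall>Z. \<forall>x\<in>arr C Z X. fac C (A, m) Z x \<longleftrightarrow> ?t Z (\<chi> \<odot> x))"
    (is "?l \<longleftrightarrow> ?r") if X: "X \<in> obj C" and A: "(A, m) \<in> subobjects C X" and \<chi>: "\<chi> \<in> arr C X \<Omega>" for X A m \<chi>
  proof
    have m: "m \<in> arr C A X" and mono: "\<And>Z g h. g \<in> arr C Z A \<Longrightarrow> h \<in> arr C Z A \<Longrightarrow> m \<odot> g = m \<odot> h \<Longrightarrow> g = h"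
      using A unfolding subobjects_iff[OF X] by auto
    {
      assume ?l
      then obtain u where u: "u \<in> arr C A I" "\<chi> \<odot> m = t \<odot> u"
        and ex: "\<And>Z x i. x \<in> arr C Z X \<Longrightarrow> i \<in> arr C Z I \<Longrightarrow> \<chi> \<odot> x = t \<odot> i \<Longrightarrow> \<exists>h\<in>arr C Z A. m \<odot> h = x \<and> u \<odot> h = i"
        unfolding is_pullback_iff by blast
      show ?r
      proof (intro allI ballI iffI)
        fix Z x assume x: "x \<in> arr C Z X"
        show "?t Z (\<chi> \<odot> x)" if fx: "fac C (A, m) Z x"
        proof -
          obtain k where k: "k \<in> arr C Z A" "m \<odot> k = x" using fx unfolding fac_def by auto
          have "t \<odot> (u \<odot> k) = \<chi> \<odot> x" using assoc[OF k(1) u(1) t] assoc[OF k(1) m \<chi>] u(2) k(2) by simp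
          then show ?thesis using u(1) k(1) by blast
        qed
        show "fac C (A, m) Z x" if tx: "?t Z (\<chi> \<odot> x)"
        proof -
          obtain i where "i \<in> arr C Z I" "\<chi> \<odot> x = t \<odot> i" using tx by metis
          then show ?thesis using ex[OF x] unfolding fac_def by auto
        qed
      qed
    }
    {
      assume r: ?r
      have "fac C (A, m) A m" unfolding fac_def using idt_arr[OF arr_obj(1)[OF m]] idt_right[OF m] by auto
      then obtain u where u: "u \<in> arr C A I" "t \<odot> u = \<chi> \<odot> m" using r m by blast
      have "\<exists>h\<in>arr C Z A. m \<odot> h = x \<and> u \<odot> h = i" if x: "x \<in> arr C Z X" and i: "i \<in> arr C Z I" "\<chi> \<odot> x = t \<odot> i" for Z x i
      proof -
        have "?t Z (\<chi> \<odot> x)" using i by metis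
        then have "fac C (A, m) Z x" using r x by blast
        then obtain h where h: "h \<in> arr C Z A" "m \<odot> h = x" unfolding fac_def by auto
        then show ?thesis using I_un[OF comp_arr[OF h(1) u(1)] i(1)] by blast
      qed
      then have "is_pullback C X I \<Omega> \<chi> t A m u"
        unfolding is_pullback_iff using \<chi> t m u mono by (intro conjI) auto
      then show ?l by blast
    }
  qed
  have classify: "\<exists>\<chi>\<in>arr C X \<Omega>. \<forall>Z. \<forall>x\<in>arr C Z X. \<phi> Z x \<longleftrightarrow> ?t Z (\<chi> \<odot> x)" if \<phi>: "sub_pred C X \<phi>" for X \<phi>
  proof -
    obtain A m where X: "X \<in> obj C" and A: "(A, m) \<in> subobjects C X" and e: "\<phi> = fac C (A, m)"
      using \<phi> unfolding sub_pred_def by auto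
    obtain \<chi> where \<chi>: "\<chi> \<in> hom C X \<Omega>" "\<exists>u. is_pullback C X I \<Omega> \<chi> t A m u" using cl[OF X A] by blast
    have "\<chi> \<in> arr C X \<Omega>" using \<chi>(1) X \<Omega> by (simp add: arr_def)
    then show ?thesis using pb[OF X A] \<chi>(2) e by blast
  qed
  have unique: "\<chi> = \<chi>'" if \<chi>: "\<chi> \<in> arr C X \<Omega>" "\<chi>' \<in> arr C X \<Omega>"
    and e: "\<forall>Z. \<forall>x\<in>arr C Z X. ?t Z (\<chi> \<odot> x) \<longleftrightarrow> ?t Z (\<chi>' \<odot> x)" for X \<chi> \<chi>'
  proof -
    have "sub_pred C X (\<lambda>Z x. x \<in> arr C Z X \<and> ?t Z (\<chi> \<odot> x))" by (rule sub_pred_pull[OF \<tau> \<chi>(1)])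
    then obtain A m where X: "X \<in> obj C" and A: "(A, m) \<in> subobjects C X"
      and "(\<lambda>Z x. x \<in> arr C Z X \<and> ?t Z (\<chi> \<odot> x)) = fac C (A, m)"
      unfolding sub_pred_def by auto
    then have f: "\<And>Z x. fac C (A, m) Z x \<longleftrightarrow> x \<in> arr C Z X \<and> ?t Z (\<chi> \<odot> x)" by (simp add: fun_eq_iff)
    have "\<exists>u. is_pullback C X I \<Omega> \<chi> t A m u" unfolding pb[OF X A \<chi>(1)] using f by simp
    moreover have "\<exists>u. is_pullback C X I \<Omega> \<chi>' t A m u" unfolding pb[OF X A \<chi>(2)] using f e by simp
    ultimately show ?thesis using cl[OF X A] arr_hom[OF \<chi>(1)] arr_hom[OF \<chi>(2)] by blast
  qed
  show thesis by (rule that[OF \<tau> classify unique])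
qed

text \<open>
  Power objects.  The predicate \<open>\<epsilon> Z u k\<close> says that the element \<open>k\<close> of \<open>K\<close> belongs to the subset
  \<open>u\<close> of \<open>K\<close>; every subset of \<open>K\<close> that varies over \<open>Z\<close> has a unique name.
\<close>

lemma power_object:
  assumes topos: "topos C" and K: "K \<in> obj C"
  obtains E \<epsilon> where "E \<in> obj C"
    "\<And>W u k. u \<in> arr C W E \<Longrightarrow> k \<in> arr C W K \<Longrightarrow> sub_pred C W (\<lambda>Z w. w \<in> arr C Z W \<and> \<epsilon> Z (u \<odot> w) (k \<odot> w))"
    "\<And>Z Q q q' \<phi>. is_product C Z K Q q q' \<Longrightarrow> sub_pred C Q \<phi> \<Longrightarrow>
      \<exists>u\<in>arr C Z E. \<forall>Z'. \<forall>y\<in>arr C Z' Q. \<epsilon> Z' (u \<odot> (q \<odot> y)) (q' \<odot> y) \<longleftrightarrow> \<phi> Z' y"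
    "\<And>Z u v. u \<in> arr C Z E \<Longrightarrow> v \<in> arr C Z E \<Longrightarrow>
      \<forall>Z'. \<forall>z\<in>arr C Z' Z. \<forall>k\<in>arr C Z' K. \<epsilon> Z' (u \<odot> z) k \<longleftrightarrow> \<epsilon> Z' (v \<odot> z) k \<Longrightarrow> u = v"
proof -
  obtain \<Omega> \<tau> where \<tau>: "sub_pred C \<Omega> \<tau>"
    and classify: "\<And>X \<phi>. sub_pred C X \<phi> \<Longrightarrow> \<exists>\<chi>\<in>arr C X \<Omega>. \<forall>Z. \<forall>x\<in>arr C Z X. \<phi> Z x \<longleftrightarrow> \<tau> Z (\<chi> \<odot> x)"
    and unique: "\<And>X \<chi> \<chi>'. \<chi> \<in> arr C X \<Omega> \<Longrightarrow> \<chi>' \<in> arr C X \<Omega> \<Longrightarrow>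
      \<forall>Z. \<forall>x\<in>arr C Z X. \<tau> Z (\<chi> \<odot> x) \<longleftrightarrow> \<tau> Z (\<chi>' \<odot> x) \<Longrightarrow> \<chi> = \<chi>'"
    by (rule subobject_classifier) (use topos in \<open>simp add: topos_def\<close>, rule that)
  have \<Omega>: "\<Omega> \<in> obj C" using \<tau> unfolding sub_pred_def by blast
  obtain E P p p' ev where ex: "is_exponential C K \<Omega> E P p p' ev" using topos K \<Omega> unfolding topos_def by blast
  then have PE: "is_product C E K P p p'" and ev_hom: "ev \<in> hom C P \<Omega>"
    and curry: "\<And>Z Q q q' f. is_product C Z K Q q q' \<Longrightarrow> f \<in> hom C Q \<Omega> \<Longrightarrow>
      \<exists>!h. h \<in> hom C Z E \<and> (\<exists>k\<in>hom C Q P. p \<odot> k = h \<odot> q \<and> p' \<odot> k = q' \<and> ev \<odot> k = f)"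
    unfolding is_exponential_def by blast+
  have p: "p \<in> arr C P E" and p': "p' \<in> arr C P K"
    and pr_ex: "\<And>Z u v. u \<in> arr C Z E \<Longrightarrow> v \<in> arr C Z K \<Longrightarrow> \<exists>h\<in>arr C Z P. p \<odot> h = u \<and> p' \<odot> h = v"
    and pr_un: "\<And>Z h k. h \<in> arr C Z P \<Longrightarrow> k \<in> arr C Z P \<Longrightarrow> p \<odot> h = p \<odot> k \<Longrightarrow> p' \<odot> h = p' \<odot> k \<Longrightarrow> h = k"
    using PE unfolding is_product_iff by blast+
  have E: "E \<in> obj C" using p arr_obj by fast
  have ev: "ev \<in> arr C P \<Omega>" by (rule hom_arr[OF arr_obj(1)[OF p] \<Omega> ev_hom])
  define \<epsilon> where "\<epsilon> Z u k \<longleftrightarrow> (\<exists>h\<in>arr C Z P. p \<odot> h = u \<and> p' \<odot> h = k \<and> \<tau> Z (ev \<odot> h))" for Z u k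
  have \<epsilon>_iff: "\<epsilon> Z (p \<odot> h) (p' \<odot> h) \<longleftrightarrow> \<tau> Z (ev \<odot> h)" if "h \<in> arr C Z P" for Z h
    unfolding \<epsilon>_def using that pr_un[OF _ that] by metis
  have \<epsilon>_comp: "\<epsilon> Z (u \<odot> w) (k \<odot> w) \<longleftrightarrow> \<tau> Z ((ev \<odot> h) \<odot> w)"
    if "h \<in> arr C W P" "p \<odot> h = u" "p' \<odot> h = k" "w \<in> arr C Z W" for Z W h u k w
    using \<epsilon>_iff[OF comp_arr[OF that(4,1)]] assoc[OF that(4,1) p] assoc[OF that(4,1) p'] assoc[OF that(4,1) ev] that
    by simp
  have pull: "sub_pred C W (\<lambda>Z w. w \<in> arr C Z W \<and> \<epsilon> Z (u \<odot> w) (k \<odot> w))"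
    if u: "u \<in> arr C W E" and k: "k \<in> arr C W K" for W u k
  proof -
    obtain h where h: "h \<in> arr C W P" "p \<odot> h = u" "p' \<odot> h = k" using pr_ex[OF u k] by blast
    show ?thesis
      by (rule sub_pred_cong[OF sub_pred_pull[OF \<tau> comp_arr[OF h(1) ev]]]) (use \<epsilon>_comp[OF h] in blast)
  qed
  have name: "\<exists>u\<in>arr C Z E. \<forall>Z'. \<forall>y\<in>arr C Z' Q. \<epsilon> Z' (u \<odot> (q \<odot> y)) (q' \<odot> y) \<longleftrightarrow> \<phi> Z' y"
    if Q: "is_product C Z K Q q q'" and \<phi>: "sub_pred C Q \<phi>" for Z Q q q' \<phi>
  proof -
    have q: "q \<in> arr C Q Z" "q' \<in> arr C Q K" using Q unfolding is_product_iff by blast+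
    obtain \<chi> where \<chi>: "\<chi> \<in> arr C Q \<Omega>" "\<And>Z x. x \<in> arr C Z Q \<Longrightarrow> \<phi> Z x \<longleftrightarrow> \<tau> Z (\<chi> \<odot> x)"
      using classify[OF \<phi>] by blast
    obtain u k where "u \<in> hom C Z E" "k \<in> hom C Q P" and k: "p \<odot> k = u \<odot> q" "p' \<odot> k = q'" "ev \<odot> k = \<chi>"
      using curry[OF Q arr_hom[OF \<chi>(1)]] by blast
    then have u: "u \<in> arr C Z E" and ka: "k \<in> arr C Q P"
      using hom_arr[OF arr_obj(2)[OF q(1)] E] hom_arr[OF arr_obj(1)[OF q(1)] arr_obj(1)[OF p]] by blast+
    have "\<epsilon> Z' (u \<odot> (q \<odot> y)) (q' \<odot> y) \<longleftrightarrow> \<phi> Z' y" if y: "y \<in> arr C Z' Q" for Z' y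
      using \<epsilon>_comp[OF ka k(1,2) y] assoc[OF y q(1) u] \<chi>(2)[OF y] k(3) by simp
    then show ?thesis using u by blast
  qed
  have ext: "u = v" if u: "u \<in> arr C Z E" and v: "v \<in> arr C Z E"
    and eq: "\<forall>Z'. \<forall>z\<in>arr C Z' Z. \<forall>k\<in>arr C Z' K. \<epsilon> Z' (u \<odot> z) k \<longleftrightarrow> \<epsilon> Z' (v \<odot> z) k" for Z u v
  proof -
    obtain Q q q' where Q: "is_product C Z K Q q q'" using product_exists[OF arr_obj(1)[OF u] K] by blast
    then have q: "q \<in> arr C Q Z" "q' \<in> arr C Q K" unfolding is_product_iff by blast+
    obtain h where h: "h \<in> arr C Q P" "p \<odot> h = u \<odot> q" "p' \<odot> h = q'" using pr_ex[OF comp_arr[OF q(1) u] q(2)] by blast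
    obtain k where k: "k \<in> arr C Q P" "p \<odot> k = v \<odot> q" "p' \<odot> k = q'" using pr_ex[OF comp_arr[OF q(1) v] q(2)] by blast
    have "ev \<odot> h = ev \<odot> k"
    proof (rule unique[OF comp_arr[OF h(1) ev] comp_arr[OF k(1) ev]], intro allI ballI)
      fix Z' y assume y: "y \<in> arr C Z' Q"
      show "\<tau> Z' ((ev \<odot> h) \<odot> y) \<longleftrightarrow> \<tau> Z' ((ev \<odot> k) \<odot> y)"
        using \<epsilon>_comp[OF h y] \<epsilon>_comp[OF k y] eq comp_arr[OF y q(1)] comp_arr[OF y q(2)]
          assoc[OF y q(1) u] assoc[OF y q(1) v] by simp
    qed
    then show ?thesis
      using curry[OF Q arr_hom[OF comp_arr[OF h(1) ev]]] arr_hom[OF u] arr_hom[OF v] arr_hom[OF h(1)]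
        arr_hom[OF k(1)] h(2,3) k(2,3) by metis
  qed
  show thesis by (rule that[OF E pull name ext])
qed

text \<open>
  Universal quantification along \<open>f\<close>: an element \<open>x\<close> of \<open>Y\<close> satisfies it iff the fibre of \<open>f\<close>
  over \<open>x\<close> and the part of this fibre where \<open>\<phi>\<close> holds have the same name.
\<close>

lemma sub_pred_forall:
  assumes topos: "topos C" and f: "f \<in> arr C K Y" and \<phi>: "sub_pred C K \<phi>"
  shows "sub_pred C Y (\<lambda>Z x. x \<in> arr C Z Y \<and> (\<forall>Z'. \<forall>z\<in>arr C Z' Z. \<forall>k\<in>arr C Z' K. f \<odot> k = x \<odot> z \<longrightarrow> \<phi> Z' k))"
proof -
  have K: "K \<in> obj C" and Y: "Y \<in> obj C" using f arr_obj by fast+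
  obtain E \<epsilon> where E: "E \<in> obj C"
    and name: "\<And>Z Q q q' \<phi>. is_product C Z K Q q q' \<Longrightarrow> sub_pred C Q \<phi> \<Longrightarrow>
      \<exists>u\<in>arr C Z E. \<forall>Z'. \<forall>y\<in>arr C Z' Q. \<epsilon> Z' (u \<odot> (q \<odot> y)) (q' \<odot> y) \<longleftrightarrow> \<phi> Z' y"
    and ext: "\<And>Z u v. u \<in> arr C Z E \<Longrightarrow> v \<in> arr C Z E \<Longrightarrow>
      \<forall>Z'. \<forall>z\<in>arr C Z' Z. \<forall>k\<in>arr C Z' K. \<epsilon> Z' (u \<odot> z) k \<longleftrightarrow> \<epsilon> Z' (v \<odot> z) k \<Longrightarrow> u = v"
    by (rule power_object[OF topos K]) (rule that)
  obtain Q q q' where Q: "is_product C Y K Q q q'" using product_exists[OF Y K] by blast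
  then have q: "q \<in> arr C Q Y" and q': "q' \<in> arr C Q K"
    and pr: "\<And>Z u v. u \<in> arr C Z Y \<Longrightarrow> v \<in> arr C Z K \<Longrightarrow> \<exists>h\<in>arr C Z Q. q \<odot> h = u \<and> q' \<odot> h = v"
    unfolding is_product_iff by blast+
  let ?\<gamma> = "\<lambda>Z y. y \<in> arr C Z Q \<and> ((f \<odot> q') \<odot> y \<in> arr C Z Y \<and> (f \<odot> q') \<odot> y = q \<odot> y)"
  have \<gamma>: "sub_pred C Q ?\<gamma>" by (rule rel_pred_pull[OF rel_pred_eq[OF Y] comp_arr[OF q' f] q])
  have \<gamma>\<phi>: "sub_pred C Q (\<lambda>Z y. ?\<gamma> Z y \<and> (y \<in> arr C Z Q \<and> \<phi> Z (q' \<odot> y)))"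
    by (rule sub_pred_conj[OF \<gamma> sub_pred_pull[OF \<phi> q']])
  obtain g where g: "g \<in> arr C Y E" "\<And>Z y. y \<in> arr C Z Q \<Longrightarrow> \<epsilon> Z (g \<odot> (q \<odot> y)) (q' \<odot> y) \<longleftrightarrow> ?\<gamma> Z y"
    using name[OF Q \<gamma>] by blast
  obtain h where h: "h \<in> arr C Y E"
    "\<And>Z y. y \<in> arr C Z Q \<Longrightarrow> \<epsilon> Z (h \<odot> (q \<odot> y)) (q' \<odot> y) \<longleftrightarrow> ?\<gamma> Z y \<and> (y \<in> arr C Z Q \<and> \<phi> Z (q' \<odot> y))"
    using name[OF Q \<gamma>\<phi>] by blast
  have \<epsilon>g: "\<epsilon> Z (g \<odot> x) k \<longleftrightarrow> f \<odot> k = x" and \<epsilon>h: "\<epsilon> Z (h \<odot> x) k \<longleftrightarrow> f \<odot> k = x \<and> \<phi> Z k"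
    if x: "x \<in> arr C Z Y" and k: "k \<in> arr C Z K" for Z x k
  proof -
    obtain y where y: "y \<in> arr C Z Q" "q \<odot> y = x" "q' \<odot> y = k" using pr[OF x k] by blast
    have "(f \<odot> q') \<odot> y = f \<odot> k" using assoc[OF y(1) q' f] y(3) by simp
    then have "?\<gamma> Z y \<longleftrightarrow> f \<odot> k = x" using y comp_arr[OF k f] by simp
    then show "\<epsilon> Z (g \<odot> x) k \<longleftrightarrow> f \<odot> k = x" "\<epsilon> Z (h \<odot> x) k \<longleftrightarrow> f \<odot> k = x \<and> \<phi> Z k"
      using g(2)[OF y(1)] h(2)[OF y(1)] y by simp_all
  qed
  show ?thesis
  proof (rule sub_pred_cong[OF rel_pred_pull[OF rel_pred_eq[OF E] g(1) h(1)]], rule conj_cong[OF refl])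
    fix Z x assume x: "x \<in> arr C Z Y"
    have ag: "(g \<odot> x) \<odot> z = g \<odot> (x \<odot> z)" "(h \<odot> x) \<odot> z = h \<odot> (x \<odot> z)" if "z \<in> arr C Z' Z" for Z' z
      using assoc[OF that x g(1)] assoc[OF that x h(1)] by simp_all
    show "(g \<odot> x \<in> arr C Z E \<and> g \<odot> x = h \<odot> x) \<longleftrightarrow> (\<forall>Z'. \<forall>z\<in>arr C Z' Z. \<forall>k\<in>arr C Z' K. f \<odot> k = x \<odot> z \<longrightarrow> \<phi> Z' k)"
    proof (intro iffI conjI allI ballI impI)
      show "g \<odot> x \<in> arr C Z E" using x g(1) by blast
      fix Z' z k assume e: "g \<odot> x \<in> arr C Z E \<and> g \<odot> x = h \<odot> x" and z: "z \<in> arr C Z' Z" and k: "k \<in> arr C Z' K"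
        and fk: "f \<odot> k = x \<odot> z"
      have "g \<odot> (x \<odot> z) = h \<odot> (x \<odot> z)" using ag[OF z] e by simp
      then show "\<phi> Z' k" using \<epsilon>g[OF comp_arr[OF z x] k] \<epsilon>h[OF comp_arr[OF z x] k] fk by simp
    next
      assume r: "\<forall>Z'. \<forall>z\<in>arr C Z' Z. \<forall>k\<in>arr C Z' K. f \<odot> k = x \<odot> z \<longrightarrow> \<phi> Z' k"
      show "g \<odot> x = h \<odot> x"
      proof (rule ext[OF comp_arr[OF x g(1)] comp_arr[OF x h(1)]], intro allI ballI)
        fix Z' z k assume z: "z \<in> arr C Z' Z" and k: "k \<in> arr C Z' K"
        show "\<epsilon> Z' ((g \<odot> x) \<odot> z) k \<longleftrightarrow> \<epsilon> Z' ((h \<odot> x) \<odot> z) k"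
          unfolding ag[OF z] \<epsilon>g[OF comp_arr[OF z x] k] \<epsilon>h[OF comp_arr[OF z x] k] using r z k by blast
      qed
    qed
  qed
qed

text \<open>Inverse image and intersection have right adjoints, so they preserve suprema.\<close>

lemma topos_chain_distributive:
  assumes topos: "topos C"
  shows "chain_distributive C"
  unfolding chain_distributive_def
proof (intro allI impI; elim conjE)
  fix W Y g A U \<beta> \<phi> Z w
  assume g: "g \<in> arr C W Y" and A: "is_chain C Y A" and U: "is_chain_sup C Y A U"
    and \<beta>: "sub_pred C W \<beta>" and \<phi>: "sub_pred C W \<phi>"
    and le: "\<forall>k Z w. \<beta> Z w \<longrightarrow> fac C (A k) Z (g \<odot> w) \<longrightarrow> \<phi> Z w"
    and w: "\<beta> Z w" "fac C U Z (g \<odot> w)"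
  have Y: "Y \<in> obj C" using g arr_obj by fast
  have A': "A k \<in> subobjects C Y" for k using A by (simp add: is_chain_def)
  from \<beta> obtain B b where "W \<in> obj C" and b: "b \<in> arr C B W"
    and "\<And>Z g h. g \<in> arr C Z B \<Longrightarrow> h \<in> arr C Z B \<Longrightarrow> b \<odot> g = b \<odot> h \<Longrightarrow> g = h"
    and \<beta>_iff: "\<And>Z x. \<beta> Z x \<longleftrightarrow> (\<exists>k\<in>arr C Z B. b \<odot> k = x)" by (rule sub_predE) (rule that)
  let ?\<psi> = "\<lambda>Z y. y \<in> arr C Z Y \<and> (\<forall>Z'. \<forall>z\<in>arr C Z' Z. \<forall>a\<in>arr C Z' B.
      (g \<odot> b) \<odot> a = y \<odot> z \<longrightarrow> (a \<in> arr C Z' B \<and> \<phi> Z' (b \<odot> a)))"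
  have \<psi>: "sub_pred C Y ?\<psi>" by (rule sub_pred_forall[OF topos comp_arr[OF b g] sub_pred_pull[OF \<phi> b]])
  have "?\<psi> X y" if y: "fac C (A i) X y" for i X y
  proof (intro conjI allI ballI impI)
    show "y \<in> arr C X Y" by (rule sub_pred_arr[OF fac_sub_pred[OF Y A'] y])
    fix Z' z a assume z: "z \<in> arr C Z' X" and a: "a \<in> arr C Z' B" and e: "(g \<odot> b) \<odot> a = y \<odot> z"
    show "a \<in> arr C Z' B" by (rule a)
    have "fac C (A i) Z' (g \<odot> (b \<odot> a))"
      using sub_pred_restrict[OF fac_sub_pred[OF Y A'] y z] e assoc[OF a b g] by simp
    then show "\<phi> Z' (b \<odot> a)" using le \<beta>_iff a by blast
  qed
  then have le': "\<forall>i Z x. fac C (A i) Z x \<longrightarrow> ?\<psi> Z x" by blast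
  have "\<forall>\<phi>. sub_pred C Y \<phi> \<longrightarrow> (\<forall>i Z x. fac C (A i) Z x \<longrightarrow> \<phi> Z x) \<longrightarrow> (\<forall>Z x. fac C U Z x \<longrightarrow> \<phi> Z x)"
    using U unfolding chain_sup_iff[OF Y A'] by (elim conjE)
  from this[THEN spec, of ?\<psi>, THEN mp, OF \<psi>, THEN mp, OF le', rule_format, OF w(2)]
  have "\<And>Z' z a. z \<in> arr C Z' Z \<Longrightarrow> a \<in> arr C Z' B \<Longrightarrow> (g \<odot> b) \<odot> a = (g \<odot> w) \<odot> z \<Longrightarrow> \<phi> Z' (b \<odot> a)" by blast
  moreover obtain a where a: "a \<in> arr C Z B" "b \<odot> a = w" using w(1) \<beta>_iff by blast
  moreover have "(g \<odot> b) \<odot> a = (g \<odot> w) \<odot> idt C Z"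
    using assoc[OF a(1) b g] a idt_right[OF comp_arr[OF comp_arr[OF a(1) b] g]] by simp
  ultimately show "\<phi> Z w" using idt_arr[OF arr_obj(1)[OF a(1)]] by blast
qed

text \<open>
  The image of \<open>f\<close> is the intersection of all subsets of \<open>Y\<close> that contain the values of \<open>f\<close>.
  The elimination rule follows by taking the subset of the elements of \<open>Y\<close> which, if equal to \<open>x\<close>,
  force \<open>\<phi>\<close>.
\<close>

lemma topos_stable_images:
  assumes topos: "topos C"
  shows "stable_images C"
  unfolding stable_images_def
proof (intro allI ballI)
  fix K Y f assume f: "f \<in> arr C K Y"
  have K: "K \<in> obj C" and Y: "Y \<in> obj C" using f arr_obj by fast+
  obtain E \<epsilon> where E: "E \<in> obj C"
    and pull: "\<And>W u k. u \<in> arr C W E \<Longrightarrow> k \<in> arr C W Y \<Longrightarrow> sub_pred C W (\<lambda>Z w. w \<in> arr C Z W \<and> \<epsilon> Z (u \<odot> w) (k \<odot> w))"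
    and name: "\<And>Z Q q q' \<phi>. is_product C Z Y Q q q' \<Longrightarrow> sub_pred C Q \<phi> \<Longrightarrow>
      \<exists>u\<in>arr C Z E. \<forall>Z'. \<forall>y\<in>arr C Z' Q. \<epsilon> Z' (u \<odot> (q \<odot> y)) (q' \<odot> y) \<longleftrightarrow> \<phi> Z' y"
    by (rule power_object[OF topos Y]) (rule that)
  obtain R r r' where "is_product C E K R r r'" using product_exists[OF E K] by blast
  then have r: "r \<in> arr C R E" and r': "r' \<in> arr C R K"
    and r_ex: "\<And>Z u v. u \<in> arr C Z E \<Longrightarrow> v \<in> arr C Z K \<Longrightarrow> \<exists>h\<in>arr C Z R. r \<odot> h = u \<and> r' \<odot> h = v"
    unfolding is_product_iff by blast+
  let ?\<alpha> = "\<lambda>Z u. u \<in> arr C Z E \<and> (\<forall>Z'. \<forall>z\<in>arr C Z' Z. \<forall>w\<in>arr C Z' R.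
      r \<odot> w = u \<odot> z \<longrightarrow> (w \<in> arr C Z' R \<and> \<epsilon> Z' (r \<odot> w) ((f \<odot> r') \<odot> w)))"
  have "sub_pred C E ?\<alpha>" by (rule sub_pred_forall[OF topos r pull[OF r comp_arr[OF r' f]]])
  then obtain A a where "E \<in> obj C" and a: "a \<in> arr C A E"
    and "\<And>Z g h. g \<in> arr C Z A \<Longrightarrow> h \<in> arr C Z A \<Longrightarrow> a \<odot> g = a \<odot> h \<Longrightarrow> g = h"
    and a_iff: "\<And>Z x. ?\<alpha> Z x \<longleftrightarrow> (\<exists>k\<in>arr C Z A. a \<odot> k = x)" by (rule sub_predE) (rule that)
  have \<alpha>: "?\<alpha> Z u \<longleftrightarrow> u \<in> arr C Z E \<and> (\<forall>Z'. \<forall>z\<in>arr C Z' Z. \<forall>k\<in>arr C Z' K. \<epsilon> Z' (u \<odot> z) (f \<odot> k))"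
    (is "_ \<longleftrightarrow> ?\<alpha>' Z u") for Z u
  proof (rule conj_cong[OF refl], intro iffI allI ballI impI conjI)
    fix Z' z k assume u: "u \<in> arr C Z E" and l: "\<forall>Z'. \<forall>z\<in>arr C Z' Z. \<forall>w\<in>arr C Z' R.
        r \<odot> w = u \<odot> z \<longrightarrow> (w \<in> arr C Z' R \<and> \<epsilon> Z' (r \<odot> w) ((f \<odot> r') \<odot> w))"
      and z: "z \<in> arr C Z' Z" and k: "k \<in> arr C Z' K"
    obtain w where w: "w \<in> arr C Z' R" "r \<odot> w = u \<odot> z" "r' \<odot> w = k" using r_ex[OF comp_arr[OF z u] k] by blast
    then have "\<epsilon> Z' (u \<odot> z) ((f \<odot> r') \<odot> w)" using l z by metis
    then show "\<epsilon> Z' (u \<odot> z) (f \<odot> k)" using assoc[OF w(1) r' f] w(3) by simp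
  next
    fix Z' z w assume l: "\<forall>Z'. \<forall>z\<in>arr C Z' Z. \<forall>k\<in>arr C Z' K. \<epsilon> Z' (u \<odot> z) (f \<odot> k)"
      and z: "z \<in> arr C Z' Z" and w: "w \<in> arr C Z' R" "r \<odot> w = u \<odot> z"
    show "w \<in> arr C Z' R" by (rule w)
    show "\<epsilon> Z' (r \<odot> w) ((f \<odot> r') \<odot> w)" using l z w assoc[OF w(1) r' f] comp_arr[OF w(1) r'] by simp
  qed
  obtain S s s' where "is_product C A Y S s s'" using product_exists[OF arr_obj(1)[OF a] Y] by blast
  then have s: "s \<in> arr C S A" and s': "s' \<in> arr C S Y"
    and s_ex: "\<And>Z u v. u \<in> arr C Z A \<Longrightarrow> v \<in> arr C Z Y \<Longrightarrow> \<exists>h\<in>arr C Z S. s \<odot> h = u \<and> s' \<odot> h = v"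
    unfolding is_product_iff by blast+
  let ?i = "\<lambda>Z x. x \<in> arr C Z Y \<and> (\<forall>Z'. \<forall>z\<in>arr C Z' Z. \<forall>w\<in>arr C Z' S.
      s' \<odot> w = x \<odot> z \<longrightarrow> (w \<in> arr C Z' S \<and> \<epsilon> Z' ((a \<odot> s) \<odot> w) (s' \<odot> w)))"
  have i_pred: "sub_pred C Y ?i" by (rule sub_pred_forall[OF topos s' pull[OF comp_arr[OF s a] s']])
  have i_f: "?i K f"
  proof (intro conjI f allI ballI impI)
    fix Z' z w assume z: "z \<in> arr C Z' K" and w: "w \<in> arr C Z' S" and e: "s' \<odot> w = f \<odot> z"
    show "w \<in> arr C Z' S" by (rule w)
    have sw: "s \<odot> w \<in> arr C Z' A" using w s by blast
    then have "?\<alpha>' Z' (a \<odot> (s \<odot> w))" using a_iff \<alpha> by blast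
    then have "\<epsilon> Z' ((a \<odot> (s \<odot> w)) \<odot> idt C Z') (f \<odot> z)" using idt_arr[OF arr_obj(1)[OF w]] z by blast
    then show "\<epsilon> Z' ((a \<odot> s) \<odot> w) (s' \<odot> w)"
      using idt_right[OF comp_arr[OF sw a]] assoc[OF w s a] e by simp
  qed
  have elim: "\<phi> Z (idt C Z)" if ix: "?i Z x" and \<phi>: "sub_pred C Z \<phi>"
    and loc: "\<forall>Z'. \<forall>z\<in>arr C Z' Z. \<forall>k\<in>arr C Z' K. f \<odot> k = x \<odot> z \<longrightarrow> \<phi> Z' z" for Z x \<phi>
  proof -
    have x: "x \<in> arr C Z Y" using ix by blast
    have Z: "Z \<in> obj C" using x arr_obj by fast
    obtain Q q q' where Q: "is_product C Z Y Q q q'" using product_exists[OF Z Y] by blast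
    then have q: "q \<in> arr C Q Z" and q': "q' \<in> arr C Q Y"
      and q_ex: "\<And>X u v. u \<in> arr C X Z \<Longrightarrow> v \<in> arr C X Y \<Longrightarrow> \<exists>h\<in>arr C X Q. q \<odot> h = u \<and> q' \<odot> h = v"
      unfolding is_product_iff by blast+
    obtain m where m: "m \<in> arr C Z Q" "q \<odot> m = idt C Z" "q' \<odot> m = x" using q_ex[OF idt_arr[OF Z] x] by blast
    let ?\<xi> = "\<lambda>X y. y \<in> arr C X Q \<and> (\<forall>X'. \<forall>z\<in>arr C X' X. \<forall>c\<in>arr C X' Z. m \<odot> c = y \<odot> z \<longrightarrow> \<phi> X' c)"
    have "sub_pred C Q ?\<xi>" by (rule sub_pred_forall[OF topos m(1) \<phi>])
    from name[OF Q this] obtain u where u1: "u \<in> arr C Z E"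
      and u_all: "\<forall>X. \<forall>y\<in>arr C X Q. \<epsilon> X (u \<odot> (q \<odot> y)) (q' \<odot> y) \<longleftrightarrow> ?\<xi> X y" by (rule bexE)
    have u2: "\<epsilon> X (u \<odot> (q \<odot> y)) (q' \<odot> y) \<longleftrightarrow> ?\<xi> X y" if "y \<in> arr C X Q" for X y
      by (rule bspec[OF spec[OF u_all] that])
    note u = u1 u2
    have "?\<alpha>' Z u"
    proof (intro conjI u(1) allI ballI)
      fix Z' z k assume z: "z \<in> arr C Z' Z" and k: "k \<in> arr C Z' K"
      obtain y where y: "y \<in> arr C Z' Q" "q \<odot> y = z" "q' \<odot> y = f \<odot> k" using q_ex[OF z comp_arr[OF k f]] by blast
      have "\<phi> X c" if t: "t \<in> arr C X Z'" and c: "c \<in> arr C X Z" and e: "m \<odot> c = y \<odot> t" for X t c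
      proof -
        have "x \<odot> c = q' \<odot> (y \<odot> t)" using assoc[OF c m(1) q'] m(3) e by simp
        also have "\<dots> = f \<odot> (k \<odot> t)" using assoc[OF t y(1) q'] assoc[OF t k f] y(3) by simp
        finally show ?thesis using loc c comp_arr[OF t k] by metis
      qed
      then have "?\<xi> Z' y" using y(1) by blast
      then show "\<epsilon> Z' (u \<odot> z) (f \<odot> k)" using u(2)[OF y(1)] y(2,3) by simp
    qed
    then have "\<exists>b\<in>arr C Z A. a \<odot> b = u" unfolding a_iff[symmetric] \<alpha> .
    then obtain b where b: "b \<in> arr C Z A" "a \<odot> b = u" by blast
    obtain w where w: "w \<in> arr C Z S" "s \<odot> w = b" "s' \<odot> w = x" using s_ex[OF b(1) x] by blast
    have "\<epsilon> Z ((a \<odot> s) \<odot> w) (s' \<odot> w)" using ix idt_arr[OF Z] w(1,3) idt_right[OF x] by metis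
    then have "\<epsilon> Z (u \<odot> (q \<odot> m)) (q' \<odot> m)" using assoc[OF w(1) s a] w(2,3) b(2) m(2,3) idt_right[OF u(1)] by simp
    then have "?\<xi> Z m" using u(2)[OF m(1)] by blast
    then show ?thesis using idt_arr[OF Z] by blast
  qed
  show "\<exists>\<iota>. sub_pred C Y \<iota> \<and> \<iota> K f \<and> (\<forall>Z x \<phi>. \<iota> Z x \<longrightarrow> sub_pred C Z \<phi> \<longrightarrow>
      (\<forall>Z'. \<forall>z\<in>arr C Z' Z. \<forall>k\<in>arr C Z' K. f \<odot> k = x \<odot> z \<longrightarrow> \<phi> Z' z) \<longrightarrow> \<phi> Z (idt C Z))"
  proof (rule exI[of _ ?i], intro conjI[OF i_pred conjI[OF i_f]] allI impI)
    fix Z x \<phi> assume a: "?i Z x" "sub_pred C Z \<phi>"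
      "\<forall>Z'. \<forall>z\<in>arr C Z' Z. \<forall>k\<in>arr C Z' K. f \<odot> k = x \<odot> z \<longrightarrow> \<phi> Z' z"
    show "\<phi> Z (idt C Z)" by (rule elim[where Z = Z and x = x and \<phi> = \<phi>, OF a])
  qed
qed

end

section \<open>Joins of congruences\<close>

definition tolerance ::
    "'f alg_theory \<Rightarrow> ('o, 'm) cat \<Rightarrow> 'o \<times> ('f \<Rightarrow> 'm) \<Rightarrow> ('o \<Rightarrow> 'm \<Rightarrow> 'm \<Rightarrow> bool) \<Rightarrow> bool" where
  "tolerance T C A \<Lambda> \<longleftrightarrow> rel_pred C (fst A) \<Lambda> \<and> compatible T C A \<Lambda> \<and>
     (\<forall>Z. \<forall>x\<in>arr C Z (fst A). \<Lambda> Z x x) \<and> (\<forall>Z x y. \<Lambda> Z x y \<longrightarrow> \<Lambda> Z y x)"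

lemma congruence_tolerance: "congruence T C A \<Phi> \<Longrightarrow> tolerance T C A \<Phi>"
  unfolding congruence_def tolerance_def by blast

lemma toleranceD:
  assumes "tolerance T C A \<Lambda>"
  shows "rel_pred C (fst A) \<Lambda>" "compatible T C A \<Lambda>" "x \<in> arr C Z (fst A) \<Longrightarrow> \<Lambda> Z x x" "\<Lambda> Z x y \<Longrightarrow> \<Lambda> Z y x"
  using assms unfolding tolerance_def by blast+

text \<open>
  The elimination rule for \<open>\<Theta> = \<Phi> ; \<Psi>\<close> says that an intermediate element exists after
  restriction, as long as a representable relation is to be proved.
\<close>

definition composite ::
    "('o, 'm) cat \<Rightarrow> 'o \<Rightarrow> ('o \<Rightarrow> 'm \<Rightarrow> 'm \<Rightarrow> bool) \<Rightarrow> ('o \<Rightarrow> 'm \<Rightarrow> 'm \<Rightarrow> bool) \<Rightarrow>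
      ('o \<Rightarrow> 'm \<Rightarrow> 'm \<Rightarrow> bool) \<Rightarrow> bool" where
  "composite C X \<Phi> \<Psi> \<Theta> \<longleftrightarrow> rel_pred C X \<Theta> \<and> (\<forall>Z x y z. \<Phi> Z x y \<longrightarrow> \<Psi> Z y z \<longrightarrow> \<Theta> Z x z) \<and>
     (\<forall>Z x z \<Xi>. \<forall>u\<in>arr C Z X. \<forall>v\<in>arr C Z X. \<Theta> Z x z \<longrightarrow> rel_pred C X \<Xi> \<longrightarrow>
        (\<forall>Z' t y. t \<in> arr C Z' Z \<longrightarrow> \<Phi> Z' (x \<odot>\<^bsub>C\<^esub> t) y \<longrightarrow> \<Psi> Z' y (z \<odot>\<^bsub>C\<^esub> t) \<longrightarrow>
           \<Xi> Z' (u \<odot>\<^bsub>C\<^esub> t) (v \<odot>\<^bsub>C\<^esub> t)) \<longrightarrow> \<Xi> Z u v)"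

lemma compositeD:
  assumes "composite C X \<Phi> \<Psi> \<Theta>"
  shows "rel_pred C X \<Theta>" "\<Phi> Z x y \<Longrightarrow> \<Psi> Z y z \<Longrightarrow> \<Theta> Z x z"
  using assms unfolding composite_def by blast+

lemma composite_elim:
  assumes "composite C X \<Phi> \<Psi> \<Theta>" "\<Theta> Z x z" "rel_pred C X \<Xi>" "u \<in> arr C Z X" "v \<in> arr C Z X"
    "\<And>Z' t y. t \<in> arr C Z' Z \<Longrightarrow> \<Phi> Z' (x \<odot>\<^bsub>C\<^esub> t) y \<Longrightarrow> \<Psi> Z' y (z \<odot>\<^bsub>C\<^esub> t) \<Longrightarrow> \<Xi> Z' (u \<odot>\<^bsub>C\<^esub> t) (v \<odot>\<^bsub>C\<^esub> t)"
  shows "\<Xi> Z u v"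
  using assms unfolding composite_def by blast

context lex_category
begin

lemma rel_pred_converse: "rel_pred C X \<Phi> \<Longrightarrow> rel_pred C X (\<lambda>Z x y. \<Phi> Z y x)"
proof -
  assume "rel_pred C X \<Phi>"
  then obtain R d0 d1 where X: "X \<in> obj C" and d: "d0 \<in> arr C R X" "d1 \<in> arr C R X"
    and mono: "\<And>Z g h. g \<in> arr C Z R \<Longrightarrow> h \<in> arr C Z R \<Longrightarrow> d0 \<odot> g = d0 \<odot> h \<Longrightarrow> d1 \<odot> g = d1 \<odot> h \<Longrightarrow> g = h"
    and iff: "\<And>Z x y. \<Phi> Z x y \<longleftrightarrow> (\<exists>k\<in>arr C Z R. d0 \<odot> k = x \<and> d1 \<odot> k = y)" by (elim rel_predE) (rule that)
  show ?thesis by (rule rel_predI[OF X d(2,1)]) (use mono in blast, use iff in auto)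
qed

lemma composite_exists:
  assumes images: "stable_images C" and \<Phi>: "rel_pred C X \<Phi>" and \<Psi>: "rel_pred C X \<Psi>"
  shows "\<exists>\<Theta>. composite C X \<Phi> \<Psi> \<Theta>"
proof -
  from \<Phi> obtain R d0 d1 where X: "X \<in> obj C" and d0: "d0 \<in> arr C R X" and d1: "d1 \<in> arr C R X"
    and "\<And>Z g h. g \<in> arr C Z R \<Longrightarrow> h \<in> arr C Z R \<Longrightarrow> d0 \<odot> g = d0 \<odot> h \<Longrightarrow> d1 \<odot> g = d1 \<odot> h \<Longrightarrow> g = h"
    and \<Phi>_iff: "\<And>Z x y. \<Phi> Z x y \<longleftrightarrow> (\<exists>k\<in>arr C Z R. d0 \<odot> k = x \<and> d1 \<odot> k = y)" by (rule rel_predE) (rule that)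
  from \<Psi> obtain S e0 e1 where "X \<in> obj C" and e0: "e0 \<in> arr C S X" and e1: "e1 \<in> arr C S X"
    and "\<And>Z g h. g \<in> arr C Z S \<Longrightarrow> h \<in> arr C Z S \<Longrightarrow> e0 \<odot> g = e0 \<odot> h \<Longrightarrow> e1 \<odot> g = e1 \<odot> h \<Longrightarrow> g = h"
    and \<Psi>_iff: "\<And>Z x y. \<Psi> Z x y \<longleftrightarrow> (\<exists>k\<in>arr C Z S. e0 \<odot> k = x \<and> e1 \<odot> k = y)" by (rule rel_predE) (rule that)
  obtain K p q where "is_pullback C R S X d1 e0 K p q" using pullback_exists[OF d1 e0] by blast
  then have p: "p \<in> arr C K R" and q: "q \<in> arr C K S" and pq: "d1 \<odot> p = e0 \<odot> q"
    and ex: "\<And>Z u v. u \<in> arr C Z R \<Longrightarrow> v \<in> arr C Z S \<Longrightarrow> d1 \<odot> u = e0 \<odot> v \<Longrightarrow> \<exists>h\<in>arr C Z K. p \<odot> h = u \<and> q \<odot> h = v"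
    unfolding is_pullback_iff by blast+
  let ?a = "d0 \<odot> p" and ?c = "e1 \<odot> q"
  have a: "?a \<in> arr C K X" and c: "?c \<in> arr C K X" using p q d0 e1 by blast+
  let ?f = "pair C X K ?a ?c"
  have f: "?f \<in> arr C K (pow_obj C X 2)" by (rule pair_arr[OF a c])
  obtain \<iota> where \<iota>: "sub_pred C (pow_obj C X 2) \<iota>" "\<iota> K ?f"
    and elim: "\<forall>Z x \<phi>. \<iota> Z x \<longrightarrow> sub_pred C Z \<phi> \<longrightarrow>
        (\<forall>Z'. \<forall>z\<in>arr C Z' Z. \<forall>k\<in>arr C Z' K. ?f \<odot> k = x \<odot> z \<longrightarrow> \<phi> Z' z) \<longrightarrow> \<phi> Z (idt C Z)"
    using images[unfolded stable_images_def, THEN spec, THEN spec, THEN bspec, OF f] by blast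
  let ?\<Theta> = "\<lambda>Z x z. x \<in> arr C Z X \<and> z \<in> arr C Z X \<and> \<iota> Z (pair C X Z x z)"
  have \<Theta>: "rel_pred C X ?\<Theta>" by (rule sub_pred_rel_pred[OF \<iota>(1) X])
  have "?\<Theta> Z x z" if xy: "\<Phi> Z x y" and yz: "\<Psi> Z y z" for Z x y z
  proof -
    obtain k where k: "k \<in> arr C Z R" "d0 \<odot> k = x" "d1 \<odot> k = y" using xy \<Phi>_iff by blast
    obtain l where l: "l \<in> arr C Z S" "e0 \<odot> l = y" "e1 \<odot> l = z" using yz \<Psi>_iff by blast
    obtain h where h: "h \<in> arr C Z K" "p \<odot> h = k" "q \<odot> h = l" using ex[OF k(1) l(1)] k(3) l(2) by auto
    have "?f \<odot> h = pair C X Z x z"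
      using pair_restrict[OF a c h(1)] assoc[OF h(1) p d0] assoc[OF h(1) q e1] h(2,3) k(2) l(3) by simp
    then have "\<iota> Z (pair C X Z x z)" using sub_pred_restrict[OF \<iota> h(1)] by simp
    then show ?thesis using rel_pred_arr[OF \<Phi> xy] rel_pred_arr[OF \<Psi> yz] by blast
  qed
  moreover have "\<Xi> Z u v" if xz: "?\<Theta> Z x z" and \<Xi>: "rel_pred C X \<Xi>" and u: "u \<in> arr C Z X" and v: "v \<in> arr C Z X"
    and loc: "\<And>Z' t y. t \<in> arr C Z' Z \<Longrightarrow> \<Phi> Z' (x \<odot> t) y \<Longrightarrow> \<Psi> Z' y (z \<odot> t) \<Longrightarrow> \<Xi> Z' (u \<odot> t) (v \<odot> t)" for Z x z \<Xi> u v
  proof -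
    let ?\<phi> = "\<lambda>Z' t. t \<in> arr C Z' Z \<and> \<Xi> Z' (u \<odot> t) (v \<odot> t)"
    have "?\<phi> Z' t" if t: "t \<in> arr C Z' Z" and k: "k \<in> arr C Z' K" and e: "?f \<odot> k = pair C X Z x z \<odot> t" for Z' t k
    proof (intro conjI t loc[OF t])
      have x: "x \<in> arr C Z X" and z: "z \<in> arr C Z X" using xz by blast+
      have "pair C X Z' (?a \<odot> k) (?c \<odot> k) = pair C X Z' (x \<odot> t) (z \<odot> t)"
        using e pair_restrict[OF a c k] pair_restrict[OF x z t] by simp
      then have eq: "?a \<odot> k = x \<odot> t" "?c \<odot> k = z \<odot> t"
        using proj_pair[OF comp_arr[OF k a] comp_arr[OF k c]] proj_pair[OF comp_arr[OF t x] comp_arr[OF t z]] by metis+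
      have pk: "p \<odot> k \<in> arr C Z' R" and qk: "q \<odot> k \<in> arr C Z' S" using k p q by blast+
      have e': "d0 \<odot> (p \<odot> k) = x \<odot> t" "e1 \<odot> (q \<odot> k) = z \<odot> t" "e0 \<odot> (q \<odot> k) = d1 \<odot> (p \<odot> k)"
        using assoc[OF k p d0] assoc[OF k q e1] assoc[OF k p d1] assoc[OF k q e0] eq pq by simp_all
      show "\<Phi> Z' (x \<odot> t) (d1 \<odot> (p \<odot> k))" unfolding \<Phi>_iff using pk e'(1) by blast
      show "\<Psi> Z' (d1 \<odot> (p \<odot> k)) (z \<odot> t)" unfolding \<Psi>_iff using qk e'(2,3) by blast
    qed
    then have "?\<phi> Z (idt C Z)"
      using elim[THEN spec, THEN spec, THEN spec, of Z "pair C X Z x z" ?\<phi>, THEN mp, THEN mp, THEN mp]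
        xz rel_pred_pull[OF \<Xi> u v] by blast
    then show ?thesis using idt_right[OF u] idt_right[OF v] by simp
  qed
  ultimately show ?thesis using \<Theta> unfolding composite_def by (intro exI[of _ ?\<Theta>]) blast
qed

text \<open>
  Compatibility of a composite: the finitely many arguments of an operation are decomposed
  one after the other, each time after a further restriction.
\<close>

lemma composite_compatible:
  assumes A: "operations T C A" and \<Theta>: "composite C (fst A) \<Phi> \<Psi> \<Theta>"
    and \<Phi>: "rel_pred C (fst A) \<Phi>" "compatible T C A \<Phi>" and \<Psi>: "rel_pred C (fst A) \<Psi>" "compatible T C A \<Psi>"
  shows "compatible T C A \<Theta>"
  unfolding compatible_def
proof (intro ballI allI impI)
  fix f Z xs zs assume f: "f \<in> ops T" and Z: "Z \<in> obj C" and e: "\<forall>i<arity T f. \<Theta> Z (xs i) (zs i)"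
  have "\<forall>i<arity T f. \<Theta> Z (xs i) (zs i) \<Longrightarrow> \<forall>i<arity T f. j \<le> i \<longrightarrow> (\<exists>y. \<Phi> Z (xs i) y \<and> \<Psi> Z y (zs i)) \<Longrightarrow>
      Z \<in> obj C \<Longrightarrow> \<Theta> Z (opr T C A f Z xs) (opr T C A f Z zs)" for j Z xs zs
  proof (induction j arbitrary: Z xs zs)
    case 0
    then obtain ys where ys: "\<forall>i<arity T f. \<Phi> Z (xs i) (ys i)" "\<forall>i<arity T f. \<Psi> Z (ys i) (zs i)" by (metis le0)
    show ?case
      by (rule compositeD(2)[OF \<Theta> compatibleD[OF \<Phi>(2) f 0(3) ys(1)] compatibleD[OF \<Psi>(2) f 0(3) ys(2)]])
  next
    case (Suc j)
    note xs = Suc.prems(1) and Z = Suc.prems(3)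
    have a: "\<forall>i<arity T f. xs i \<in> arr C Z (fst A)" "\<forall>i<arity T f. zs i \<in> arr C Z (fst A)"
      using xs rel_pred_arr[OF compositeD(1)[OF \<Theta>]] by blast+
    show ?case
    proof (cases "j < arity T f")
      case True
      show ?thesis
      proof (rule composite_elim[OF \<Theta> xs[rule_format, OF True] compositeD(1)[OF \<Theta>] opr_arr[OF A f Z a(1)] opr_arr[OF A f Z a(2)]])
        fix Z' t y assume t: "t \<in> arr C Z' Z" and y: "\<Phi> Z' (xs j \<odot> t) y" "\<Psi> Z' y (zs j \<odot> t)"
        show "\<Theta> Z' (opr T C A f Z xs \<odot> t) (opr T C A f Z zs \<odot> t)"
          unfolding opr_restrict[OF A f t a(1)] opr_restrict[OF A f t a(2)]
        proof (rule Suc.IH)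
          show "Z' \<in> obj C" using t arr_obj by fast
          show "\<forall>i<arity T f. \<Theta> Z' (xs i \<odot> t) (zs i \<odot> t)"
            using xs rel_pred_restrict[OF compositeD(1)[OF \<Theta>] _ t] by blast
          show "\<forall>i<arity T f. j \<le> i \<longrightarrow> (\<exists>y. \<Phi> Z' (xs i \<odot> t) y \<and> \<Psi> Z' y (zs i \<odot> t))"
          proof (intro allI impI)
            fix i assume i: "i < arity T f" "j \<le> i"
            show "\<exists>y. \<Phi> Z' (xs i \<odot> t) y \<and> \<Psi> Z' y (zs i \<odot> t)"
            proof (cases "i = j")
              case False
              then obtain y where "\<Phi> Z (xs i) y" "\<Psi> Z y (zs i)" using Suc.prems(2) i by fastforce
              then show ?thesis using rel_pred_restrict[OF \<Phi>(1) _ t] rel_pred_restrict[OF \<Psi>(1) _ t] by blast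
            qed (use y in blast)
          qed
        qed
      qed
    next
      case False
      show ?thesis by (rule Suc.IH[OF xs _ Z]) (use False Suc.prems(2) in auto)
    qed
  qed
  from this[of Z xs zs "arity T f", OF e _ Z] show "\<Theta> Z (opr T C A f Z xs) (opr T C A f Z zs)" by auto
qed

text \<open>
  The construction of joins iterates the passage from \<open>\<Lambda>\<close> to \<open>\<Lambda>' = \<Lambda> ; \<Phi> ; \<Lambda>\<close>.  Since \<open>\<Phi>\<close> is
  reflexive, \<open>\<Lambda>'\<close> contains \<open>\<Lambda> ; \<Lambda>\<close>, which makes the union of the iterates transitive.
\<close>

lemma tolerance_step:
  assumes images: "stable_images C" and A: "operations T C A" and \<Lambda>: "tolerance T C A \<Lambda>" and \<Phi>: "tolerance T C A \<Phi>"
  obtains \<Lambda>' where "tolerance T C A \<Lambda>'" "\<Phi> \<sqsubseteq> \<Lambda>'" "\<Lambda> \<sqsubseteq> \<Lambda>'" "\<And>Z x y z. \<Lambda> Z x y \<Longrightarrow> \<Lambda> Z y z \<Longrightarrow> \<Lambda>' Z x z"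
    "\<And>Z x z \<Xi>. \<Lambda>' Z x z \<Longrightarrow> rel_pred C (fst A) \<Xi> \<Longrightarrow>
      \<forall>Z' t b d. t \<in> arr C Z' Z \<longrightarrow> \<Lambda> Z' (x \<odot> t) b \<longrightarrow> \<Phi> Z' b d \<longrightarrow> \<Lambda> Z' d (z \<odot> t) \<longrightarrow> \<Xi> Z' (x \<odot> t) (z \<odot> t) \<Longrightarrow> \<Xi> Z x z"
proof -
  note L = toleranceD[OF \<Lambda>] and P = toleranceD[OF \<Phi>]
  obtain \<Theta> where \<Theta>: "composite C (fst A) \<Lambda> \<Phi> \<Theta>" using composite_exists[OF images L(1) P(1)] by blast
  obtain \<Lambda>' where \<Lambda>': "composite C (fst A) \<Theta> \<Lambda> \<Lambda>'" using composite_exists[OF images compositeD(1)[OF \<Theta>] L(1)] by blast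
  have intro3: "\<Lambda>' Z x z" if "\<Lambda> Z x b" "\<Phi> Z b d" "\<Lambda> Z d z" for Z x b d z
    using compositeD(2)[OF \<Lambda>' compositeD(2)[OF \<Theta> that(1,2)] that(3)] .
  have elim3: "\<Xi> Z u v" if xz: "\<Lambda>' Z x z" and \<Xi>: "rel_pred C (fst A) \<Xi>"
    and u: "u \<in> arr C Z (fst A)" and v: "v \<in> arr C Z (fst A)"
    and loc: "\<And>Z' t b d. t \<in> arr C Z' Z \<Longrightarrow> \<Lambda> Z' (x \<odot> t) b \<Longrightarrow> \<Phi> Z' b d \<Longrightarrow> \<Lambda> Z' d (z \<odot> t) \<Longrightarrow> \<Xi> Z' (u \<odot> t) (v \<odot> t)"
    for Z x z \<Xi> u v
  proof (rule composite_elim[OF \<Lambda>' xz \<Xi> u v])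
    fix Z' t d assume t: "t \<in> arr C Z' Z" and xd: "\<Theta> Z' (x \<odot> t) d" and dz: "\<Lambda> Z' d (z \<odot> t)"
    have x: "x \<in> arr C Z (fst A)" and z: "z \<in> arr C Z (fst A)"
      using rel_pred_arr[OF compositeD(1)[OF \<Lambda>'] xz] by blast+
    show "\<Xi> Z' (u \<odot> t) (v \<odot> t)"
    proof (rule composite_elim[OF \<Theta> xd \<Xi> comp_arr[OF t u] comp_arr[OF t v]])
      fix Z'' s b assume s: "s \<in> arr C Z'' Z'" and b: "\<Lambda> Z'' ((x \<odot> t) \<odot> s) b" "\<Phi> Z'' b (d \<odot> s)"
      have "\<Lambda> Z'' (d \<odot> s) ((z \<odot> t) \<odot> s)" by (rule rel_pred_restrict[OF L(1) dz s])
      then show "\<Xi> Z'' ((u \<odot> t) \<odot> s) ((v \<odot> t) \<odot> s)"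
        using loc[OF comp_arr[OF s t]] b assoc[OF s t x] assoc[OF s t z] assoc[OF s t u] assoc[OF s t v] by metis
    qed
  qed
  have "tolerance T C A \<Lambda>'"
    unfolding tolerance_def
  proof (intro conjI allI ballI impI)
    show rp: "rel_pred C (fst A) \<Lambda>'" by (rule compositeD(1)[OF \<Lambda>'])
    show "compatible T C A \<Lambda>'"
      by (rule composite_compatible[OF A \<Lambda>' compositeD(1)[OF \<Theta>] composite_compatible[OF A \<Theta> L(1,2) P(1,2)] L(1,2)])
    show "\<Lambda>' Z x x" if "x \<in> arr C Z (fst A)" for Z x by (rule intro3[OF L(3)[OF that] P(3)[OF that] L(3)[OF that]])
    fix Z x y assume xy: "\<Lambda>' Z x y"
    show "\<Lambda>' Z y x"
      by (rule elim3[OF xy rp rel_pred_arr(2)[OF rp xy] rel_pred_arr(1)[OF rp xy]])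
        (rule intro3[OF L(4) P(4) L(4)])
  qed
  moreover have "\<Phi> \<sqsubseteq> \<Lambda>'" using intro3 L(3) rel_pred_arr[OF P(1)] by blast
  moreover have trans: "\<Lambda>' Z x z" if "\<Lambda> Z x y" "\<Lambda> Z y z" for Z x y z
    using intro3[OF that(1) P(3)[OF rel_pred_arr(2)[OF L(1) that(1)]] that(2)] .
  moreover have "\<Lambda> \<sqsubseteq> \<Lambda>'" using trans L(3) rel_pred_arr(2)[OF L(1)] by blast
  moreover have "\<Xi> Z x z" if "\<Lambda>' Z x z" "rel_pred C (fst A) \<Xi>"
     "\<forall>Z' t b d. t \<in> arr C Z' Z \<longrightarrow> \<Lambda> Z' (x \<odot> t) b \<longrightarrow> \<Phi> Z' b d \<longrightarrow> \<Lambda> Z' d (z \<odot> t) \<longrightarrow> \<Xi> Z' (x \<odot> t) (z \<odot> t)" for Z x z \<Xi>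
    using elim3[OF that(1,2)] rel_pred_arr[OF compositeD(1)[OF \<Lambda>'] that(1)] that(3) by blast
  ultimately show thesis by (intro that) assumption+
qed

subsection \<open>Unions of chains of relations\<close>

text \<open>
  The union is formed in the square of \<open>X\<close>.  Statements about two coordinates of a tuple are
  treated by pulling it back along the projection of a power of \<open>X\<close> to these coordinates, which
  is a split epimorphism.
\<close>

lemma chain_union:
  fixes \<Lambda> :: "nat \<Rightarrow> 'o \<Rightarrow> 'm \<Rightarrow> 'm \<Rightarrow> bool"
  assumes sup: "has_chain_suprema C" and distrib: "chain_distributive C" and X: "X \<in> obj C"
    and \<Lambda>: "\<And>k. rel_pred C X (\<Lambda> k)" and mono: "\<And>k. \<Lambda> k \<sqsubseteq> \<Lambda> (Suc k)"
  obtains \<Sigma> where "rel_pred C X \<Sigma>" "\<And>k. \<Lambda> k \<sqsubseteq> \<Sigma>"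
    "\<And>m a b \<beta> \<phi>. a < m \<Longrightarrow> b < m \<Longrightarrow> a \<noteq> b \<Longrightarrow> sub_pred C (pow_obj C X m) \<beta> \<Longrightarrow> sub_pred C (pow_obj C X m) \<phi> \<Longrightarrow>
      \<forall>k Z w. \<beta> Z w \<longrightarrow> \<Lambda> k Z (pow_proj C X m a \<odot> w) (pow_proj C X m b \<odot> w) \<longrightarrow> \<phi> Z w \<Longrightarrow>
      \<forall>Z w. \<beta> Z w \<longrightarrow> \<Sigma> Z (pow_proj C X m a \<odot> w) (pow_proj C X m b \<odot> w) \<longrightarrow> \<phi> Z w"
proof -
  let ?P = "pow_obj C X 2" let ?p0 = "pow_proj C X 2 0" let ?p1 = "pow_proj C X 2 1"
  have P: "?P \<in> obj C" by (rule pow_obj[OF X])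
  have p: "?p0 \<in> arr C ?P X" "?p1 \<in> arr C ?P X" using pow_proj[OF X, of _ 2] by auto
  have "\<forall>k. \<exists>M. M \<in> subobjects C ?P \<and> (\<forall>Z w. fac C M Z w \<longleftrightarrow> w \<in> arr C Z ?P \<and> \<Lambda> k Z (?p0 \<odot> w) (?p1 \<odot> w))"
    using rel_pred_sub_pred[OF \<Lambda>] unfolding sub_pred_def by (metis (no_types, lifting))
  from choice[OF this] obtain M where M: "\<And>k. M k \<in> subobjects C ?P"
    and M_iff: "\<And>k Z w. fac C (M k) Z w \<longleftrightarrow> w \<in> arr C Z ?P \<and> \<Lambda> k Z (?p0 \<odot> w) (?p1 \<odot> w)" by blast
  have chain: "is_chain C ?P M"
    unfolding is_chain_def using M sub_le_iff[OF P M M] M_iff mono by simp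
  then obtain U where U: "is_chain_sup C ?P M U" using sup P unfolding has_chain_suprema_def by blast
  have U': "U \<in> subobjects C ?P" and MU: "\<And>k Z x. fac C (M k) Z x \<Longrightarrow> fac C U Z x"
    using U unfolding chain_sup_iff[OF P M] by blast+
  let ?\<Sigma> = "\<lambda>Z x y. x \<in> arr C Z X \<and> y \<in> arr C Z X \<and> fac C U Z (pair C X Z x y)"
  have "rel_pred C X ?\<Sigma>" by (rule sub_pred_rel_pred[OF fac_sub_pred[OF P U'] X])
  moreover have "\<Lambda> k \<sqsubseteq> ?\<Sigma>" for k
  proof (intro allI impI)
    fix Z x y assume xy: "\<Lambda> k Z x y"
    note a = rel_pred_arr[OF \<Lambda> xy]
    have "fac C (M k) Z (pair C X Z x y)" unfolding M_iff using pair_arr[OF a] proj_pair[OF a] xy by simp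
    then show "?\<Sigma> Z x y" using a MU by blast
  qed
  moreover have "\<forall>Z w. \<beta> Z w \<longrightarrow> ?\<Sigma> Z (pow_proj C X m a \<odot> w) (pow_proj C X m b \<odot> w) \<longrightarrow> \<phi> Z w"
    if ab: "a < m" "b < m" "a \<noteq> b" and \<beta>: "sub_pred C (pow_obj C X m) \<beta>" and \<phi>: "sub_pred C (pow_obj C X m) \<phi>"
    and le: "\<forall>k Z w. \<beta> Z w \<longrightarrow> \<Lambda> k Z (pow_proj C X m a \<odot> w) (pow_proj C X m b \<odot> w) \<longrightarrow> \<phi> Z w" for m a b \<beta> \<phi>
  proof -
    let ?W = "pow_obj C X m" let ?a = "pow_proj C X m a" let ?b = "pow_proj C X m b"
    have a: "?a \<in> arr C ?W X" and b: "?b \<in> arr C ?W X" using pow_proj[OF X] ab by blast+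
    let ?g = "pair C X ?W ?a ?b"
    have g: "?g \<in> arr C ?W ?P" by (rule pair_arr[OF a b])
    have gw: "?g \<odot> w = pair C X Z (?a \<odot> w) (?b \<odot> w)" if "w \<in> arr C Z ?W" for Z w
      by (rule pair_restrict[OF a b that])
    \<comment> \<open>The projection to two different coordinates is split: repeat the second one elsewhere.\<close>
    let ?s = "tuple C X m ?P (\<lambda>j. if j = a then ?p0 else ?p1)"
    have q: "\<forall>j<m. (if j = a then ?p0 else ?p1) \<in> arr C ?P X" using p by simp
    have s: "?s \<in> arr C ?P ?W" by (rule tuple_arr[OF X P q])
    have "?a \<odot> ?s = ?p0" "?b \<odot> ?s = ?p1"
      using proj_tuple[OF X P q ab(1)] proj_tuple[OF X P q ab(2)] ab(3) by simp_all
    then have "?g \<odot> ?s = idt C ?P"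
      using gw[OF s] pair_proj[OF X idt_arr[OF P]] idt_right[OF p(1)] idt_right[OF p(2)] by simp
    then have split: "split_epi C ?W ?P ?g" unfolding split_epi_def using arr_hom[OF g] arr_hom[OF s] by blast
    have g_iff: "fac C (M k) Z (?g \<odot> w) \<longleftrightarrow> \<Lambda> k Z (?a \<odot> w) (?b \<odot> w)" if w: "w \<in> arr C Z ?W" for k Z w
      unfolding M_iff gw[OF w] using pair_arr[OF comp_arr[OF w a] comp_arr[OF w b]] proj_pair[OF comp_arr[OF w a] comp_arr[OF w b]]
      by simp
    have "\<forall>k Z w. \<beta> Z w \<longrightarrow> fac C (M k) Z (?g \<odot> w) \<longrightarrow> \<phi> Z w"
      using le g_iff sub_pred_arr[OF \<beta>] by blast
    then have "\<forall>Z w. \<beta> Z w \<longrightarrow> fac C U Z (?g \<odot> w) \<longrightarrow> \<phi> Z w"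
      using distrib g split chain U \<beta> \<phi> unfolding chain_distributive_def by blast
    then show ?thesis using gw sub_pred_arr[OF \<beta>] by (metis (no_types, lifting))
  qed
  ultimately show thesis by (rule that)
qed

text \<open>
  Finitely many membership statements in the union can be replaced by membership in one member
  of the chain: distributivity is applied to one coordinate pair after the other.
\<close>

lemma chain_union_finite:
  fixes \<Lambda> :: "nat \<Rightarrow> 'o \<Rightarrow> 'm \<Rightarrow> 'm \<Rightarrow> bool" and n :: nat
  assumes X: "X \<in> obj C" and \<Lambda>: "\<And>k. rel_pred C X (\<Lambda> k)" and mono: "\<And>k. \<Lambda> k \<sqsubseteq> \<Lambda> (Suc k)"
    and \<Sigma>: "rel_pred C X \<Sigma>"
    and distrib: "\<And>m a b \<beta> \<phi>. a < m \<Longrightarrow> b < m \<Longrightarrow> a \<noteq> b \<Longrightarrow> sub_pred C (pow_obj C X m) \<beta> \<Longrightarrow> sub_pred C (pow_obj C X m) \<phi> \<Longrightarrow>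
      \<forall>k Z w. \<beta> Z w \<longrightarrow> \<Lambda> k Z (pow_proj C X m a \<odot> w) (pow_proj C X m b \<odot> w) \<longrightarrow> \<phi> Z w \<Longrightarrow>
      \<forall>Z w. \<beta> Z w \<longrightarrow> \<Sigma> Z (pow_proj C X m a \<odot> w) (pow_proj C X m b \<odot> w) \<longrightarrow> \<phi> Z w"
    and ab: "\<And>i. i < n \<Longrightarrow> a i < m \<and> b i < m \<and> a i \<noteq> (b i :: nat)" and \<phi>: "sub_pred C (pow_obj C X m) \<phi>"
    and le: "\<And>k Z w. w \<in> arr C Z (pow_obj C X m) \<Longrightarrow>
      (\<And>i. i < n \<Longrightarrow> \<Lambda> k Z (pow_proj C X m (a i) \<odot> w) (pow_proj C X m (b i) \<odot> w)) \<Longrightarrow> \<phi> Z w"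
    and w: "w \<in> arr C Z (pow_obj C X m)" "\<And>i. i < n \<Longrightarrow> \<Sigma> Z (pow_proj C X m (a i) \<odot> w) (pow_proj C X m (b i) \<odot> w)"
  shows "\<phi> Z w"
proof -
  let ?W = "pow_obj C X m" let ?\<pi> = "pow_proj C X m"
  have mono': "\<Lambda> k \<sqsubseteq> \<Lambda> l" if "k \<le> l" for k l
    using that by (induction l rule: dec_induct) (use mono in auto)
  have "\<forall>k Z w. w \<in> arr C Z ?W \<longrightarrow> (\<forall>i<n. if i < j then \<Sigma> Z (?\<pi> (a i) \<odot> w) (?\<pi> (b i) \<odot> w)
      else \<Lambda> k Z (?\<pi> (a i) \<odot> w) (?\<pi> (b i) \<odot> w)) \<longrightarrow> \<phi> Z w" for j
  proof (induction j)
    case 0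
    show ?case using le by (simp, blast)
  next
    case (Suc j)
    show ?case
    proof (cases "j < n")
      case False
      then have "i < Suc j \<longleftrightarrow> i < j" if "i < n" for i using that by linarith
      then show ?thesis using Suc by simp
    next
      case True
      show ?thesis
      proof (intro allI impI)
        fix k Z w assume w: "w \<in> arr C Z ?W" and h: "\<forall>i<n. if i < Suc j then \<Sigma> Z (?\<pi> (a i) \<odot> w) (?\<pi> (b i) \<odot> w)
          else \<Lambda> k Z (?\<pi> (a i) \<odot> w) (?\<pi> (b i) \<odot> w)"
        let ?c = "\<lambda>i Z w. w \<in> arr C Z ?W \<and> (if i < j then \<Sigma> Z (?\<pi> (a i) \<odot> w) (?\<pi> (b i) \<odot> w)
          else if i = j then True else \<Lambda> k Z (?\<pi> (a i) \<odot> w) (?\<pi> (b i) \<odot> w))"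
        have c: "sub_pred C ?W (?c i)" if i: "i < n" for i
        proof -
          have \<pi>: "?\<pi> (a i) \<in> arr C ?W X" "?\<pi> (b i) \<in> arr C ?W X" using ab[OF i] pow_proj[OF X] by blast+
          consider "i < j" | "i = j" | "j < i" by linarith
          then show ?thesis
            using rel_pred_pull[OF \<Sigma> \<pi>] sub_pred_true[OF pow_obj[OF X, of m]] rel_pred_pull[OF \<Lambda>[of k] \<pi>] by cases simp_all
        qed
        have \<beta>: "sub_pred C ?W (\<lambda>Z w. w \<in> arr C Z ?W \<and> (\<forall>i<n. ?c i Z w))"
          by (rule sub_pred_all[OF pow_obj[OF X] c])
        have abj: "a j < m" "b j < m" "a j \<noteq> b j" using ab[OF True] by auto
        have "\<phi> Z w" if "w \<in> arr C Z ?W \<and> (\<forall>i<n. ?c i Z w)" "\<Lambda> l Z (?\<pi> (a j) \<odot> w) (?\<pi> (b j) \<odot> w)" for l Z w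
        proof -
          have "if i < j then \<Sigma> Z (?\<pi> (a i) \<odot> w) (?\<pi> (b i) \<odot> w)
              else \<Lambda> (max k l) Z (?\<pi> (a i) \<odot> w) (?\<pi> (b i) \<odot> w)" if "i < n" for i
            using \<open>_ \<and> (\<forall>i<n. ?c i Z w)\<close> \<open>\<Lambda> l Z _ _\<close> mono'[of k "max k l"] mono'[of l "max k l"] \<open>i < n\<close>
            by (cases "i = j") auto
          then show ?thesis using Suc that(1) by blast
        qed
        then have "\<forall>k Z w. w \<in> arr C Z ?W \<and> (\<forall>i<n. ?c i Z w) \<longrightarrow> \<Lambda> k Z (?\<pi> (a j) \<odot> w) (?\<pi> (b j) \<odot> w) \<longrightarrow> \<phi> Z w"
          by blast
        from distrib[OF abj \<beta> \<phi> this]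
        have "w \<in> arr C Z ?W \<and> (\<forall>i<n. ?c i Z w) \<longrightarrow> \<Sigma> Z (?\<pi> (a j) \<odot> w) (?\<pi> (b j) \<odot> w) \<longrightarrow> \<phi> Z w" by blast
        moreover have "\<forall>i<n. ?c i Z w" using h w by (metis less_Suc_eq)
        moreover have "\<Sigma> Z (?\<pi> (a j) \<odot> w) (?\<pi> (b j) \<odot> w)" using h True by auto
        ultimately show "\<phi> Z w" using w by blast
      qed
    qed
  qed
  from this[of n] show ?thesis using w by simp
qed

end

context algebras_in_lex_category
begin

text \<open>
  The join of \<open>\<Phi>\<close> and \<open>\<Psi>\<close> is the union of the chain \<open>\<Psi> \<sqsubseteq> \<Psi> ; \<Phi> ; \<Psi> \<sqsubseteq> \<dots>\<close>, in which every
  relation \<open>\<Lambda>\<close> is followed by \<open>\<Lambda> ; \<Phi> ; \<Lambda>\<close>.  Since intersection distributes over this union,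
  properties of the part of the join below \<open>\<Gamma>\<close> can be proved by induction along the chain.
\<close>

lemma join_exists:
  assumes images: "stable_images C" and sup: "has_chain_suprema C" and distrib: "chain_distributive C"
    and A: "A \<in> internal_algebras T C" and \<Phi>: "congruence T C A \<Phi>" and \<Psi>: "congruence T C A \<Psi>"
  obtains J where "congruence_join T C A \<Phi> \<Psi> J"
    "\<And>\<Gamma> \<Xi>. rel_pred C (fst A) \<Gamma> \<Longrightarrow> rel_pred C (fst A) \<Xi> \<Longrightarrow> \<Psi> \<sqinter> \<Gamma> \<sqsubseteq> \<Xi> \<Longrightarrow>
      \<forall>\<Lambda>. tolerance T C A \<Lambda> \<longrightarrow> \<Lambda> \<sqsubseteq> J \<longrightarrow> \<Lambda> \<sqinter> \<Gamma> \<sqsubseteq> \<Xi> \<longrightarrow>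
        (\<forall>Z x b d y. \<Lambda> Z x b \<longrightarrow> \<Phi> Z b d \<longrightarrow> \<Lambda> Z d y \<longrightarrow> \<Gamma> Z x y \<longrightarrow> \<Xi> Z x y) \<Longrightarrow> J \<sqinter> \<Gamma> \<sqsubseteq> \<Xi>"
proof -
  note oA = algebra_operations[OF A]
  have X: "fst A \<in> obj C" by (rule operations_obj[OF oA])
  let ?X = "fst A"
  define st where "st L L' \<longleftrightarrow> tolerance T C A L' \<and> \<Phi> \<sqsubseteq> L' \<and> L \<sqsubseteq> L' \<and> (\<forall>Z x y z. L Z x y \<longrightarrow> L Z y z \<longrightarrow> L' Z x z) \<and>
    (\<forall>Z x z \<Xi>. L' Z x z \<longrightarrow> rel_pred C ?X \<Xi> \<longrightarrow>
      (\<forall>Z' t b d. t \<in> arr C Z' Z \<longrightarrow> L Z' (x \<odot> t) b \<longrightarrow> \<Phi> Z' b d \<longrightarrow> L Z' d (z \<odot> t) \<longrightarrow> \<Xi> Z' (x \<odot> t) (z \<odot> t)) \<longrightarrow> \<Xi> Z x z)"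
    for L L'
  have st_ex: "\<exists>L'. st L L'" if L: "tolerance T C A L" for L
  proof -
    obtain L' where s: "tolerance T C A L'" "\<Phi> \<sqsubseteq> L'" "L \<sqsubseteq> L'" "\<And>Z x y z. L Z x y \<Longrightarrow> L Z y z \<Longrightarrow> L' Z x z"
      and e: "\<And>Z x z \<Xi>. L' Z x z \<Longrightarrow> rel_pred C ?X \<Xi> \<Longrightarrow>
        \<forall>Z' t b d. t \<in> arr C Z' Z \<longrightarrow> L Z' (x \<odot> t) b \<longrightarrow> \<Phi> Z' b d \<longrightarrow> L Z' d (z \<odot> t) \<longrightarrow> \<Xi> Z' (x \<odot> t) (z \<odot> t) \<Longrightarrow> \<Xi> Z x z"
      by (rule tolerance_step[OF images oA L congruence_tolerance[OF \<Phi>]]) (rule that)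
    have "st L L'"
      unfolding st_def by (rule conjI[OF s(1) conjI[OF s(2) conjI[OF s(3)]]]) (use s(4) e in blast)
    then show ?thesis by blast
  qed
  define \<Lambda> where "\<Lambda> = rec_nat \<Psi> (\<lambda>_ L. SOME L'. st L L')"
  have \<Lambda>0: "\<Lambda> 0 = \<Psi>" and \<Lambda>Suc: "\<Lambda> (Suc k) = (SOME L'. st (\<Lambda> k) L')" for k
    by (simp_all add: \<Lambda>_def)
  have tol: "tolerance T C A (\<Lambda> k)" for k
  proof (induction k)
    case 0
    show ?case unfolding \<Lambda>0 by (rule congruence_tolerance[OF \<Psi>])
  next
    case (Suc k)
    have "st (\<Lambda> k) (\<Lambda> (Suc k))" unfolding \<Lambda>Suc by (rule someI_ex[OF st_ex[OF Suc]])
    then show ?case unfolding st_def by (rule conjunct1)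
  qed
  have st: "st (\<Lambda> k) (\<Lambda> (Suc k))" for k unfolding \<Lambda>Suc by (rule someI_ex[OF st_ex[OF tol]])
  note st1 = st[unfolded st_def, THEN conjunct2] note st2 = st1[THEN conjunct2] note st3 = st2[THEN conjunct2]
  note \<Phi>\<Lambda> = st1[THEN conjunct1] and mono = st2[THEN conjunct1]
  have \<Lambda>trans: "\<And>k Z x y z. \<Lambda> k Z x y \<Longrightarrow> \<Lambda> k Z y z \<Longrightarrow> \<Lambda> (Suc k) Z x z"
    using st3[THEN conjunct1] by blast
  note \<Lambda>elim = st3[THEN conjunct2, THEN spec, THEN spec, THEN spec, THEN spec, THEN mp, THEN mp, THEN mp]
  note \<Lambda> = toleranceD[OF tol]
  obtain J where J: "rel_pred C ?X J" and \<Lambda>J: "\<And>k. \<Lambda> k \<sqsubseteq> J"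
    and distr: "\<And>m a b \<beta> \<phi>. a < m \<Longrightarrow> b < m \<Longrightarrow> a \<noteq> b \<Longrightarrow> sub_pred C (pow_obj C ?X m) \<beta> \<Longrightarrow> sub_pred C (pow_obj C ?X m) \<phi> \<Longrightarrow>
      \<forall>k Z w. \<beta> Z w \<longrightarrow> \<Lambda> k Z (pow_proj C ?X m a \<odot> w) (pow_proj C ?X m b \<odot> w) \<longrightarrow> \<phi> Z w \<Longrightarrow>
      \<forall>Z w. \<beta> Z w \<longrightarrow> J Z (pow_proj C ?X m a \<odot> w) (pow_proj C ?X m b \<odot> w) \<longrightarrow> \<phi> Z w"
    by (rule chain_union[where \<Lambda> = \<Lambda>, OF sup distrib X]) (rule \<Lambda>(1), rule mono, rule that)
  have finite: "\<phi> Z w"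
    if ab: "\<And>i. i < n \<Longrightarrow> a i < m \<and> b i < m \<and> a i \<noteq> (b i :: nat)" and \<phi>: "sub_pred C (pow_obj C ?X m) \<phi>"
      and le: "\<And>k Z w. w \<in> arr C Z (pow_obj C ?X m) \<Longrightarrow>
        (\<And>i. i < n \<Longrightarrow> \<Lambda> k Z (pow_proj C ?X m (a i) \<odot> w) (pow_proj C ?X m (b i) \<odot> w)) \<Longrightarrow> \<phi> Z w"
      and w: "w \<in> arr C Z (pow_obj C ?X m)" "\<And>i. i < n \<Longrightarrow> J Z (pow_proj C ?X m (a i) \<odot> w) (pow_proj C ?X m (b i) \<odot> w)"
    for n :: nat and a m b \<phi> Z w
  proof (rule chain_union_finite[where \<Lambda> = \<Lambda> and \<Sigma> = J and X = ?X and m = m and a = a and b = b and n = n])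
    fix m a b \<beta> \<phi> assume "a < m" "b < m" "a \<noteq> b" "sub_pred C (pow_obj C ?X m) \<beta>" "sub_pred C (pow_obj C ?X m) \<phi>"
      "\<forall>k Z w. \<beta> Z w \<longrightarrow> \<Lambda> k Z (pow_proj C ?X m a \<odot> w) (pow_proj C ?X m b \<odot> w) \<longrightarrow> \<phi> Z w"
    then show "\<forall>Z w. \<beta> Z w \<longrightarrow> J Z (pow_proj C ?X m a \<odot> w) (pow_proj C ?X m b \<odot> w) \<longrightarrow> \<phi> Z w" by (rule distr)
  qed (fact X, fact \<Lambda>(1), fact mono, fact J, fact ab, fact \<phi>, fact le, fact w(1), fact w(2))
  have proj: "pow_proj C ?X m i \<in> arr C (pow_obj C ?X m) ?X" if "i < m" for i m by (rule pow_proj[OF X that])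
  have below: "J \<sqinter> \<Gamma> \<sqsubseteq> \<Xi>" if \<Gamma>: "rel_pred C ?X \<Gamma>" and \<Xi>: "rel_pred C ?X \<Xi>" and le: "\<And>k. \<Lambda> k \<sqinter> \<Gamma> \<sqsubseteq> \<Xi>" for \<Gamma> \<Xi>
  proof (intro allI impI)
    fix Z x y assume xy: "J Z x y \<and> \<Gamma> Z x y"
    have x: "x \<in> arr C Z ?X" and y: "y \<in> arr C Z ?X" using rel_pred_arr[OF J] xy by blast+
    let ?W = "pow_obj C ?X 2" let ?p0 = "pow_proj C ?X 2 0" let ?p1 = "pow_proj C ?X 2 1"
    have "\<forall>k Z w. w \<in> arr C Z ?W \<and> \<Gamma> Z (?p0 \<odot> w) (?p1 \<odot> w) \<longrightarrow> \<Lambda> k Z (?p0 \<odot> w) (?p1 \<odot> w) \<longrightarrow>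
        w \<in> arr C Z ?W \<and> \<Xi> Z (?p0 \<odot> w) (?p1 \<odot> w)" using le by blast
    from distr[OF _ _ _ rel_pred_sub_pred[OF \<Gamma>] rel_pred_sub_pred[OF \<Xi>] this,
        THEN spec[where x = Z], THEN spec[where x = "pair C ?X Z x y"]]
    have "\<Xi> Z (?p0 \<odot> pair C ?X Z x y) (?p1 \<odot> pair C ?X Z x y)"
      using xy pair_arr[OF x y] proj_pair[OF x y] by simp
    then show "\<Xi> Z x y" using proj_pair[OF x y] by simp
  qed
  have ind: "J \<sqinter> \<Gamma> \<sqsubseteq> \<Xi>" if \<Gamma>: "rel_pred C ?X \<Gamma>" and \<Xi>: "rel_pred C ?X \<Xi>" and base: "\<Psi> \<sqinter> \<Gamma> \<sqsubseteq> \<Xi>"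
    and step: "\<forall>\<Lambda>. tolerance T C A \<Lambda> \<longrightarrow> \<Lambda> \<sqsubseteq> J \<longrightarrow> \<Lambda> \<sqinter> \<Gamma> \<sqsubseteq> \<Xi> \<longrightarrow>
        (\<forall>Z x b d y. \<Lambda> Z x b \<longrightarrow> \<Phi> Z b d \<longrightarrow> \<Lambda> Z d y \<longrightarrow> \<Gamma> Z x y \<longrightarrow> \<Xi> Z x y)" for \<Gamma> \<Xi>
  proof (rule below[OF \<Gamma> \<Xi>])
    show "\<Lambda> k \<sqinter> \<Gamma> \<sqsubseteq> \<Xi>" for k
    proof (induction k)
      case 0
      then show ?case using base unfolding \<Lambda>0 .
    next
      case (Suc k)
      have s: "\<Xi> Z x y" if "\<Lambda> k Z x b" "\<Phi> Z b d" "\<Lambda> k Z d y" "\<Gamma> Z x y" for Z x b d y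
        using step tol[of k] \<Lambda>J[of k] Suc that by blast
      show ?case
      proof (intro allI impI)
        fix Z x y assume xy: "\<Lambda> (Suc k) Z x y \<and> \<Gamma> Z x y"
        show "\<Xi> Z x y"
          by (rule \<Lambda>elim[OF conjunct1[OF xy] \<Xi>]) (use s rel_pred_restrict[OF \<Gamma> conjunct2[OF xy]] in blast)
      qed
    qed
  qed
  have "congruence T C A J"
    unfolding congruence_def
  proof (intro conjI allI ballI impI)
    show "rel_pred C ?X J" by (rule J)
    show "J Z x x" if "x \<in> arr C Z ?X" for Z x using \<Lambda>(3)[OF that, of 0] \<Lambda>J by blast
    have "J \<sqinter> J \<sqsubseteq> (\<lambda>Z x y. J Z y x)"
      by (rule below[OF J rel_pred_converse[OF J]]) (use \<Lambda>(4) \<Lambda>J in blast)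
    then show "J Z y x" if "J Z x y" for Z x y using that by blast
    {
      fix Z x y z assume xy: "J Z x y" and yz: "J Z y z"
      let ?W = "pow_obj C ?X 3" let ?p = "pow_proj C ?X 3" let ?q = "\<lambda>i::nat. if i = 0 then x else if i = 1 then y else z"
      have q: "\<forall>i<3. ?q i \<in> arr C Z ?X" using rel_pred_arr[OF J xy] rel_pred_arr[OF J yz] by simp
      have Z: "Z \<in> obj C" using q arr_obj by fastforce
      have "tuple C ?X 3 Z ?q \<in> arr C Z ?W \<and> J Z (?p 0 \<odot> tuple C ?X 3 Z ?q) (?p 2 \<odot> tuple C ?X 3 Z ?q)"
      proof (rule finite[of 2 "\<lambda>i. i" 3 Suc "\<lambda>Z w. w \<in> arr C Z ?W \<and> J Z (?p 0 \<odot> w) (?p 2 \<odot> w)"])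
        show "sub_pred C ?W (\<lambda>Z w. w \<in> arr C Z ?W \<and> J Z (?p 0 \<odot> w) (?p 2 \<odot> w))"
          by (rule rel_pred_pull[OF J]) (simp_all add: proj)
        show "tuple C ?X 3 Z ?q \<in> arr C Z ?W" by (rule tuple_arr[OF X Z q])
        show "J Z (?p i \<odot> tuple C ?X 3 Z ?q) (?p (Suc i) \<odot> tuple C ?X 3 Z ?q)" if "i < 2" for i
          using that xy yz proj_tuple[OF X Z q, of i] proj_tuple[OF X Z q, of "Suc i"] by (auto simp: less_2_cases_iff)
        fix k Z w assume w: "w \<in> arr C Z ?W" and l: "\<And>i. i < 2 \<Longrightarrow> \<Lambda> k Z (?p i \<odot> w) (?p (Suc i) \<odot> w)"
        have "\<Lambda> (Suc k) Z (?p 0 \<odot> w) (?p 2 \<odot> w)"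
          by (rule \<Lambda>trans[of _ _ _ "?p 1 \<odot> w"]) (use l[of 0] l[of 1] in \<open>simp_all add: numeral_2_eq_2\<close>)
        then show "w \<in> arr C Z ?W \<and> J Z (?p 0 \<odot> w) (?p 2 \<odot> w)" using w \<Lambda>J by blast
      qed simp
      then show "J Z x z" using proj_tuple[OF X Z q, of 0] proj_tuple[OF X Z q, of 2] by simp
    }
    show "compatible T C A J"
      unfolding compatible_def
    proof (intro ballI allI impI)
      fix f Z xs ys assume f: "f \<in> ops T" and Z: "Z \<in> obj C" and e: "\<forall>i<arity T f. J Z (xs i) (ys i)"
      let ?n = "arity T f" let ?W = "pow_obj C ?X (2 * ?n)" let ?p = "pow_proj C ?X (2 * ?n)"
      let ?q = "\<lambda>j. if j < ?n then xs j else ys (j - ?n)" let ?w = "tuple C ?X (2 * ?n) Z ?q"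
      let ?u = "opr T C A f ?W ?p" let ?v = "opr T C A f ?W (\<lambda>i. ?p (?n + i))"
      have W: "?W \<in> obj C" by (rule pow_obj[OF X])
      have a: "\<forall>i<?n. xs i \<in> arr C Z ?X" "\<forall>i<?n. ys i \<in> arr C Z ?X" using e rel_pred_arr[OF J] by blast+
      then have q: "\<forall>j<2 * ?n. ?q j \<in> arr C Z ?X" by simp
      have p: "\<forall>i<?n. ?p i \<in> arr C ?W ?X" "\<forall>i<?n. ?p (?n + i) \<in> arr C ?W ?X" using proj by simp_all
      have uv: "?u \<in> arr C ?W ?X" "?v \<in> arr C ?W ?X" using opr_arr[OF oA f W p(1)] opr_arr[OF oA f W p(2)] .
      have uv_comp: "?u \<odot> w = opr T C A f Z (\<lambda>i. ?p i \<odot> w)" "?v \<odot> w = opr T C A f Z (\<lambda>i. ?p (?n + i) \<odot> w)"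
        if w: "w \<in> arr C Z ?W" for Z w
        using opr_restrict[OF oA f w p(1)] opr_restrict[OF oA f w p(2)] .
      have w: "?w \<in> arr C Z ?W" by (rule tuple_arr[OF X Z q])
      have pw: "?p i \<odot> ?w = xs i" "?p (?n + i) \<odot> ?w = ys i" if "i < ?n" for i
        using proj_tuple[OF X Z q, of i] proj_tuple[OF X Z q, of "?n + i"] that by simp_all
      have "?w \<in> arr C Z ?W \<and> J Z (?u \<odot> ?w) (?v \<odot> ?w)"
      proof (rule finite[of ?n "\<lambda>i. i" "2 * ?n" "\<lambda>i. ?n + i" "\<lambda>Z w. w \<in> arr C Z ?W \<and> J Z (?u \<odot> w) (?v \<odot> w)"])
        show "sub_pred C ?W (\<lambda>Z w. w \<in> arr C Z ?W \<and> J Z (?u \<odot> w) (?v \<odot> w))" by (rule rel_pred_pull[OF J uv])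
        show "?w \<in> arr C Z ?W" by (rule w)
        show "J Z (?p i \<odot> ?w) (?p (?n + i) \<odot> ?w)" if "i < ?n" for i using pw[OF that] e that by simp
        fix k Z w assume w: "w \<in> arr C Z ?W" and l: "\<And>i. i < ?n \<Longrightarrow> \<Lambda> k Z (?p i \<odot> w) (?p (?n + i) \<odot> w)"
        have "\<Lambda> k Z (?u \<odot> w) (?v \<odot> w)"
          unfolding uv_comp[OF w] by (rule compatibleD[OF \<Lambda>(2) f arr_obj(1)[OF w]]) (use l in simp)
        then show "w \<in> arr C Z ?W \<and> J Z (?u \<odot> w) (?v \<odot> w)" using w \<Lambda>J by blast
      qed simp
      then have "J Z (opr T C A f Z (\<lambda>i. ?p i \<odot> ?w)) (opr T C A f Z (\<lambda>i. ?p (?n + i) \<odot> ?w))"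
        unfolding uv_comp[OF w] by blast
      moreover have "opr T C A f Z (\<lambda>i. ?p i \<odot> ?w) = opr T C A f Z xs"
        "opr T C A f Z (\<lambda>i. ?p (?n + i) \<odot> ?w) = opr T C A f Z ys"
        by (rule opr_cong[OF oA], simp add: pw)+
      ultimately show "J Z (opr T C A f Z xs) (opr T C A f Z ys)" by simp
    qed
  qed
  moreover have "\<Phi> \<sqsubseteq> J" "\<Psi> \<sqsubseteq> J" using \<Phi>\<Lambda> \<Lambda>J \<Lambda>0 by metis+
  moreover have "J \<sqsubseteq> J'" if J': "congruence T C A J'" and le: "\<Phi> \<sqsubseteq> J'" "\<Psi> \<sqsubseteq> J'" for J'
  proof -
    have "J \<sqinter> J \<sqsubseteq> J'"
    proof (rule ind[OF J congruenceD(1)[OF J']])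
      show "\<Psi> \<sqinter> J \<sqsubseteq> J'" using le by blast
      show "\<forall>\<Lambda>. tolerance T C A \<Lambda> \<longrightarrow> \<Lambda> \<sqsubseteq> J \<longrightarrow> \<Lambda> \<sqinter> J \<sqsubseteq> J' \<longrightarrow>
        (\<forall>Z x b d y. \<Lambda> Z x b \<longrightarrow> \<Phi> Z b d \<longrightarrow> \<Lambda> Z d y \<longrightarrow> J Z x y \<longrightarrow> J' Z x y)"
      proof (intro allI impI)
        fix \<Lambda> Z x b d y assume h: "\<Lambda> \<sqsubseteq> J" "\<Lambda> \<sqinter> J \<sqsubseteq> J'" and xb: "\<Lambda> Z x b" and bd: "\<Phi> Z b d" and dy: "\<Lambda> Z d y"
        have "J' Z x b" "J' Z b d" "J' Z d y" using h xb bd dy le(1) by blast+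
        then show "J' Z x y" using congruenceD(5)[OF J'] by blast
      qed
    qed
    then show ?thesis by blast
  qed
  ultimately have "congruence_join T C A \<Phi> \<Psi> J" unfolding congruence_join_def by blast
  then show thesis using that ind by blast
qed

end

section \<open>Equational logic\<close>

primrec subst :: "(nat \<Rightarrow> 'f trm) \<Rightarrow> 'f trm \<Rightarrow> 'f trm" where
  "subst \<sigma> (Var i) = \<sigma> i"
| "subst \<sigma> (App f ts) = App f (map (subst \<sigma>) ts)"

text \<open>
  Birkhoff's calculus for terms in the variables \<open>0, \<dots>, n - 1\<close>.  No other variables may occur in
  a derivation: as algebras may be empty, an additional variable need not have a value.
\<close>

inductive derivable :: "'f alg_theory \<Rightarrow> nat \<Rightarrow> 'f trm \<Rightarrow> 'f trm \<Rightarrow> bool" for T n where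
  refl: "wf_trm T n t \<Longrightarrow> derivable T n t t"
| sym: "derivable T n s t \<Longrightarrow> derivable T n t s"
| trans: "derivable T n s t \<Longrightarrow> derivable T n t u \<Longrightarrow> derivable T n s u"
| app: "f \<in> ops T \<Longrightarrow> length ss = arity T f \<Longrightarrow> length ts = arity T f \<Longrightarrow>
    (\<And>i. i < arity T f \<Longrightarrow> derivable T n (ss ! i) (ts ! i)) \<Longrightarrow> derivable T n (App f ss) (App f ts)"
| ax: "(k, s, t) \<in> axioms T \<Longrightarrow> (\<And>i. i < k \<Longrightarrow> wf_trm T n (\<sigma> i)) \<Longrightarrow> derivable T n (subst \<sigma> s) (subst \<sigma> t)"

lemma wf_subst: "wf_trm T k t \<Longrightarrow> (\<And>i. i < k \<Longrightarrow> wf_trm T n (\<sigma> i)) \<Longrightarrow> wf_trm T n (subst \<sigma> t)"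
  by (induction t) auto

lemma subst_subst: "subst \<tau> (subst \<sigma> t) = subst (\<lambda>i. subst \<tau> (\<sigma> i)) t"
  by (induction t) auto

lemma subst_cong: "wf_trm T k t \<Longrightarrow> (\<And>i. i < k \<Longrightarrow> \<sigma> i = \<tau> i) \<Longrightarrow> subst \<sigma> t = subst \<tau> t"
  by (induction t) auto

lemma derivable_wf:
  assumes "algebraic_theory T"
  shows "derivable T n s t \<Longrightarrow> wf_trm T n s \<and> wf_trm T n t"
proof (induction rule: derivable.induct)
  case (app f ss ts)
  then show ?case by (auto simp: in_set_conv_nth)
next
  case (ax k s t \<sigma>)
  then have "wf_trm T k s" "wf_trm T k t" using assms by (auto simp: algebraic_theory_def)
  then show ?case using ax wf_subst by blast
qed auto

lemma derivable_subst:
  assumes T: "algebraic_theory T" and d: "derivable T k s t" and \<sigma>: "\<And>i. i < k \<Longrightarrow> wf_trm T n (\<sigma> i)"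
  shows "derivable T n (subst \<sigma> s) (subst \<sigma> t)"
  using d
proof (induction rule: derivable.induct)
  case (refl t)
  then show ?case by (intro derivable.refl wf_subst \<sigma>)
next
  case (app f ss ts)
  then show ?case by (auto intro: derivable.app)
next
  case (ax m s t \<tau>)
  show ?case
    unfolding subst_subst by (rule derivable.ax[OF ax(1)]) (rule wf_subst[OF ax(2)], assumption, rule \<sigma>)
qed (auto intro: derivable.sym derivable.trans)

context algebras_in_lex_category
begin

lemma evl_subst: "evl C A Z xs (subst \<sigma> t) = evl C A Z (\<lambda>i. evl C A Z xs (\<sigma> i)) t"
  by (induction t) (auto intro!: arg_cong[of _ _ "cmp C _"] tuple_cong)

lemma evl_cong:
  "wf_trm T k t \<Longrightarrow> (\<And>i. i < k \<Longrightarrow> xs i = ys i) \<Longrightarrow> evl C A Z xs t = evl C A Z ys t"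
  by (induction t) (auto intro!: arg_cong[of _ _ "cmp C _"] tuple_cong)

lemma derivable_sound:
  assumes A: "A \<in> internal_algebras T C" and Z: "Z \<in> obj C" and d: "derivable T n s t"
    and xs: "\<forall>i<n. xs i \<in> arr C Z (fst A)"
  shows "evl C A Z xs s = evl C A Z xs t"
  using d
proof (induction rule: derivable.induct)
  case (app f ss ts)
  then show ?case by (auto intro!: arg_cong[of _ _ "cmp C _"] tuple_cong)
next
  case (ax k s t \<sigma>)
  have "\<forall>i<k. evl C A Z xs (\<sigma> i) \<in> arr C Z (fst A)"
    using evl_arr[OF algebra_operations[OF A] ax(2) Z xs] by blast
  then show ?case unfolding evl_subst by (rule algebra_axiom[OF T A ax(1) Z])
qed auto

lemma compatible_evl:
  assumes \<Phi>: "compatible T C A \<Phi>" and Z: "Z \<in> obj C" and xs: "\<And>i. i < k \<Longrightarrow> \<Phi> Z (xs i) (ys i)"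
  shows "wf_trm T k t \<Longrightarrow> \<Phi> Z (evl C A Z xs t) (evl C A Z ys t)"
proof (induction t)
  case (App f ts)
  show ?case unfolding evl_App[OF App.prems] by (rule compatibleD[OF \<Phi> _ Z]) (use App in auto)
qed (use xs in simp)

end

section \<open>Day terms\<close>

text \<open>
  Write \<open>x, y, z, u\<close> for the variables \<open>0, 1, 2, 3\<close>.  A Day term is a term \<open>m\<close> with
  \<open>m(x, y, y, x) = x\<close>, and consecutive terms of a Day chain from \<open>x\<close> to \<open>u\<close> agree at
  \<open>(x, y, y, u)\<close> or at \<open>(x, x, u, u)\<close>.
\<close>

definition quad :: "'a \<Rightarrow> 'a \<Rightarrow> 'a \<Rightarrow> 'a \<Rightarrow> nat \<Rightarrow> 'a" where
  "quad a b c d i = (if i = 0 then a else if i = 1 then b else if i = 2 then c else d)"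

lemma quad_simps [simp]:
  "quad a b c d 0 = a" "quad a b c d (Suc 0) = b" "quad a b c d 2 = c" "quad a b c d 3 = d"
  by (simp_all add: quad_def)

definition at_vars :: "'f trm \<Rightarrow> nat \<Rightarrow> nat \<Rightarrow> nat \<Rightarrow> nat \<Rightarrow> 'f trm" where
  "at_vars t a b c d = subst (quad (Var a) (Var b) (Var c) (Var d)) t"

definition day_term :: "'f alg_theory \<Rightarrow> 'f trm \<Rightarrow> bool" where
  "day_term T t \<longleftrightarrow> wf_trm T 4 t \<and> derivable T 4 (at_vars t 0 1 1 0) (Var 0)"

definition day_step :: "'f alg_theory \<Rightarrow> ('f trm \<times> 'f trm) set" where
  "day_step T = {(s, t). day_term T s \<and> day_term T t \<and>
     (derivable T 4 (at_vars s 0 1 1 3) (at_vars t 0 1 1 3) \<or> derivable T 4 (at_vars s 0 0 3 3) (at_vars t 0 0 3 3))}"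

definition has_day_terms :: "'f alg_theory \<Rightarrow> bool" where
  "has_day_terms T \<longleftrightarrow> (Var 0, Var 3) \<in> (day_step T)\<^sup>*"

context algebras_in_lex_category
begin

lemma evl_at_vars:
  assumes "wf_trm T 4 t" "a < 4" "b < 4" "c < 4" "d < 4"
  shows "evl C A Z xs (at_vars t a b c d) = evl C A Z (quad (xs a) (xs b) (xs c) (xs d)) t"
  unfolding at_vars_def evl_subst by (rule evl_cong[OF assms(1)]) (auto simp: quad_def)

lemma evl_quad_cong:
  assumes "wf_trm T 4 t" "\<Phi> Z a a'" "\<Phi> Z b b'" "\<Phi> Z c c'" "\<Phi> Z d d'" "compatible T C A \<Phi>" "Z \<in> obj C"
  shows "\<Phi> Z (evl C A Z (quad a b c d) t) (evl C A Z (quad a' b' c' d') t)"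
  by (rule compatible_evl[OF assms(6,7) _ assms(1)]) (simp add: quad_def assms(2-5))

text \<open>
  Day's argument at one stage.  For the terms \<open>t\<close> of the chain, \<open>t(a, a, c, c)\<close> and
  \<open>t(a, b, d, c)\<close> are related by \<open>\<Lambda>\<close> because \<open>\<Lambda>\<close> is a tolerance, and by \<open>\<Gamma>\<close> because both are
  \<open>\<Gamma>\<close>-related to \<open>a\<close>; hence they are related by \<open>N\<close>.  Along the chain one can pass from a term to
  the next one on the one or on the other side.
\<close>

lemma day_shift:
  assumes D: "has_day_terms T" and A: "A \<in> internal_algebras T C"
    and \<Phi>: "congruence T C A \<Phi>" and \<Gamma>: "congruence T C A \<Gamma>" and N: "congruence T C A N"
    and \<Lambda>: "tolerance T C A \<Lambda>" and \<Phi>\<Gamma>: "\<Phi> \<sqsubseteq> \<Gamma>" and \<Phi>N: "\<Phi> \<sqsubseteq> N" and \<Lambda>\<Gamma>: "\<Lambda> \<sqinter> \<Gamma> \<sqsubseteq> N"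
    and ab: "\<Lambda> Z a b" and bd: "\<Phi> Z b d" and dc: "\<Lambda> Z d c" and ac: "\<Gamma> Z a c"
  shows "N Z a c"
proof -
  note G = congruenceD[OF \<Gamma>] and M = congruenceD[OF N] and L = toleranceD[OF \<Lambda>]
  have a: "a \<in> arr C Z (fst A)" and b: "b \<in> arr C Z (fst A)" using rel_pred_arr[OF L(1) ab] by blast+
  have d: "d \<in> arr C Z (fst A)" and c: "c \<in> arr C Z (fst A)" using rel_pred_arr[OF L(1) dc] by blast+
  have Z: "Z \<in> obj C" using a arr_obj by fast
  let ?e = "\<lambda>w x y z t. evl C A Z (quad w x y z) t"
  have arr4: "\<forall>i<4. quad w x y z i \<in> arr C Z (fst A)"
    if "w \<in> arr C Z (fst A)" "x \<in> arr C Z (fst A)" "y \<in> arr C Z (fst A)" "z \<in> arr C Z (fst A)" for w x y z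
    using that by (simp add: quad_def)
  have idem: "?e a x x a t = a" if "day_term T t" "x \<in> arr C Z (fst A)" for x t
  proof -
    have wf: "wf_trm T 4 t" and der: "derivable T 4 (at_vars t 0 1 1 0) (Var 0)"
      using that(1) unfolding day_term_def by auto
    have "?e a x x a (at_vars t 0 1 1 0) = a"
      using derivable_sound[OF A Z der arr4[OF a that(2) that(2) a]] by simp
    then show ?thesis using evl_at_vars[OF wf, of 0 1 1 0 A Z "quad a x x a"] by simp
  qed
  have uv: "N Z (?e a a c c t) (?e a b d c t)" if t: "day_term T t" for t
  proof -
    have wf: "wf_trm T 4 t" using t unfolding day_term_def by auto
    have "\<Lambda> Z (?e a a c c t) (?e a b d c t)"
      by (rule evl_quad_cong[OF wf L(3)[OF a] ab L(4)[OF dc] L(3)[OF c] L(2) Z])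
    moreover have "\<Gamma> Z (?e a a a a t) (?e a a c c t)"
      by (rule evl_quad_cong[OF wf G(3)[OF a] G(3)[OF a] ac ac G(2) Z])
    moreover have "\<Gamma> Z (?e a b b a t) (?e a b d c t)"
      by (rule evl_quad_cong[OF wf G(3)[OF a] G(3)[OF b] _ ac G(2) Z]) (use bd \<Phi>\<Gamma> in blast)
    ultimately show ?thesis using idem[OF t a] idem[OF t b] G(4,5) \<Lambda>\<Gamma> by metis
  qed
  have "N Z a (?e a b d c t)" if "(Var 0, t) \<in> (day_step T)\<^sup>*" for t
    using that
  proof (induction rule: rtrancl_induct)
    case base
    show ?case using M(3)[OF a] by simp
  next
    case (step s t)
    then have s: "day_term T s" and t: "day_term T t"
      and alt: "derivable T 4 (at_vars s 0 1 1 3) (at_vars t 0 1 1 3) \<or> derivable T 4 (at_vars s 0 0 3 3) (at_vars t 0 0 3 3)"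
      unfolding day_step_def by auto
    have wf: "wf_trm T 4 s" "wf_trm T 4 t" using s t unfolding day_term_def by auto
    note sound = derivable_sound[OF A Z _ arr4]
    from alt have "N Z (?e a b d c s) (?e a b d c t)"
    proof
      assume der: "derivable T 4 (at_vars s 0 1 1 3) (at_vars t 0 1 1 3)"
      have eq: "?e a b b c s = ?e a b b c t"
        using sound[OF der a b b c] evl_at_vars[OF wf(1), of 0 1 1 3 A Z "quad a b b c"]
          evl_at_vars[OF wf(2), of 0 1 1 3 A Z "quad a b b c"] by simp
      have nb: "N Z (?e a b b c r) (?e a b d c r)" if "wf_trm T 4 r" for r
        by (rule evl_quad_cong[OF that M(3)[OF a] M(3)[OF b] _ M(3)[OF c] M(2) Z]) (use bd \<Phi>N in blast)
      show ?thesis by (rule M(5)[OF M(4)[OF nb[OF wf(1)]]]) (use nb[OF wf(2)] eq in simp)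
    next
      assume der: "derivable T 4 (at_vars s 0 0 3 3) (at_vars t 0 0 3 3)"
      have "?e a a c c s = ?e a a c c t"
        using sound[OF der a a c c] evl_at_vars[OF wf(1), of 0 0 3 3 A Z "quad a a c c"]
          evl_at_vars[OF wf(2), of 0 0 3 3 A Z "quad a a c c"] by simp
      then show ?thesis using uv[OF s] uv[OF t] M(4,5) by metis
    qed
    then show ?case using step.IH M(5) by blast
  qed
  from this[of "Var 3"] show ?thesis using D by (simp add: has_day_terms_def)
qed

lemma congruence_meet:
  assumes \<Phi>: "congruence T C A \<Phi>" and \<Gamma>: "congruence T C A \<Gamma>"
  shows "congruence T C A (\<Phi> \<sqinter> \<Gamma>)"
  unfolding congruence_def
proof (intro conjI allI ballI impI rel_pred_conj)
  show "compatible T C A (\<Phi> \<sqinter> \<Gamma>)"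
    using congruenceD(2)[OF \<Phi>] congruenceD(2)[OF \<Gamma>] unfolding compatible_def by blast
qed (use congruenceD[OF \<Phi>] congruenceD[OF \<Gamma>] in blast)+

theorem congruence_modular_if_day_terms:
  assumes D: "has_day_terms T"
    and images: "stable_images C" and sup: "has_chain_suprema C" and distrib: "chain_distributive C"
  shows "congruence_modular (algebra_cat T C)"
  unfolding congruence_modular_iff
proof (intro ballI conjI allI impI; (elim conjE)?)
  fix A \<Phi> \<Psi> assume A: "A \<in> internal_algebras T C" and c: "congruence T C A \<Phi>" "congruence T C A \<Psi>"
  show "\<exists>J. congruence_join T C A \<Phi> \<Psi> J"
    by (rule join_exists[OF images sup distrib A c]) blast
next
  fix A \<Phi> \<Psi> \<Gamma> J N
  assume A: "A \<in> internal_algebras T C" and c: "congruence T C A \<Phi>" "congruence T C A \<Psi>"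
    and \<Gamma>: "congruence T C A \<Gamma>" and \<Phi>\<Gamma>: "\<Phi> \<sqsubseteq> \<Gamma>"
    and J: "congruence_join T C A \<Phi> \<Psi> J" and NJ: "congruence_join T C A \<Phi> (\<Psi> \<sqinter> \<Gamma>) N"
  have N: "congruence T C A N" and \<Phi>N: "\<Phi> \<sqsubseteq> N" and \<Psi>N: "\<Psi> \<sqinter> \<Gamma> \<sqsubseteq> N"
    by (fact congruence_joinD[OF NJ])+
  obtain J' where J': "congruence_join T C A \<Phi> \<Psi> J'"
    and ind: "\<And>\<Gamma> \<Xi>. rel_pred C (fst A) \<Gamma> \<Longrightarrow> rel_pred C (fst A) \<Xi> \<Longrightarrow> \<Psi> \<sqinter> \<Gamma> \<sqsubseteq> \<Xi> \<Longrightarrow>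
      \<forall>\<Lambda>. tolerance T C A \<Lambda> \<longrightarrow> \<Lambda> \<sqsubseteq> J' \<longrightarrow> \<Lambda> \<sqinter> \<Gamma> \<sqsubseteq> \<Xi> \<longrightarrow>
        (\<forall>Z x b d y. \<Lambda> Z x b \<longrightarrow> \<Phi> Z b d \<longrightarrow> \<Lambda> Z d y \<longrightarrow> \<Gamma> Z x y \<longrightarrow> \<Xi> Z x y) \<Longrightarrow> J' \<sqinter> \<Gamma> \<sqsubseteq> \<Xi>"
    by (rule join_exists[OF images sup distrib A c]) (rule that)
  have "J' \<sqinter> \<Gamma> \<sqsubseteq> N"
  proof (rule ind[where \<Gamma> = \<Gamma> and \<Xi> = N, OF congruenceD(1)[OF \<Gamma>] congruenceD(1)[OF N] \<Psi>N], rule allI, intro impI)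
    fix \<Lambda> assume \<Lambda>: "tolerance T C A \<Lambda>" "\<Lambda> \<sqinter> \<Gamma> \<sqsubseteq> N"
    show "\<forall>Z x b d y. \<Lambda> Z x b \<longrightarrow> \<Phi> Z b d \<longrightarrow> \<Lambda> Z d y \<longrightarrow> \<Gamma> Z x y \<longrightarrow> N Z x y"
    proof (intro allI impI)
      fix Z x b d y assume h: "\<Lambda> Z x b" "\<Phi> Z b d" "\<Lambda> Z d y" "\<Gamma> Z x y"
      show "N Z x y" by (rule day_shift[OF D A c(1) \<Gamma> N \<Lambda>(1) \<Phi>\<Gamma> \<Phi>N \<Lambda>(2) h])
    qed
  qed
  moreover have "J \<sqsubseteq> J'"
    by (rule congruence_joinD(4)[OF J congruence_joinD(1,2,3)[OF J']])
  ultimately have 1: "J \<sqinter> \<Gamma> \<sqsubseteq> N" by blast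
  have "congruence T C A (J \<sqinter> \<Gamma>)"
    by (rule congruence_meet[OF _ \<Gamma>]) (rule congruence_joinD(1)[OF J])
  moreover have "\<Phi> \<sqsubseteq> J \<sqinter> \<Gamma>" "\<Psi> \<sqinter> \<Gamma> \<sqsubseteq> J \<sqinter> \<Gamma>"
    using congruence_joinD(2,3)[OF J] \<Phi>\<Gamma> by blast+
  ultimately have "N \<sqsubseteq> J \<sqinter> \<Gamma>" by (rule congruence_joinD(4)[OF NJ])
  with 1 show "J \<sqinter> \<Gamma> = N" by (intro ext) blast
qed

end

section \<open>The category of sets in an infinite universe\<close>

text \<open>A list is coded by its length and an iterated pairing; an infinite set has a pairing function.\<close>

lemma list_code_exists:
  assumes "infinite (UNIV :: 'u set)"
  shows "\<exists>c :: 'u list \<Rightarrow> 'u. inj c"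
proof -
  have "(card_of (UNIV \<times> UNIV :: ('u \<times> 'u) set), card_of (UNIV :: 'u set)) \<in> ordLeq"
    using card_of_Times_same_infinite[OF assms] ordIso_iff_ordLeq by blast
  then obtain p :: "'u \<times> 'u \<Rightarrow> 'u" where p: "inj p"
    unfolding card_of_ordLeq[symmetric] by auto
  obtain N :: "nat \<Rightarrow> 'u" where N: "inj N" using infinite_countable_subset[OF assms] by blast
  define g where "g = rec_list (N 0) (\<lambda>x _ y. p (x, y))"
  have g: "g [] = N 0" "g (x # xs) = p (x, g xs)" for x xs by (simp_all add: g_def)
  have inj_g: "length xs = length ys \<Longrightarrow> g xs = g ys \<Longrightarrow> xs = ys" for xs ys
    by (induction rule: list_induct2) (use p in \<open>auto simp: g inj_eq\<close>)
  have "inj (\<lambda>xs. p (N (length xs), g xs))"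
    by (rule injI) (use p N inj_g in \<open>auto simp: inj_eq\<close>)
  then show ?thesis by blast
qed

lemma set_cat_simps [simp]:
  "obj set_cat = UNIV" "hom set_cat A B = {f. dom f = A \<and> ran f \<subseteq> B}"
  "idt set_cat A = Some |` A" "cmp set_cat g f = g \<circ>\<^sub>m f"
  by (simp_all add: set_cat_def)

definition set_map :: "'u set \<Rightarrow> ('u \<Rightarrow> 'u) \<Rightarrow> 'u \<rightharpoonup> 'u" where
  "set_map Z h = (\<lambda>z. if z \<in> Z then Some (h z) else None)"

lemma set_arr_iff: "f \<in> arr set_cat Z X \<longleftrightarrow> dom f = Z \<and> ran f \<subseteq> X"
  by (simp add: arr_def)

lemma set_arr_the:
  assumes "f \<in> arr set_cat Z X" "z \<in> Z" shows "f z = Some (the (f z))" "the (f z) \<in> X"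
  using assms by (auto simp: set_arr_iff ran_def)

lemma set_arr_ext:
  assumes "f \<in> arr set_cat Z X" "g \<in> arr set_cat Z Y" "\<And>z. z \<in> Z \<Longrightarrow> the (f z) = the (g z)" shows "f = g"
proof
  fix z show "f z = g z"
    using assms set_arr_the(1)[OF assms(1)] set_arr_the(1)[OF assms(2)]
    by (cases "z \<in> Z") (metis, metis domIff set_arr_iff)
qed

lemma set_map_arr: "(\<And>z. z \<in> Z \<Longrightarrow> h z \<in> X) \<Longrightarrow> set_map Z h \<in> arr set_cat Z X"
  by (auto simp: set_arr_iff set_map_def ran_def dom_def split: if_splits)

lemma the_set_map: "z \<in> Z \<Longrightarrow> the (set_map Z h z) = h z"
  by (simp add: set_map_def)

lemma the_comp: "f \<in> arr set_cat Z X \<Longrightarrow> z \<in> Z \<Longrightarrow> the ((g \<circ>\<^sub>m f) z) = the (g (the (f z)))"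
  by (cases "f z") (auto simp: map_comp_def set_arr_iff)

lemma the_comp_set_map:
  assumes "k \<in> arr set_cat Z X" "z \<in> Z" shows "the ((set_map X h \<circ>\<^sub>m k) z) = h (the (k z))"
  unfolding the_comp[OF assms] by (rule the_set_map[OF set_arr_the(2)[OF assms]])

lemma set_cat_category: "cat_setup (set_cat :: ('u set, 'u \<rightharpoonup> 'u) cat)"
proof
  have 1: "ran (g \<circ>\<^sub>m f) \<subseteq> ran g" for f g :: "'u \<rightharpoonup> 'u"
    by (auto simp: ran_def map_comp_def split: option.splits)
  have 2: "dom (g \<circ>\<^sub>m f) = dom f" if "ran f \<subseteq> dom g" for f g :: "'u \<rightharpoonup> 'u"
    using that by (fastforce simp: ran_def dom_def map_comp_def split: option.splits)
  have 3: "f \<circ>\<^sub>m (Some |` dom f) = f" for f :: "'u \<rightharpoonup> 'u"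
    by (rule ext) (auto simp: map_comp_def restrict_map_def dom_def)
  have 4: "(Some |` B) \<circ>\<^sub>m f = f" if "ran f \<subseteq> B" for B and f :: "'u \<rightharpoonup> 'u"
    using that by (intro ext) (auto simp: map_comp_def restrict_map_def ran_def split: option.splits)
  have 5: "(h \<circ>\<^sub>m g) \<circ>\<^sub>m f = h \<circ>\<^sub>m (g \<circ>\<^sub>m f)" for f g h :: "'u \<rightharpoonup> 'u"
    by (rule ext) (auto simp: map_comp_def split: option.splits)
  have 6: "dom (Some |` A) = A" "ran (Some |` A) \<subseteq> A" for A :: "'u set"
    by (auto simp: ran_def restrict_map_def split: if_splits)
  show "category (set_cat :: ('u set, 'u \<rightharpoonup> 'u) cat)"
    unfolding category_def using 1 2 3 4 5 6 by (simp; blast)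
qed

text \<open>A finite limit consists of the codes of the compatible tuples of elements.\<close>

lemma set_cat_finitely_complete:
  assumes "infinite (UNIV :: 'u set)"
  shows "finitely_complete (set_cat :: ('u set, 'u \<rightharpoonup> 'u) cat)"
proof -
  interpret S: cat_setup "set_cat :: ('u set, 'u \<rightharpoonup> 'u) cat" by (rule set_cat_category)
  obtain c :: "'u list \<Rightarrow> 'u" where c: "inj c" using list_code_exists[OF assms] by blast
  have "\<exists>L p. is_limit (set_cat :: ('u set, 'u \<rightharpoonup> 'u) cat) n D W L p" if d: "is_diagram set_cat n D W"
    for n and D :: "nat \<Rightarrow> 'u set" and W
  proof -
    have W: "i < n \<and> j < n \<and> f \<in> arr set_cat (D i) (D j)" if "(i, j, f) \<in> W" for i j f
    proof -
      have "\<forall>(i, j, f)\<in>W. i < n \<and> j < n \<and> f \<in> hom set_cat (D i) (D j)"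
        using d unfolding is_diagram_def by (elim conjE)
      from bspec[OF this that] show ?thesis by (simp add: set_arr_iff)
    qed
    define L where "L = {c l | l. length l = n \<and> (\<forall>i<n. l ! i \<in> D i) \<and> (\<forall>(i, j, f)\<in>W. the (f (l ! i)) = l ! j)}"
    define p where "p i = set_map L (\<lambda>x. inv c x ! i)" for i
    have Lc: "length (inv c x) = n" "\<And>i. i < n \<Longrightarrow> inv c x ! i \<in> D i" "c (inv c x) = x"
      "\<And>i j f. (i, j, f) \<in> W \<Longrightarrow> the (f (inv c x ! i)) = inv c x ! j" if "x \<in> L" for x
      using that c unfolding L_def by auto
    have p: "p i \<in> arr set_cat L (D i)" if "i < n" for i
      unfolding p_def by (rule set_map_arr) (use Lc that in simp)
    have "is_limit set_cat n D W L p"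
    proof (rule S.is_limitI[OF d])
      show "L \<in> obj set_cat" by simp
      show "p i \<in> arr set_cat L (D i)" if "i < n" for i by (rule p[OF that])
      fix i j f assume e: "(i, j, f) \<in> W"
      have i: "i < n" and j: "j < n" and f: "f \<in> arr set_cat (D i) (D j)" using W[OF e] by auto
      show "cmp set_cat f (p i) = p j"
      proof (rule set_arr_ext[OF S.comp_arr[OF p[OF i] f] p[OF j]])
        fix z assume z: "z \<in> L"
        have "the ((f \<circ>\<^sub>m p i) z) = the (f (the (p i z)))" by (rule the_comp[OF p[OF i] z])
        then show "the (cmp set_cat f (p i) z) = the (p j z)"
          by (simp add: p_def the_set_map z Lc(4)[OF z e])
      qed
    next
      fix Z :: "'u set" and q assume q: "\<And>i. i < n \<Longrightarrow> q i \<in> arr set_cat Z (D i)"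
        and e: "\<And>i j f. (i, j, f) \<in> W \<Longrightarrow> cmp set_cat f (q i) = q j"
      let ?l = "\<lambda>z. map (\<lambda>i. the (q i z)) [0..<n]"
      have l: "c (?l z) \<in> L" if z: "z \<in> Z" for z
      proof -
        have "the (f (the (q i z))) = the (q j z)" if "(i, j, f) \<in> W" for i j f
          using e[OF that] the_comp[OF q z, of i f] W[OF that] by simp
        then have "\<forall>(i, j, f)\<in>W. the (f (?l z ! i)) = ?l z ! j" using W by (intro ballI) auto
        moreover have "\<forall>i<n. ?l z ! i \<in> D i" using set_arr_the(2)[OF q z] by simp
        ultimately show ?thesis unfolding L_def mem_Collect_eq by (intro exI[of _ "?l z"]) simp
      qed
      let ?h = "set_map Z (\<lambda>z. c (?l z))"
      have h: "?h \<in> arr set_cat Z L" by (rule set_map_arr[OF l])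
      have "cmp set_cat (p i) ?h = q i" if i: "i < n" for i
        by (rule set_arr_ext[OF S.comp_arr[OF h p[OF i]] q[OF i]])
          (use i c in \<open>simp add: the_comp[OF h] the_set_map p_def l\<close>)
      then show "\<exists>h\<in>arr set_cat Z L. \<forall>i<n. cmp set_cat (p i) h = q i" using h by blast
    next
      fix Z :: "'u set" and g h assume g: "g \<in> arr set_cat Z L" and h: "h \<in> arr set_cat Z L"
        and e: "\<And>i. i < n \<Longrightarrow> cmp set_cat (p i) g = cmp set_cat (p i) h"
      show "g = h"
      proof (rule set_arr_ext[OF g h])
        fix z assume z: "z \<in> Z"
        note gz = Lc[OF set_arr_the(2)[OF g z]] and hz = Lc[OF set_arr_the(2)[OF h z]]
        have "inv c (the (g z)) ! i = inv c (the (h z)) ! i" if i: "i < n" for i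
        proof -
          have "the ((p i \<circ>\<^sub>m g) z) = the ((p i \<circ>\<^sub>m h) z)" using e[OF i] by simp
          then show ?thesis
            unfolding the_comp[OF g z] the_comp[OF h z] p_def the_set_map[OF set_arr_the(2)[OF g z]]
              the_set_map[OF set_arr_the(2)[OF h z]] .
        qed
        then have "inv c (the (g z)) = inv c (the (h z))" using gz(1) hz(1) by (simp add: list_eq_iff_nth_eq)
        then show "the (g z) = the (h z)" using gz(3) hz(3) by metis
      qed
    qed
    then show ?thesis by blast
  qed
  then show ?thesis unfolding finitely_complete_def using S.category by blast
qed

section \<open>Free algebras in the category of sets\<close>

text \<open>
  The label of an operation is written twice, which distinguishes the code list of an
  application from the one-element list that codes a variable.
\<close>

primrec term_code :: "('u list \<Rightarrow> 'u) \<Rightarrow> (nat \<Rightarrow> 'u) \<Rightarrow> ('f \<Rightarrow> 'u) \<Rightarrow> 'f trm \<Rightarrow> 'u" where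
  "term_code c N e (Var i) = c [N i]"
| "term_code c N e (App f ts) = c (e f # e f # map (term_code c N e) ts)"

lemma term_code_inj:
  assumes c: "inj c" and N: "inj N" and e: "inj_on e (ops T)"
  shows "wf_trm T k s \<Longrightarrow> wf_trm T k t \<Longrightarrow> term_code c N e s = term_code c N e t \<Longrightarrow> s = t"
proof (induction s arbitrary: t)
  case (Var i)
  then show ?case using c N by (cases t) (auto simp: inj_eq)
next
  case (App f ss)
  then obtain g ts where t: "t = App g ts" using c by (cases t) (auto simp: inj_eq)
  have eq: "e f = e g" "map (term_code c N e) ss = map (term_code c N e) ts" using App.prems(3) c by (simp_all add: t inj_eq)
  have "f = g" using eq(1) e App.prems(1,2) by (auto simp: t inj_on_def)
  moreover have "ss = ts"
  proof (rule nth_equalityI)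
    show len: "length ss = length ts" using eq(2) by (rule map_eq_imp_length_eq)
    fix i assume i: "i < length ss"
    show "ss ! i = ts ! i"
      by (rule App.IH) (use i len App.prems(1,2) arg_cong[OF eq(2), of "\<lambda>l. l ! i"] in \<open>auto simp: t\<close>)
  qed
  ultimately show ?case by (simp add: t)
qed

text \<open>
  A class of terms is coded by the code of a chosen member.  Adequacy of the universe provides the
  codes of variables, operation symbols and lists of codes.
\<close>

lemma class_code_exists:
  assumes "algebraic_theory T" and "adequate_universe TYPE('u) T"
  shows "\<exists>\<kappa> :: 'f trm \<Rightarrow> 'u. \<forall>s t. wf_trm T n s \<longrightarrow> wf_trm T n t \<longrightarrow> (\<kappa> s = \<kappa> t \<longleftrightarrow> derivable T n s t)"
proof -
  have inf: "infinite (UNIV :: 'u set)" using assms(2) by (simp add: adequate_universe_def)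
  obtain e :: "'f \<Rightarrow> 'u" where e: "inj_on e (ops T)" using assms(2) by (auto simp: adequate_universe_def)
  obtain c :: "'u list \<Rightarrow> 'u" where c: "inj c" using list_code_exists[OF inf] by blast
  obtain N :: "nat \<Rightarrow> 'u" where N: "inj N" using infinite_countable_subset[OF inf] by blast
  define r where "r t = (SOME s. derivable T n t s)" for t
  have r: "derivable T n t (r t)" if "wf_trm T n t" for t
    unfolding r_def by (rule someI[of _ t]) (rule derivable.refl[OF that])
  have "term_code c N e (r s) = term_code c N e (r t) \<longleftrightarrow> derivable T n s t"
    if s: "wf_trm T n s" and t: "wf_trm T n t" for s t
  proof
    assume "term_code c N e (r s) = term_code c N e (r t)"
    then have "r s = r t"
      using term_code_inj[OF c N e] derivable_wf[OF assms(1) r[OF s]] derivable_wf[OF assms(1) r[OF t]] by blast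
    then show "derivable T n s t" using r[OF s] r[OF t] derivable.sym derivable.trans by metis
  next
    assume "derivable T n s t"
    then have "derivable T n s = derivable T n t" using derivable.sym derivable.trans by (intro ext) blast
    then show "term_code c N e (r s) = term_code c N e (r t)" by (simp add: r_def)
  qed
  then show ?thesis by (intro exI[of _ "\<lambda>t. term_code c N e (r t)"]) blast
qed

text \<open>
  The congruences of the free algebra on \<open>n\<close> generators, pulled back to terms; derivably equal terms
  are related because they denote the same element.
\<close>

definition term_congruence :: "'f alg_theory \<Rightarrow> nat \<Rightarrow> ('f trm \<Rightarrow> 'f trm \<Rightarrow> bool) \<Rightarrow> bool" where
  "term_congruence T n \<theta> \<longleftrightarrow> (\<forall>s t. \<theta> s t \<longrightarrow> wf_trm T n s \<and> wf_trm T n t) \<and>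
     (\<forall>s t. derivable T n s t \<longrightarrow> \<theta> s t) \<and> (\<forall>s t. \<theta> s t \<longrightarrow> \<theta> t s) \<and> (\<forall>s t u. \<theta> s t \<longrightarrow> \<theta> t u \<longrightarrow> \<theta> s u) \<and>
     (\<forall>f\<in>ops T. \<forall>ss ts. length ss = arity T f \<longrightarrow> length ts = arity T f \<longrightarrow>
        (\<forall>i<arity T f. \<theta> (ss ! i) (ts ! i)) \<longrightarrow> \<theta> (App f ss) (App f ts))"

lemma term_congruenceD:
  assumes "term_congruence T n \<theta>"
  shows "\<theta> s t \<Longrightarrow> wf_trm T n s \<and> wf_trm T n t" "derivable T n s t \<Longrightarrow> \<theta> s t" "\<theta> s t \<Longrightarrow> \<theta> t s"
    "\<theta> s t \<Longrightarrow> \<theta> t u \<Longrightarrow> \<theta> s u"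
    "f \<in> ops T \<Longrightarrow> length ss = arity T f \<Longrightarrow> length ts = arity T f \<Longrightarrow> \<forall>i<arity T f. \<theta> (ss ! i) (ts ! i) \<Longrightarrow> \<theta> (App f ss) (App f ts)"
  using assms unfolding term_congruence_def by blast+

text \<open>
  The free algebra in the category of sets: its elements at a stage \<open>Z\<close> are the families of
  terms indexed by \<open>Z\<close>, up to derivable equality.  Here \<open>el t\<close> is the element given by the
  term \<open>t\<close> at a one-point stage \<open>P\<close>, and \<open>\<Phi>\<close> turns term congruences into congruences.
\<close>

lemma free_algebra:
  assumes T: "algebraic_theory T" and U: "adequate_universe TYPE('u) T"
  obtains A :: "'u set \<times> ('f \<Rightarrow> 'u \<rightharpoonup> 'u)" and P and el :: "'f trm \<Rightarrow> 'u \<rightharpoonup> 'u"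
    and \<Phi> :: "('f trm \<Rightarrow> 'f trm \<Rightarrow> bool) \<Rightarrow> 'u set \<Rightarrow> ('u \<rightharpoonup> 'u) \<Rightarrow> ('u \<rightharpoonup> 'u) \<Rightarrow> bool" where
    "A \<in> internal_algebras T set_cat"
    "\<And>\<theta>. term_congruence T n \<theta> \<Longrightarrow> congruence T set_cat A (\<Phi> \<theta>)"
    "\<And>\<theta> \<eta>. \<forall>s t. \<theta> s t \<longrightarrow> \<eta> s t \<Longrightarrow> \<Phi> \<theta> \<sqsubseteq> \<Phi> \<eta>"
    "\<And>\<theta> \<eta>. \<Phi> \<theta> \<sqinter> \<Phi> \<eta> \<sqsubseteq> \<Phi> (\<lambda>s t. \<theta> s t \<and> \<eta> s t)"
    "\<And>\<theta> s t. term_congruence T n \<theta> \<Longrightarrow> wf_trm T n s \<Longrightarrow> wf_trm T n t \<Longrightarrow> \<Phi> \<theta> P (el s) (el t) \<longleftrightarrow> \<theta> s t"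
proof -
  let ?S = "set_cat :: ('u set, 'u \<rightharpoonup> 'u) cat"
  have inf: "infinite (UNIV :: 'u set)" using U by (simp add: adequate_universe_def)
  interpret S: algebras_in_lex_category ?S T
    by unfold_locales (rule set_cat_finitely_complete[OF inf], rule T)
  obtain c :: "'u list \<Rightarrow> 'u" where c: "inj c" using list_code_exists[OF inf] by blast
  obtain \<kappa> :: "'f trm \<Rightarrow> 'u" where \<kappa>: "\<And>s t. wf_trm T n s \<Longrightarrow> wf_trm T n t \<Longrightarrow> \<kappa> s = \<kappa> t \<longleftrightarrow> derivable T n s t"
    using class_code_exists[OF T U, of n] by blast
  define F where "F = \<kappa> ` {t. wf_trm T n t}"
  define \<delta> where "\<delta> x = (SOME t. wf_trm T n t \<and> \<kappa> t = x)" for x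
  have \<delta>: "wf_trm T n (\<delta> x)" "\<kappa> (\<delta> x) = x" if "x \<in> F" for x
  proof -
    have "\<exists>t. wf_trm T n t \<and> \<kappa> t = x" using that unfolding F_def by blast
    from someI_ex[OF this] show "wf_trm T n (\<delta> x)" "\<kappa> (\<delta> x) = x" unfolding \<delta>_def by blast+
  qed
  have \<kappa>F: "\<kappa> t \<in> F" if "wf_trm T n t" for t using that unfolding F_def by blast
  have \<delta>\<kappa>: "derivable T n (\<delta> (\<kappa> t)) t" if "wf_trm T n t" for t
    using \<kappa>[OF \<delta>(1)[OF \<kappa>F[OF that]] that] \<delta>(2)[OF \<kappa>F[OF that]] by simp
  let ?at = "\<lambda>xs z i. \<delta> (the (xs i z))"
  define u where "u f Z xs = set_map Z (\<lambda>z. \<kappa> (App f (map (?at xs z) [0..<arity T f])))" for f and Z :: "'u set" and xs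
  have at_wf: "wf_trm T n (?at xs z i)" if "\<forall>i<k. xs i \<in> arr ?S Z F" "z \<in> Z" "i < k" for k xs Z z i
    using \<delta>(1) set_arr_the(2) that by metis
  have u_wf: "wf_trm T n (App f (map (?at xs z) [0..<arity T f]))"
    if "f \<in> ops T" "\<forall>i<arity T f. xs i \<in> arr ?S Z F" "z \<in> Z" for f Z xs z
    using that at_wf[OF that(2,3)] by auto
  have u_arr: "u f Z xs \<in> arr ?S Z F" if "f \<in> ops T" "\<forall>i<arity T f. xs i \<in> arr ?S Z F" for f Z xs
    unfolding u_def by (rule set_map_arr) (rule \<kappa>F[OF u_wf[OF that]])
  have u_cong: "u f Z xs = u f Z ys" if "\<And>i. i < arity T f \<Longrightarrow> xs i = ys i" for f Z xs ys
  proof -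
    have "map (?at xs z) [0..<arity T f] = map (?at ys z) [0..<arity T f]" for z
      by (rule map_cong) (simp_all add: that)
    then show ?thesis unfolding u_def by (simp only:)
  qed
  have u_nat: "cmp ?S (u f Z xs) z = u f Z' (\<lambda>i. cmp ?S (xs i) z)"
    if f: "f \<in> ops T" and z: "z \<in> arr ?S Z' Z" and xs: "\<forall>i<arity T f. xs i \<in> arr ?S Z F" for f Z xs z Z'
  proof -
    have xz: "\<forall>i<arity T f. cmp ?S (xs i) z \<in> arr ?S Z' F" using xs S.comp_arr[OF z] by blast
    show ?thesis
    proof (rule set_arr_ext[OF S.comp_arr[OF z u_arr[OF f xs]] u_arr[OF f xz]])
      fix w assume w: "w \<in> Z'"
      have zw: "the (z w) \<in> Z" by (rule set_arr_the(2)[OF z w])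
      show "the (cmp ?S (u f Z xs) z w) = the (u f Z' (\<lambda>i. cmp ?S (xs i) z) w)"
        using the_comp[OF z w, of "u f Z xs"] the_comp[OF z w, of "xs _"]
        by (simp add: u_def the_set_map[OF zw] the_set_map[OF w])
    qed
  qed
  obtain l where l: "operations T ?S (F, l)" "\<And>f. f \<notin> ops T \<Longrightarrow> l f = undefined"
    "\<And>f Z xs. f \<in> ops T \<Longrightarrow> Z \<in> obj ?S \<Longrightarrow> \<forall>i<arity T f. xs i \<in> arr ?S Z F \<Longrightarrow> opr T ?S (F, l) f Z xs = u f Z xs"
    by (rule S.algebra_of_natural_operations[where u = u and L = F and T = T, OF T])
      (simp, rule u_arr, assumption+, rule u_nat, assumption+, rule u_cong, assumption, rule that)
  \<comment> \<open>Evaluation in the free algebra is substitution.\<close>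
  have ev: "the (evl ?S (F, l) Z xs t z) = \<kappa> (subst (?at xs z) t)"
    if xs: "\<forall>i<k. xs i \<in> arr ?S Z F" and z: "z \<in> Z" and wf: "wf_trm T k t" for k Z xs z t
    using wf
  proof (induction t)
    case (Var i)
    then show ?case using \<delta>(2) set_arr_the(2)[OF _ z] xs by fastforce
  next
    case (App f ts)
    have f: "f \<in> ops T" and len: "length ts = arity T f" and w: "\<And>i. i < arity T f \<Longrightarrow> wf_trm T k (ts ! i)"
      using App.prems by auto
    have xs': "\<forall>i<k. xs i \<in> arr ?S Z (fst (F, l))" using xs by simp
    have a: "\<forall>i<arity T f. evl ?S (F, l) Z xs (ts ! i) \<in> arr ?S Z F"
      using S.evl_arr[OF l(1) w _ xs'] by simp
    let ?ss = "map (?at (\<lambda>i. evl ?S (F, l) Z xs (ts ! i)) z) [0..<arity T f]"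
    have sub_wf: "wf_trm T n (subst (?at xs z) t)" if "wf_trm T k t" for t
      by (rule wf_subst[OF that at_wf[OF xs z]])
    have "the (evl ?S (F, l) Z xs (App f ts) z) = \<kappa> (App f ?ss)"
      unfolding evl_App[OF App.prems] l(3)[OF f _ a, simplified] u_def the_set_map[OF z] ..
    also have "\<dots> = \<kappa> (subst (?at xs z) (App f ts))"
    proof (subst \<kappa>[OF u_wf[OF f a z] sub_wf[OF App.prems]])
      show "derivable T n (App f ?ss) (subst (?at xs z) (App f ts))"
        unfolding subst.simps
      proof (rule derivable.app[OF f])
        fix i assume i: "i < arity T f"
        have "the (evl ?S (F, l) Z xs (ts ! i) z) = \<kappa> (subst (?at xs z) (ts ! i))"
          by (rule App.IH) (use i len w in auto)
        then show "derivable T n (?ss ! i) (map (subst (?at xs z)) ts ! i)"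
          using i len \<delta>\<kappa>[OF sub_wf[OF w[OF i]]] by simp
      qed (use len in simp_all)
    qed
    finally show ?case .
  qed
  have A: "(F, l) \<in> internal_algebras T ?S"
    unfolding S.internal_algebras_iff[OF T]
  proof (intro conjI l(1) allI impI)
    show "snd (F, l) f = undefined" if "f \<notin> ops T" for f using l(2)[OF that] by simp
    have "evl ?S (F, l) Z xs s = evl ?S (F, l) Z xs t"
      if ax: "(k, s, t) \<in> axioms T" and xs: "\<forall>i<k. xs i \<in> arr ?S Z F" for k s t Z xs
    proof -
      have wf: "wf_trm T k s" "wf_trm T k t" using T ax unfolding algebraic_theory_def by auto
      have xs': "\<forall>i<k. xs i \<in> arr ?S Z (fst (F, l))" using xs by simp
      show ?thesis
      proof (rule set_arr_ext[OF S.evl_arr[OF l(1) wf(1) _ xs'] S.evl_arr[OF l(1) wf(2) _ xs']])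
        fix z assume z: "z \<in> Z"
        have "derivable T n (subst (?at xs z) s) (subst (?at xs z) t)"
          by (rule derivable.ax[OF ax at_wf[OF xs z]])
        then show "the (evl ?S (F, l) Z xs s z) = the (evl ?S (F, l) Z xs t z)"
          unfolding ev[OF xs z wf(1)] ev[OF xs z wf(2)] using \<kappa> derivable_wf[OF T] by blast
      qed simp_all
    qed
    then show "\<forall>(k, s, t)\<in>axioms T. \<forall>Z\<in>obj ?S. \<forall>xs. (\<forall>i<k. xs i \<in> arr ?S Z (fst (F, l))) \<longrightarrow>
        evl ?S (F, l) Z xs s = evl ?S (F, l) Z xs t" by auto
  qed
  define \<Phi> where "\<Phi> \<theta> Z x y \<longleftrightarrow> x \<in> arr ?S Z F \<and> y \<in> arr ?S Z F \<and> (\<forall>z\<in>Z. \<theta> (\<delta> (the (x z))) (\<delta> (the (y z))))"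
    for \<theta> :: "'f trm \<Rightarrow> 'f trm \<Rightarrow> bool" and Z x y
  have \<Phi>_cong: "congruence T ?S (F, l) (\<Phi> \<theta>)" if \<theta>: "term_congruence T n \<theta>" for \<theta>
  proof -
    note th = term_congruenceD[OF \<theta>]
    let ?R = "{c [a, b] | a b. a \<in> F \<and> b \<in> F \<and> \<theta> (\<delta> a) (\<delta> b)}"
    let ?d = "\<lambda>i. set_map ?R (\<lambda>r. inv c r ! i)"
    have R: "\<exists>a b. r = c [a, b] \<and> a \<in> F \<and> b \<in> F \<and> \<theta> (\<delta> a) (\<delta> b) \<and> inv c r = [a, b]" if "r \<in> ?R" for r
      using that c by auto
    have d: "?d 0 \<in> arr ?S ?R F" "?d 1 \<in> arr ?S ?R F" by (rule set_map_arr, drule R, force)+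
    have d_the: "the (cmp ?S (?d i) k z) = inv c (the (k z)) ! i" if "k \<in> arr ?S Z ?R" "z \<in> Z" for i k Z z
      using the_comp_set_map[OF that] by simp
    have "rel_pred ?S F (\<Phi> \<theta>)"
    proof (rule S.rel_predI[OF _ d])
      show "F \<in> obj ?S" by simp
      fix Z g h assume g: "g \<in> arr ?S Z ?R" and h: "h \<in> arr ?S Z ?R"
        and e: "cmp ?S (?d 0) g = cmp ?S (?d 0) h" "cmp ?S (?d 1) g = cmp ?S (?d 1) h"
      show "g = h"
      proof (rule set_arr_ext[OF g h])
        fix z assume z: "z \<in> Z"
        have "inv c (the (g z)) ! 0 = inv c (the (h z)) ! 0" "inv c (the (g z)) ! 1 = inv c (the (h z)) ! 1"
          by (simp_all only: d_the[OF g z, symmetric] d_the[OF h z, symmetric] e)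
        moreover obtain a b where "the (g z) = c [a, b]" "inv c (the (g z)) = [a, b]"
          using R[OF set_arr_the(2)[OF g z]] by blast
        moreover obtain a' b' where "the (h z) = c [a', b']" "inv c (the (h z)) = [a', b']"
          using R[OF set_arr_the(2)[OF h z]] by blast
        ultimately show "the (g z) = the (h z)" by simp
      qed
    next
      fix Z x y
      show "\<Phi> \<theta> Z x y \<longleftrightarrow> (\<exists>k\<in>arr ?S Z ?R. cmp ?S (?d 0) k = x \<and> cmp ?S (?d 1) k = y)"
      proof
        assume xy: "\<Phi> \<theta> Z x y"
        then have x: "x \<in> arr ?S Z F" and y: "y \<in> arr ?S Z F" unfolding \<Phi>_def by auto
        let ?k = "set_map Z (\<lambda>z. c [the (x z), the (y z)])"
        have k: "?k \<in> arr ?S Z ?R"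
          by (rule set_map_arr) (use xy set_arr_the(2)[OF x] set_arr_the(2)[OF y] in \<open>unfold \<Phi>_def, blast\<close>)
        have "cmp ?S (?d 0) ?k = x"
          by (rule set_arr_ext[OF S.comp_arr[OF k d(1)] x]) (use d_the[OF k] c in \<open>simp add: the_set_map\<close>)
        moreover have "cmp ?S (?d 1) ?k = y"
          by (rule set_arr_ext[OF S.comp_arr[OF k d(2)] y]) (use d_the[OF k] c in \<open>simp add: the_set_map\<close>)
        ultimately show "\<exists>k\<in>arr ?S Z ?R. cmp ?S (?d 0) k = x \<and> cmp ?S (?d 1) k = y" using k by blast
      next
        assume "\<exists>k\<in>arr ?S Z ?R. cmp ?S (?d 0) k = x \<and> cmp ?S (?d 1) k = y"
        then obtain k where k: "k \<in> arr ?S Z ?R" and xy: "x = cmp ?S (?d 0) k" "y = cmp ?S (?d 1) k" by blast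
        have "\<theta> (\<delta> (the (x z))) (\<delta> (the (y z)))" if z: "z \<in> Z" for z
          unfolding xy d_the[OF k z] using R[OF set_arr_the(2)[OF k z]] by auto
        then show "\<Phi> \<theta> Z x y" unfolding \<Phi>_def using S.comp_arr[OF k d(1)] S.comp_arr[OF k d(2)] xy by blast
      qed
    qed
    moreover have "compatible T ?S (F, l) (\<Phi> \<theta>)"
      unfolding compatible_def
    proof (intro ballI allI impI)
      fix f Z xs ys assume f: "f \<in> ops T" and Z: "Z \<in> obj ?S" and e: "\<forall>i<arity T f. \<Phi> \<theta> Z (xs i) (ys i)"
      have a: "\<forall>i<arity T f. xs i \<in> arr ?S Z F" "\<forall>i<arity T f. ys i \<in> arr ?S Z F" using e unfolding \<Phi>_def by blast+
      have "\<theta> (\<delta> (the (u f Z xs z))) (\<delta> (the (u f Z ys z)))" if z: "z \<in> Z" for z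
      proof -
        have "\<theta> (App f (map (?at xs z) [0..<arity T f])) (App f (map (?at ys z) [0..<arity T f]))"
          by (rule th(5)[OF f]) (use e z in \<open>simp_all add: \<Phi>_def\<close>)
        moreover have "\<theta> (\<delta> (the (u f Z xs z))) (App f (map (?at xs z) [0..<arity T f]))"
          unfolding u_def the_set_map[OF z] by (rule th(2)[OF \<delta>\<kappa>[OF u_wf[OF f a(1) z]]])
        moreover have "\<theta> (\<delta> (the (u f Z ys z))) (App f (map (?at ys z) [0..<arity T f]))"
          unfolding u_def the_set_map[OF z] by (rule th(2)[OF \<delta>\<kappa>[OF u_wf[OF f a(2) z]]])
        ultimately show ?thesis using th(3,4) by blast
      qed
      then show "\<Phi> \<theta> Z (opr T ?S (F, l) f Z xs) (opr T ?S (F, l) f Z ys)"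
        unfolding l(3)[OF f Z a(1)] l(3)[OF f Z a(2)] \<Phi>_def using u_arr[OF f a(1)] u_arr[OF f a(2)] by blast
    qed
    moreover have "\<Phi> \<theta> Z x x" if x: "x \<in> arr ?S Z F" for Z x
      unfolding \<Phi>_def using x th(2)[OF derivable.refl[OF \<delta>(1)[OF set_arr_the(2)[OF x]]]] by blast
    ultimately show ?thesis
      unfolding congruence_def fst_conv using th(3,4) unfolding \<Phi>_def by (intro conjI) blast+
  qed
  let ?P = "{c []}" let ?el = "\<lambda>t. set_map ?P (\<lambda>_. \<kappa> t)"
  have el: "\<Phi> \<theta> ?P (?el s) (?el t) \<longleftrightarrow> \<theta> s t"
    if \<theta>: "term_congruence T n \<theta>" and s: "wf_trm T n s" and t: "wf_trm T n t" for \<theta> s t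
  proof -
    note th = term_congruenceD[OF \<theta>]
    have "\<Phi> \<theta> ?P (?el s) (?el t) \<longleftrightarrow> \<theta> (\<delta> (\<kappa> s)) (\<delta> (\<kappa> t))"
      unfolding \<Phi>_def using set_map_arr[of ?P "\<lambda>_. \<kappa> s" F] set_map_arr[of ?P "\<lambda>_. \<kappa> t" F] \<kappa>F[OF s] \<kappa>F[OF t]
      by (simp add: the_set_map)
    also have "\<dots> \<longleftrightarrow> \<theta> s t" using th(3,4) th(2)[OF \<delta>\<kappa>[OF s]] th(2)[OF \<delta>\<kappa>[OF t]] by blast
    finally show ?thesis .
  qed
  show thesis
    by (rule that[of "(F, l)" \<Phi> ?P ?el, OF A \<Phi>_cong _ _ el]) (auto simp: \<Phi>_def)
qed

section \<open>Day terms from congruence modularity of the variety\<close>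

text \<open>The kernel of the endomorphism of the free algebra that renames the four generators.\<close>

definition renaming_kernel :: "'f alg_theory \<Rightarrow> nat \<Rightarrow> nat \<Rightarrow> nat \<Rightarrow> nat \<Rightarrow> 'f trm \<Rightarrow> 'f trm \<Rightarrow> bool" where
  "renaming_kernel T a b c d s t \<longleftrightarrow>
     wf_trm T 4 s \<and> wf_trm T 4 t \<and> derivable T 4 (at_vars s a b c d) (at_vars t a b c d)"

lemma renaming_kernel_congruence:
  assumes T: "algebraic_theory T" and abcd: "a < 4" "b < 4" "c < 4" "d < 4"
  shows "term_congruence T 4 (renaming_kernel T a b c d)"
  unfolding term_congruence_def
proof (intro conjI allI impI ballI)
  fix s t assume "derivable T 4 s t"
  then show "renaming_kernel T a b c d s t"
    unfolding renaming_kernel_def at_vars_def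
    using derivable_wf[OF T] derivable_subst[OF T, of 4 s t 4 "quad (Var a) (Var b) (Var c) (Var d)"] abcd
    by (simp add: quad_def)
next
  fix f ss ts assume f: "f \<in> ops T" and l: "length ss = arity T f" "length ts = arity T f"
    and e: "\<forall>i<arity T f. renaming_kernel T a b c d (ss ! i) (ts ! i)"
  have "wf_trm T 4 (App f ss)" "wf_trm T 4 (App f ts)"
    using f l e by (auto simp: renaming_kernel_def in_set_conv_nth)
  moreover have "derivable T 4 (at_vars (App f ss) a b c d) (at_vars (App f ts) a b c d)"
    unfolding at_vars_def subst.simps
    by (rule derivable.app[OF f]) (use l e in \<open>simp_all add: renaming_kernel_def at_vars_def\<close>)
  ultimately show "renaming_kernel T a b c d (App f ss) (App f ts)" by (simp add: renaming_kernel_def)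
qed (auto simp: renaming_kernel_def intro: derivable.sym derivable.trans)

lemma term_congruence_conj:
  "term_congruence T n \<theta> \<Longrightarrow> term_congruence T n \<eta> \<Longrightarrow> term_congruence T n (\<lambda>s t. \<theta> s t \<and> \<eta> s t)"
  unfolding term_congruence_def by meson

text \<open>
  The join of two congruences of an ordinary algebra consists of finite alternating chains.  It is
  compatible because the arguments of an operation can be changed one at a time.
\<close>

lemma term_congruence_chains:
  assumes \<theta>: "term_congruence T n \<theta>" and \<eta>: "term_congruence T n \<eta>"
  defines "r \<equiv> {(s, t). \<theta> s t \<or> \<eta> s t}"
  shows "term_congruence T n (\<lambda>s t. wf_trm T n s \<and> wf_trm T n t \<and> (s, t) \<in> r\<^sup>*)"
proof -
  note th = term_congruenceD[OF \<theta>] and et = term_congruenceD[OF \<eta>]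
  have wf: "wf_trm T n s \<and> wf_trm T n t" if "(s, t) \<in> r" for s t using that th(1) et(1) unfolding r_def by blast
  have "sym r" unfolding sym_def r_def using th(3) et(3) by blast
  then have r_sym: "(t, s) \<in> r\<^sup>*" if "(s, t) \<in> r\<^sup>*" for s t using that sym_rtrancl unfolding sym_def by blast
  have th_refl: "\<theta> t t" and et_refl: "\<eta> t t" if "wf_trm T n t" for t
    using th(2) et(2) derivable.refl[OF that] by blast+
  have coord: "(App f (xs[j := s]), App f (xs[j := t])) \<in> r\<^sup>*"
    if f: "f \<in> ops T" and xs: "length xs = arity T f" "\<forall>t\<in>set xs. wf_trm T n t" and st: "(s, t) \<in> r\<^sup>*" for f xs j s t
    using st
  proof (induction rule: rtrancl_induct)
    case (step t u)
    have nth: "\<forall>i<arity T f. wf_trm T n (xs ! i)" using xs by simp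
    have "(App f (xs[j := t]), App f (xs[j := u])) \<in> r"
      using step(2) unfolding r_def
    proof (simp, elim disjE)
      assume tu: "\<theta> t u"
      have "\<theta> (App f (xs[j := t])) (App f (xs[j := u]))"
      proof (rule th(5)[OF f], simp add: xs(1), simp add: xs(1), intro allI impI)
        show "\<theta> (xs[j := t] ! i) (xs[j := u] ! i)" if "i < arity T f" for i
          using that xs(1) nth tu th_refl by (cases "i = j") simp_all
      qed
      then show "\<theta> (App f (xs[j := t])) (App f (xs[j := u])) \<or> \<eta> (App f (xs[j := t])) (App f (xs[j := u]))" ..
    next
      assume tu: "\<eta> t u"
      have "\<eta> (App f (xs[j := t])) (App f (xs[j := u]))"
      proof (rule et(5)[OF f], simp add: xs(1), simp add: xs(1), intro allI impI)
        show "\<eta> (xs[j := t] ! i) (xs[j := u] ! i)" if "i < arity T f" for i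
          using that xs(1) nth tu et_refl by (cases "i = j") simp_all
      qed
      then show "\<theta> (App f (xs[j := t])) (App f (xs[j := u])) \<or> \<eta> (App f (xs[j := t])) (App f (xs[j := u]))" ..
    qed
    then show ?case using step.IH by (rule rtrancl_into_rtrancl[rotated])
  qed simp
  have app: "wf_trm T n (App f ss) \<and> wf_trm T n (App f ts) \<and> (App f ss, App f ts) \<in> r\<^sup>*"
    if f: "f \<in> ops T" and l: "length ss = arity T f" "length ts = arity T f"
      and e: "\<forall>i<arity T f. wf_trm T n (ss ! i) \<and> wf_trm T n (ts ! i) \<and> (ss ! i, ts ! i) \<in> r\<^sup>*" for f ss ts
  proof -
    have w: "\<forall>t\<in>set ss. wf_trm T n t" "\<forall>t\<in>set ts. wf_trm T n t" using l e by (auto simp: in_set_conv_nth)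
    have "j \<le> arity T f \<Longrightarrow> (App f ss, App f (take j ts @ drop j ss)) \<in> r\<^sup>*" for j
    proof (induction j)
      case (Suc j)
      then have j: "j < arity T f" by simp
      let ?xs = "take j ts @ drop j ss"
      have len: "length ?xs = arity T f" using l j by simp
      have xs: "?xs[j := ss ! j] = ?xs" "?xs[j := ts ! j] = take (Suc j) ts @ drop (Suc j) ss"
        using l j by (auto simp: list_eq_iff_nth_eq nth_list_update nth_append min_def not_less_eq less_Suc_eq)
      have "\<forall>t\<in>set ?xs. wf_trm T n t" using w by (auto dest: in_set_takeD in_set_dropD)
      from coord[OF f len this, of "ss ! j" "ts ! j" j] e j
      have "(App f ?xs, App f (take (Suc j) ts @ drop (Suc j) ss)) \<in> r\<^sup>*" unfolding xs by blast
      then show ?case using Suc by (meson Suc_leD rtrancl_trans)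
    qed simp
    from this[of "arity T f"] show ?thesis using f l w by simp
  qed
  show ?thesis
    unfolding term_congruence_def
  proof (intro conjI allI impI ballI)
    fix s t assume d: "derivable T n s t"
    show "wf_trm T n s" "wf_trm T n t" using th(1)[OF th(2)[OF d]] by blast+
    show "(s, t) \<in> r\<^sup>*" using th(2)[OF d] unfolding r_def by blast
  next
    fix f ss ts assume "f \<in> ops T" "length ss = arity T f" "length ts = arity T f"
      "\<forall>i<arity T f. wf_trm T n (ss ! i) \<and> wf_trm T n (ts ! i) \<and> (ss ! i, ts ! i) \<in> r\<^sup>*"
    note app = app[OF this]
    show "wf_trm T n (App f ss)" "wf_trm T n (App f ts)" "(App f ss, App f ts) \<in> r\<^sup>*"
      by (rule app[THEN conjunct1], rule app[THEN conjunct2, THEN conjunct1], rule app[THEN conjunct2, THEN conjunct2])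
  qed (use r_sym in \<open>auto intro: rtrancl_trans\<close>)
qed

text \<open>
  Day's theorem.  In the free algebra on \<open>x, y, z, u\<close>, let \<open>\<alpha>, \<beta>, \<gamma>\<close> be the kernels of the
  renamings \<open>(x, y, y, u)\<close>, \<open>(x, x, u, u)\<close> and \<open>(x, y, y, x)\<close>.  Then \<open>\<alpha> \<subseteq> \<gamma>\<close>, and \<open>(x, u)\<close> lies in
  \<open>(\<alpha> \<or> \<beta>) \<and> \<gamma>\<close>, hence in \<open>\<alpha> \<or> (\<beta> \<and> \<gamma>)\<close>.  The chain that witnesses this is a Day chain.
\<close>

theorem day_terms_if_congruence_modular:
  fixes T :: "'f alg_theory"
  assumes T: "algebraic_theory T" and U: "adequate_universe TYPE('u) T"
    and mod: "congruence_modular (variety TYPE('u) T)"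
  shows "has_day_terms T"
proof -
  let ?S = "set_cat :: ('u set, 'u \<rightharpoonup> 'u) cat"
  have inf: "infinite (UNIV :: 'u set)" using U by (simp add: adequate_universe_def)
  interpret S: algebras_in_lex_category ?S T
    by unfold_locales (rule set_cat_finitely_complete[OF inf], rule T)
  obtain A :: "'u set \<times> ('f \<Rightarrow> 'u \<rightharpoonup> 'u)" and P and el :: "'f trm \<Rightarrow> 'u \<rightharpoonup> 'u"
    and \<Phi> :: "('f trm \<Rightarrow> 'f trm \<Rightarrow> bool) \<Rightarrow> 'u set \<Rightarrow> ('u \<rightharpoonup> 'u) \<Rightarrow> ('u \<rightharpoonup> 'u) \<Rightarrow> bool" where
    A: "A \<in> internal_algebras T ?S"
    and cong: "\<And>\<theta>. term_congruence T 4 \<theta> \<Longrightarrow> congruence T ?S A (\<Phi> \<theta>)"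
    and mono: "\<And>\<theta> \<eta>. \<forall>s t. \<theta> s t \<longrightarrow> \<eta> s t \<Longrightarrow> \<Phi> \<theta> \<sqsubseteq> \<Phi> \<eta>"
    and meet: "\<And>\<theta> \<eta>. \<Phi> \<theta> \<sqinter> \<Phi> \<eta> \<sqsubseteq> \<Phi> (\<lambda>s t. \<theta> s t \<and> \<eta> s t)"
    and el: "\<And>\<theta> s t. term_congruence T 4 \<theta> \<Longrightarrow> wf_trm T 4 s \<Longrightarrow> wf_trm T 4 t \<Longrightarrow> \<Phi> \<theta> P (el s) (el t) \<longleftrightarrow> \<theta> s t"
    by (rule free_algebra[OF T U, where n = 4]) (rule that)
  let ?\<alpha> = "renaming_kernel T 0 1 1 3" and ?\<beta> = "renaming_kernel T 0 0 3 3" and ?\<gamma> = "renaming_kernel T 0 1 1 0"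
  have \<alpha>: "term_congruence T 4 ?\<alpha>" and \<beta>: "term_congruence T 4 ?\<beta>" and \<gamma>: "term_congruence T 4 ?\<gamma>"
    by (rule renaming_kernel_congruence[OF T]; simp)+
  have \<alpha>\<gamma>: "?\<gamma> s t" if st: "?\<alpha> s t" for s t
  proof -
    have wf: "wf_trm T 4 s" "wf_trm T 4 t" using st by (auto simp: renaming_kernel_def)
    have "at_vars (at_vars r 0 1 1 3) 0 1 1 0 = at_vars r 0 1 1 0" if "wf_trm T 4 r" for r :: "'f trm"
      unfolding at_vars_def subst_subst by (rule subst_cong[OF that]) (simp add: quad_def)
    moreover have "derivable T 4 (at_vars (at_vars s 0 1 1 3) 0 1 1 0) (at_vars (at_vars t 0 1 1 3) 0 1 1 0)"
      unfolding at_vars_def[of "at_vars _ _ _ _ _"]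
      by (rule derivable_subst[OF T, of 4]) (use st in \<open>simp_all add: renaming_kernel_def quad_def\<close>)
    ultimately show ?thesis using wf by (simp add: renaming_kernel_def)
  qed
  let ?\<beta>\<gamma> = "\<lambda>s t. ?\<beta> s t \<and> ?\<gamma> s t"
  have \<beta>\<gamma>: "term_congruence T 4 ?\<beta>\<gamma>" by (rule term_congruence_conj[OF \<beta> \<gamma>])
  let ?r = "{(s, t). ?\<alpha> s t \<or> ?\<beta>\<gamma> s t}"
  let ?\<rho> = "\<lambda>s t. wf_trm T 4 s \<and> wf_trm T 4 t \<and> (s, t) \<in> ?r\<^sup>*"
  have \<rho>: "term_congruence T 4 ?\<rho>" by (rule term_congruence_chains[OF \<alpha> \<beta>\<gamma>])
  have m: "(\<forall>\<Phi> \<Psi>. congruence T ?S A \<Phi> \<and> congruence T ?S A \<Psi> \<longrightarrow> (\<exists>J. congruence_join T ?S A \<Phi> \<Psi> J)) \<and>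
     (\<forall>\<Phi> \<Psi> \<Gamma> J N. congruence T ?S A \<Phi> \<and> congruence T ?S A \<Psi> \<and> congruence T ?S A \<Gamma> \<and> \<Phi> \<sqsubseteq> \<Gamma> \<and>
        congruence_join T ?S A \<Phi> \<Psi> J \<and> congruence_join T ?S A \<Phi> (\<Psi> \<sqinter> \<Gamma>) N \<longrightarrow> J \<sqinter> \<Gamma> = N)"
    using mod A unfolding variety_def S.congruence_modular_iff by (rule bspec)
  note c = cong[OF \<alpha>] cong[OF \<beta>] cong[OF \<gamma>]
  obtain J where J: "congruence_join T ?S A (\<Phi> ?\<alpha>) (\<Phi> ?\<beta>) J" using m c by blast
  obtain N where N: "congruence_join T ?S A (\<Phi> ?\<alpha>) (\<Phi> ?\<beta> \<sqinter> \<Phi> ?\<gamma>) N"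
    using m c(1) S.congruence_meet[OF c(2,3)] by blast
  have \<Phi>\<alpha>\<gamma>: "\<Phi> ?\<alpha> \<sqsubseteq> \<Phi> ?\<gamma>" by (rule mono) (use \<alpha>\<gamma> in blast)
  have JN: "J \<sqinter> \<Phi> ?\<gamma> = N"
    by (rule m[THEN conjunct2, THEN spec, THEN spec, THEN spec, THEN spec, THEN spec, THEN mp])
      (rule conjI[OF c(1) conjI[OF c(2) conjI[OF c(3) conjI[OF \<Phi>\<alpha>\<gamma> conjI[OF J N]]]]])
  have "N \<sqsubseteq> \<Phi> ?\<rho>"
  proof (rule congruence_joinD(4)[OF N cong[OF \<rho>]])
    show "\<Phi> ?\<alpha> \<sqsubseteq> \<Phi> ?\<rho>" by (rule mono) (auto simp: renaming_kernel_def)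
    have "\<Phi> ?\<beta>\<gamma> \<sqsubseteq> \<Phi> ?\<rho>" by (rule mono) (auto simp: renaming_kernel_def)
    then show "\<Phi> ?\<beta> \<sqinter> \<Phi> ?\<gamma> \<sqsubseteq> \<Phi> ?\<rho>" using meet by blast
  qed
  moreover have "N P (el (Var 0)) (el (Var 3))"
  proof -
    have ker: "renaming_kernel T a b c d (Var i) (Var j)"
      if "i < 4" "j < 4" "quad a b c d i < 4" "quad a b c d i = quad a b c d j" for a b c d i j
    proof -
      have "at_vars (Var k :: 'f trm) a b c d = Var (quad a b c d k)" for k by (simp add: at_vars_def quad_def)
      then show ?thesis using that by (simp add: renaming_kernel_def derivable.refl)
    qed
    have "\<Phi> ?\<beta> P (el (Var 0)) (el (Var 1))" "\<Phi> ?\<alpha> P (el (Var 1)) (el (Var 2))"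
      "\<Phi> ?\<beta> P (el (Var 2)) (el (Var 3))" "\<Phi> ?\<gamma> P (el (Var 0)) (el (Var 3))"
      using el[OF \<alpha>] el[OF \<beta>] el[OF \<gamma>] ker by simp_all
    moreover from this have "J P (el (Var 0)) (el (Var 3))"
      using congruence_joinD[OF J] congruenceD(5)[OF congruence_joinD(1)[OF J]] by metis
    ultimately show ?thesis unfolding JN[symmetric] by blast
  qed
  ultimately have "?\<rho> (Var 0) (Var 3)" using el[OF \<rho>, of "Var 0" "Var 3"] by simp
  then have chain: "(Var 0, Var 3) \<in> ?r\<^sup>*" by blast
  have "?\<gamma> (Var 0) t \<and> (Var 0, t) \<in> (day_step T)\<^sup>*" if "(Var 0, t) \<in> ?r\<^sup>*" for t
    using that
  proof (induction rule: rtrancl_induct)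
    case base
    show ?case by (simp add: renaming_kernel_def at_vars_def derivable.refl)
  next
    case (step s t)
    note g = term_congruenceD[OF \<gamma>]
    have day: "day_term T r" if "?\<gamma> (Var 0) r" for r
      using that derivable.sym by (auto simp: day_term_def renaming_kernel_def at_vars_def)
    have "?\<gamma> s t" using step.hyps(2) \<alpha>\<gamma> by blast
    then have t: "?\<gamma> (Var 0) t" using step.IH g(4) by blast
    have "(s, t) \<in> day_step T"
      using step.hyps(2) day[OF t] day[of s] step.IH unfolding day_step_def renaming_kernel_def by auto
    then show ?case using step.IH t by (meson rtrancl.rtrancl_into_rtrancl)
  qed
  then show ?thesis unfolding has_day_terms_def using chain by blast
qed

section \<open>Internal algebras of a congruence modular theory\<close>

theorem theorem5p1:
  fixes T :: "'f alg_theory" and E :: "('o, 'm) cat"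
  assumes "algebraic_theory T"
    and "adequate_universe TYPE('u) T"
    and "congruence_modular (variety TYPE('u) T)"
  shows "(regular_category E \<and> has_chain_suprema E \<and>
            chain_suprema_stable_split_epi E \<and> chain_suprema_stable_intersection E
          \<longrightarrow> congruence_modular (algebra_cat T E)) \<and>
         (topos E \<and> has_chain_suprema E \<longrightarrow> congruence_modular (algebra_cat T E))"
proof (intro conjI impI; elim conjE)
  note day = day_terms_if_congruence_modular[OF assms]
  assume E: "regular_category E" and sup: "has_chain_suprema E"
    and stable: "chain_suprema_stable_split_epi E" "chain_suprema_stable_intersection E"
  interpret algebras_in_lex_category E T
    using E assms(1) by unfold_locales (auto simp: regular_category_def)
  show "congruence_modular (algebra_cat T E)"
    by (rule congruence_modular_if_day_terms[OF day regular_stable_images[OF E] sup chain_distributive_if_stable[OF stable]])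
next
  note day = day_terms_if_congruence_modular[OF assms]
  assume E: "topos E" and sup: "has_chain_suprema E"
  interpret algebras_in_lex_category E T
    using E assms(1) by unfold_locales (auto simp: topos_def)
  show "congruence_modular (algebra_cat T E)"
    by (rule congruence_modular_if_day_terms[OF day topos_stable_images[OF E] sup topos_chain_distributive[OF E]])
qed

end
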